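(* Let $d\ge3$. The correspondence between nonzero spinors and spin-decorated horospheres yields the following identifications (bijections), obtained by letting the columns of a $2\times d$ matrix be spinors $\kappa_1,\ldots,\kappa_d$ whose corresponding horospheres decorate the successive ideal vertices. (i) The decorated Teichmüller space $\widetilde T(d)$ of ideal $d$-gons in $\mathbb{H}^2$ is identified with the affine cone $X^+(d)$ on the positive Grassmannian $\mathrm{Gr}^+(2,d)$: the class of a real matrix with columns $\kappa_1,\ldots,\kappa_d$ and all Plücker coordinates positive corresponds to the class of the decorated ideal $d$-gon whose horocycles are those of $\kappa_1,\ldots,\kappa_d$. (ii) The decorated Teichmüller space $\widetilde T^3(d)$ of skew ideal $d$-gons in $\mathbb{H}^3$ is identified with the affine cone $X^*(d)$ on the subvariety of the complex Grassmannian $\mathrm{Gr}(2,d)$ where all Plücker coordinates are nonzero: the class of a complex matrix with columns $\kappa_1,\ldots,\kappa_d$ and all Plücker coordinates nonzero corresponds to the class of the spin-decorated skew ideal $d$-gon whose spin-decorated horospheres are those of $\kappa_1,\ldots,\kappa_d$. Under each identification, lambda lengths correspond to Plücker coordinates: $\lambda_{ij}=p_{ij}$ for all $i<j$.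
   Context: Spinors and horospheres. A spinor is an element $\kappa=(\xi,\eta)\in\mathbb{C}^2$, viewed as a column vector. Let $\mathbb{U}^3=\{(x,y,z):z>0\}$ be the upper half space model of $\mathbb{H}^3$, with boundary $\mathbb{C}\cup\{\infty\}$, $(x,y)\leftrightarrow x+yi$. A decoration on a horosphere $H$ is a tangent oriented line field invariant under all parabolic isometries fixing $H$ (equivalently a parallel unit tangent vector field $v$). The centre of $H$ is its point at infinity. If $H$ is centred at $\infty$ it is a horizontal plane, whose $z$-coordinate is its height, and a decoration is specified by $w\in\mathbb{C}\setminus\{0\}$ if it points in direction $(\mathrm{Re}\,w,\mathrm{Im}\,w,0)$; otherwise $H$ is a sphere tangent to $\mathbb{C}$, and a decoration is north-pole specified by $w$ if it points in that direction at the highest point. The decorated horosphere of a nonzero spinor $(\xi,\eta)$ has centre $\xi/\eta$; if $\eta\neq0$ it has Euclidean diameter $|\eta|^{-2}$ and decoration north-pole specified by $i\eta^{-2}$; if $\eta=0$ it has height $|\xi|^2$ and decoration specified by $i\xi^2$. Spin decorations. A frame is a right-handed orthonormal frame at a point of $\mathbb{H}^3$; $\mathrm{Fr}\to\mathbb{H}^3$ is the bundle of frames and $\mathrm{Fr}^S$ its double (universal) cover, whose points are spin frames. $PSL(2,\mathbb{C})$ acts on $\mathrm{Fr}$ by orientation-preserving isometries, lifting to an action of $SL(2,\mathbb{C})$ on $\mathrm{Fr}^S$ (spin isometries). Rotations and translations of spin frames are obtained by lifting paths of rotated/translated frames. Let $N^{out}$ (resp. $N^{in}$) be the unit normal field along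 $H$ pointing towards (resp. away from) its centre. A spin decoration on $H$ is a pair $W=(W^{in},W^{out})$ of continuous lifts to $\mathrm{Fr}^S$ of the frame fields $(N^{in},v,N^{in}\times v)$ and $(N^{out},v,N^{out}\times v)$ along $H$, for some decoration $v$, such that $W^{out}$ is obtained from $W^{in}$ by rotation of angle $-\pi$ about $v$ at each point (equivalently $W^{in}$ from $W^{out}$ by rotation of angle $\pi$ about $v$). The space of spin-decorated horospheres $\mathrm{Hor}^S$ is the connected double cover of the space $\mathrm{Hor}^D$ of decorated horospheres. The correspondence from nonzero spinors to spin-decorated horospheres is a (fixed, arbitrarily chosen) continuous lift $\mathbb{C}^2\setminus\{0\}\to\mathrm{Hor}^S$ of the map $\mathbb{C}^2\setminus\{0\}\to\mathrm{Hor}^D$ that sends a nonzero spinor $(\xi,\eta)$ to its decorated horosphere (the one with centre $\xi/\eta$ which, if $\eta\neq0$, has Euclidean diameter $|\eta|^{-2}$ and decoration north-pole specified by $i\eta^{-2}$, and, if $\eta=0$, has height $|\xi|^2$ and decoration specified by $i\xi^2$); it is an $SL(2,\mathbb{C})$-equivariant bijection. Complex lambda lengths. A spin frame at a point of an oriented geodesic $\gamma$ is adapted to $\gamma$ if it lifts a frame whose first vector is positively tangent to $\gamma$. The complex distance from one adapted spin frame to another is $\rho+i\theta$ (well defined mod $4\pi i$), where translation along $\gamma$ by signed distance $\rho$ followed by rotation about $\gamma$ by angle $\theta$ takes the first to the second. For $(H_i,W_i),(H_j,W_j)$ with distinct centres $z_i,z_j$, let $\gamma_{ij}$ be the oriented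 geodesic from $z_i$ to $z_j$, meeting $H_i,H_j$ at $p_i,p_j$; the complex lambda length is $\lambda_{ij}=\exp(d_{ij}/2)$, with $d_{ij}$ the complex distance from $W_i^{in}(p_i)$ to $W_j^{out}(p_j)$. Two dimensions. $\mathbb{U}^2\subset\mathbb{U}^3$ is the upper half plane with boundary $\mathbb{R}\cup\{\infty\}$, where the boundary circle is oriented in the negative real direction. The horocycle of a real nonzero spinor is the intersection of its horosphere with $\mathbb{U}^2$. An ideal $d$-gon is a collection of distinct points $z_1,\ldots,z_d\in\partial\mathbb{U}^2$ labelled in order around the oriented boundary, i.e. for some $k$ either all are real and $z_k>z_{k+1}>\cdots>z_d>z_1>\cdots>z_{k-1}$, or $z_k=\infty$ and $z_{k+1}>\cdots>z_d>z_1>\cdots>z_{k-1}$. A decoration on it is a choice of horocycle centred at each $z_i$. $\widetilde T(d)$ is the set of decorated ideal $d$-gons up to orientation-preserving isometries $PSL(2,\mathbb{R})$ of $\mathbb{U}^2$. In the 2-dimensional setting the lambda length between horocycles at $z_i,z_j$ is the real number $\lambda_{ij}=\exp(\rho_{ij}/2)$, where $\rho_{ij}$ is the signed distance between the horocycles along their common perpendicular geodesic (positive when the horodiscs are disjoint). Three dimensions. A skew ideal $d$-gon is a collection of distinct points $z_1,\ldots,z_d\in\partial\mathbb{U}^3$; a spin decoration on it is a choice of spin-decorated horosphere centred at each $z_i$. $\widetilde T^3(d)$ is the set of spin-decorated skew ideal $d$-gons up to the action of the spin isometry group $SL(2,\mathbb{C})$. Grassmannians. The Plücker coordinates $p_{ij}$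 ($i<j$) of a $2\times d$ matrix are its $2\times2$ minors from columns $i,j$. $\mathrm{Mat}^+_{\mathbb{R}}(2,d)$ is the set of real $2\times d$ matrices with all $p_{ij}>0$, and $\mathrm{Gr}^+(2,d)$ is its quotient by the left action of $GL^+(2,\mathbb{R})$. $\mathrm{Mat}^*_{\mathbb{C}}(2,d)$ is the set of complex $2\times d$ matrices with all $p_{ij}\ne0$, and $\mathrm{Gr}^*_{\mathbb{C}}(2,d)$ is its quotient by the left action of $GL(2,\mathbb{C})$. The affine cone $X^+(d)$ on $\mathrm{Gr}^+(2,d)$ (resp. $X^*(d)$ on $\mathrm{Gr}^*_{\mathbb{C}}(2,d)$) is the set of decomposable elements $R_1\wedge R_2\in\Lambda^2(\mathbb{R}^d)$ (resp. $\Lambda^2(\mathbb{C}^d)$), where $R_1,R_2$ are the rows of a matrix in $\mathrm{Mat}^+_{\mathbb{R}}(2,d)$ (resp. $\mathrm{Mat}^*_{\mathbb{C}}(2,d)$); equivalently it is the quotient of $\mathrm{Mat}^+_{\mathbb{R}}(2,d)$ by $SL(2,\mathbb{R})$ (resp. of $\mathrm{Mat}^*_{\mathbb{C}}(2,d)$ by $SL(2,\mathbb{C})$). The $p_{ij}$ are well-defined functions on these cones. *)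

theory Defs
  imports "HOL-Analysis.Analysis"
begin

section \<open>Upper half space and its isometries\<close>

definition upt3 :: "complex \<Rightarrow> real \<Rightarrow> real^3"
  where "upt3 z t = vector [Re z, Im z, t]"

definition U3 :: "(real^3) set"
  where "U3 = {p. p $ 3 > 0}"

definition U2 :: "(real^3) set"
  where "U2 = {p \<in> U3. p $ 2 = 0}"

definition hyp_dist :: "real^3 \<Rightarrow> real^3 \<Rightarrow> real"
  where "hyp_dist p q = arcosh (1 + (dist p q)\<^sup>2 / (2 * p $ 3 * q $ 3))"

datatype bdry = Fin complex | Infty

definition SL2 :: "('a::comm_ring_1^2^2) set"
  where "SL2 = {A. det A = 1}"

definition cvec :: "real^2 \<Rightarrow> complex^2"
  where "cvec x = (\<chi> i. complex_of_real (x $ i))"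

definition mobius :: "complex^2^2 \<Rightarrow> bdry \<Rightarrow> bdry"
  where "mobius A z = (case z of
      Infty \<Rightarrow> if A$2$1 = 0 then Infty else Fin (A$1$1 / A$2$1)
    | Fin w \<Rightarrow> if A$2$1 * w + A$2$2 = 0 then Infty
              else Fin ((A$1$1 * w + A$1$2) / (A$2$1 * w + A$2$2)))"

(* Poincare extension of the Moebius transformation of A \<in> SL2 to the upper half space *)
definition act :: "complex^2^2 \<Rightarrow> real^3 \<Rightarrow> real^3"
  where "act A p =
    (let a = A$1$1; b = A$1$2; c = A$2$1; d = A$2$2;
         z = Complex (p$1) (p$2); t = p$3;
         D = (cmod (c * z + d))\<^sup>2 + (cmod c)\<^sup>2 * t\<^sup>2
     in upt3 (((a * z + b) * cnj (c * z + d) + a * cnj c * of_real (t\<^sup>2)) / of_real D) (t / D))"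

(* Oriented geodesics from z to w: isometric images of the geodesic s \<mapsto> (0,0,exp s) from 0 to
   \<infinity>, whose parameter s is hyperbolic arc length. *)
definition unit_geodesic :: "bdry \<Rightarrow> bdry \<Rightarrow> (real \<Rightarrow> real^3) \<Rightarrow> bool"
  where "unit_geodesic z w \<gamma> \<longleftrightarrow>
    (\<exists>B\<in>SL2. mobius B (Fin 0) = z \<and> mobius B Infty = w \<and> \<gamma> = (\<lambda>s. act B (upt3 0 (exp s))))"

definition geodesic :: "bdry \<Rightarrow> bdry \<Rightarrow> (real^3) set"
  where "geodesic z w = {p. \<exists>\<gamma> s. unit_geodesic z w \<gamma> \<and> p = \<gamma> s}"


section \<open>Frames and spin frames\<close>

(* Base point, then the three vectors of the frame. Tangent vectors at p \<in> U3 are elements of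
   \<real>^3 with the hyperbolic inner product u \<bullet> v / (p $ 3)^2. *)
type_synonym frame = "(real^3) \<times> (real^3) \<times> (real^3) \<times> (real^3)"

(* cross product of tangent vectors at p for the hyperbolic metric *)
definition hyp_cross :: "real^3 \<Rightarrow> real^3 \<Rightarrow> real^3 \<Rightarrow> real^3"
  where "hyp_cross p u v = (1 / p $ 3) *\<^sub>R cross3 u v"

definition act_tangent :: "complex^2^2 \<Rightarrow> real^3 \<Rightarrow> real^3 \<Rightarrow> real^3"
  where "act_tangent A p = frechet_derivative (act A) (at p)"

fun act_frame :: "complex^2^2 \<Rightarrow> frame \<Rightarrow> frame"
  where "act_frame A (p, f1, f2, f3) =
    (act A p, act_tangent A p f1, act_tangent A p f2, act_tangent A p f3)"

definition base_frame :: frame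
  where "base_frame = (upt3 0 1, axis 1 1, axis 2 1, axis 3 1)"

(* The group PSL(2,C) acts simply transitively on right-handed orthonormal frames, so the frame
   bundle is PSL(2,C) and its universal double cover is SL(2,C): a spin frame is an element A of SL2,
   lying over the frame frame_of A; spin isometries act on spin frames by left multiplication. *)
type_synonym spin_frame = "complex^2^2"

definition frame_of :: "spin_frame \<Rightarrow> frame"
  where "frame_of A = act_frame A base_frame"

definition lifts_path :: "(real \<Rightarrow> frame) \<Rightarrow> spin_frame \<Rightarrow> spin_frame \<Rightarrow> bool"
  where "lifts_path c F G \<longleftrightarrow>
    (\<exists>g. path g \<and> path_image g \<subseteq> SL2 \<and> pathstart g = F \<and> pathfinish g = G \<and>
         (\<forall>t\<in>{0..1}. frame_of (g t) = c t))"

(* right-handed rotations by \<theta> about the first, resp. second, vector of a frame *)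
fun rot_first :: "real \<Rightarrow> frame \<Rightarrow> frame"
  where "rot_first \<theta> (p, f1, f2, f3) =
    (p, f1, cos \<theta> *\<^sub>R f2 + sin \<theta> *\<^sub>R f3, cos \<theta> *\<^sub>R f3 - sin \<theta> *\<^sub>R f2)"

fun rot_second :: "real \<Rightarrow> frame \<Rightarrow> frame"
  where "rot_second \<theta> (p, f1, f2, f3) =
    (p, cos \<theta> *\<^sub>R f1 - sin \<theta> *\<^sub>R f3, f2, cos \<theta> *\<^sub>R f3 + sin \<theta> *\<^sub>R f1)"

definition spin_rot_first :: "real \<Rightarrow> spin_frame \<Rightarrow> spin_frame \<Rightarrow> bool"
  where "spin_rot_first \<theta> F G \<longleftrightarrow> lifts_path (\<lambda>t. rot_first (t * \<theta>) (frame_of F)) F G"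

definition spin_rot_second :: "real \<Rightarrow> spin_frame \<Rightarrow> spin_frame \<Rightarrow> bool"
  where "spin_rot_second \<theta> F G \<longleftrightarrow> lifts_path (\<lambda>t. rot_second (t * \<theta>) (frame_of F)) F G"

(* translation by \<rho> along the geodesic from 0 to \<infinity> *)
definition axis_translation :: "real \<Rightarrow> complex^2^2"
  where "axis_translation \<rho> =
    vector [vector [of_real (exp (\<rho> / 2)), 0], vector [0, of_real (exp (- \<rho> / 2))]]"

(* translation by signed distance \<rho> along the geodesic from z to w *)
definition spin_translate :: "bdry \<Rightarrow> bdry \<Rightarrow> real \<Rightarrow> spin_frame \<Rightarrow> spin_frame \<Rightarrow> bool"
  where "spin_translate z w \<rho> F G \<longleftrightarrow>
    (\<exists>B\<in>SL2. mobius B (Fin 0) = z \<and> mobius B Infty = w \<and>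
      lifts_path (\<lambda>t. act_frame (B ** axis_translation (t * \<rho>) ** matrix_inv B) (frame_of F)) F G)"

definition adapted :: "bdry \<Rightarrow> bdry \<Rightarrow> spin_frame \<Rightarrow> bool"
  where "adapted z w F \<longleftrightarrow> F \<in> SL2 \<and>
    (\<exists>\<gamma> s. unit_geodesic z w \<gamma> \<and> fst (frame_of F) = \<gamma> s \<and>
           fst (snd (frame_of F)) = vector_derivative \<gamma> (at s))"

(* d = \<rho> + i\<theta> is a value of the complex distance (defined modulo 4\<pi>i) *)
definition complex_distance ::
    "bdry \<Rightarrow> bdry \<Rightarrow> spin_frame \<Rightarrow> spin_frame \<Rightarrow> complex \<Rightarrow> bool"
  where "complex_distance z w F G d \<longleftrightarrow> adapted z w F \<and> adapted z w G \<and>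
    (\<exists>E. spin_translate z w (Re d) F E \<and> spin_rot_first (Im d) E G)"


section \<open>Horospheres and decorations\<close>

(* r is the height if the centre is \<infinity>, and the Euclidean diameter otherwise *)
definition horosphere :: "bdry \<Rightarrow> real \<Rightarrow> (real^3) set"
  where "horosphere z r = (case z of
      Infty \<Rightarrow> {p. p $ 3 = r}
    | Fin w \<Rightarrow> U3 \<inter> sphere (upt3 w (r / 2)) (r / 2))"

definition horoball :: "bdry \<Rightarrow> real \<Rightarrow> (real^3) set"
  where "horoball z r = (case z of
      Infty \<Rightarrow> {p. p $ 3 > r}
    | Fin w \<Rightarrow> ball (upt3 w (r / 2)) (r / 2))"

(* hyperbolic unit normals at p \<in> horosphere z r, pointing towards resp. away from z *)
definition Nout :: "bdry \<Rightarrow> real \<Rightarrow> real^3 \<Rightarrow> real^3"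
  where "Nout z r p = (case z of
      Infty \<Rightarrow> p $ 3 *\<^sub>R axis 3 1
    | Fin w \<Rightarrow> (p $ 3 / (r / 2)) *\<^sub>R (upt3 w (r / 2) - p))"

definition Nin :: "bdry \<Rightarrow> real \<Rightarrow> real^3 \<Rightarrow> real^3"
  where "Nin z r p = - Nout z r p"

definition parabolic :: "complex^2^2 \<Rightarrow> bool"
  where "parabolic A \<longleftrightarrow> A \<in> SL2 \<and> (trace A)\<^sup>2 = 4 \<and> A \<noteq> mat 1 \<and> A \<noteq> - mat 1"

definition decoration :: "bdry \<Rightarrow> real \<Rightarrow> (real^3 \<Rightarrow> real^3) \<Rightarrow> bool"
  where "decoration z r v \<longleftrightarrow>
    (\<forall>p\<in>horosphere z r. norm (v p) = p $ 3 \<and> v p \<bullet> Nout z r p = 0) \<and>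
    (\<forall>A. parabolic A \<and> act A ` horosphere z r = horosphere z r \<longrightarrow>
       (\<forall>p\<in>horosphere z r. act_tangent A p (v p) = v (act A p)))"

(* specified by w at every point if z = \<infinity>, and north-pole specified by w otherwise *)
definition specified_by :: "bdry \<Rightarrow> real \<Rightarrow> (real^3 \<Rightarrow> real^3) \<Rightarrow> complex \<Rightarrow> bool"
  where "specified_by z r v w \<longleftrightarrow> (case z of
      Infty \<Rightarrow> \<forall>p\<in>horosphere z r. \<exists>c>0. v p = c *\<^sub>R upt3 w 0
    | Fin u \<Rightarrow> \<exists>c>0. v (upt3 u r) = c *\<^sub>R upt3 w 0)"

(* a horosphere H with its lifts (W^in, W^out) along H, normalised to be undefined off H *)
type_synonym spin_horosphere =
  "(real^3) set \<times> (real^3 \<Rightarrow> spin_frame) \<times> (real^3 \<Rightarrow> spin_frame)"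

definition spin_decoration ::
    "bdry \<Rightarrow> real \<Rightarrow> (real^3 \<Rightarrow> real^3) \<Rightarrow> (real^3 \<Rightarrow> spin_frame) \<Rightarrow> (real^3 \<Rightarrow> spin_frame) \<Rightarrow> bool"
  where "spin_decoration z r v Win Wout \<longleftrightarrow>
    (let H = horosphere z r in
      Win \<in> H \<rightarrow>\<^sub>E SL2 \<and> Wout \<in> H \<rightarrow>\<^sub>E SL2 \<and> continuous_on H Win \<and> continuous_on H Wout \<and>
      (\<forall>p\<in>H. frame_of (Win p) = (p, Nin z r p, v p, hyp_cross p (Nin z r p) (v p)) \<and>
             frame_of (Wout p) = (p, Nout z r p, v p, hyp_cross p (Nout z r p) (v p)) \<and>
             spin_rot_second (- pi) (Win p) (Wout p)))"

definition HorS_at :: "bdry \<Rightarrow> spin_horosphere set"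
  where "HorS_at z = {(H, Win, Wout). \<exists>r v. r > 0 \<and> H = horosphere z r \<and>
    decoration z r v \<and> spin_decoration z r v Win Wout}"

definition HorS :: "spin_horosphere set"
  where "HorS = (\<Union>z. HorS_at z)"

(* Every spin frame F is W^in(p) for exactly one spin-decorated horosphere, where p is the base
   point of F. This is the quotient topology of the resulting map from spin frames to HorS: that
   map is open, so the images of open sets V form a basis. *)
definition HorS_topology :: "spin_horosphere topology"
  where "HorS_topology = topology_generated_by
    {{(H, Win, Wout) \<in> HorS. \<exists>p\<in>H. Win p \<in> V} |V. open V}"

fun act_spin_horosphere :: "complex^2^2 \<Rightarrow> spin_horosphere \<Rightarrow> spin_horosphere"
  where "act_spin_horosphere A (H, Win, Wout) =
    (act A ` H,
     restrict (\<lambda>q. A ** Win (act (matrix_inv A) q)) (act A ` H),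
     restrict (\<lambda>q. A ** Wout (act (matrix_inv A) q)) (act A ` H))"


section \<open>Spinors\<close>

definition spinor_centre :: "complex^2 \<Rightarrow> bdry"
  where "spinor_centre \<kappa> = (if \<kappa>$2 = 0 then Infty else Fin (\<kappa>$1 / \<kappa>$2))"

definition spinor_size :: "complex^2 \<Rightarrow> real"
  where "spinor_size \<kappa> = (if \<kappa>$2 = 0 then (cmod (\<kappa>$1))\<^sup>2 else 1 / (cmod (\<kappa>$2))\<^sup>2)"

definition spinor_direction :: "complex^2 \<Rightarrow> complex"
  where "spinor_direction \<kappa> = (if \<kappa>$2 = 0 then \<i> * (\<kappa>$1)\<^sup>2 else \<i> / (\<kappa>$2)\<^sup>2)"

definition spinor_horosphere :: "complex^2 \<Rightarrow> (real^3) set"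
  where "spinor_horosphere \<kappa> = horosphere (spinor_centre \<kappa>) (spinor_size \<kappa>)"

definition lies_over_spinor :: "spin_horosphere \<Rightarrow> complex^2 \<Rightarrow> bool"
  where "lies_over_spinor S \<kappa> \<longleftrightarrow>
    (case S of (H, Win, Wout) \<Rightarrow> H = spinor_horosphere \<kappa> \<and>
      (\<exists>v. decoration (spinor_centre \<kappa>) (spinor_size \<kappa>) v \<and>
           specified_by (spinor_centre \<kappa>) (spinor_size \<kappa>) v (spinor_direction \<kappa>) \<and>
           spin_decoration (spinor_centre \<kappa>) (spinor_size \<kappa>) v Win Wout))"

definition spinor_correspondence :: "(complex^2 \<Rightarrow> spin_horosphere) \<Rightarrow> bool"
  where "spinor_correspondence \<Phi> \<longleftrightarrow>
    continuous_map (top_of_set (- {0})) HorS_topology \<Phi> \<and>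
    (\<forall>\<kappa>. \<kappa> \<noteq> 0 \<longrightarrow> lies_over_spinor (\<Phi> \<kappa>) \<kappa>)"


section \<open>Lambda lengths\<close>

definition complex_lambda ::
    "bdry \<times> spin_horosphere \<Rightarrow> bdry \<times> spin_horosphere \<Rightarrow> complex"
  where "complex_lambda S T = (case (S, T) of
    ((z, H, Win, Wout), (z', H', Win', Wout')) \<Rightarrow>
      THE l. \<exists>p q d. p \<in> geodesic z z' \<inter> H \<and> q \<in> geodesic z z' \<inter> H' \<and>
        complex_distance z z' (Win p) (Wout' q) d \<and> l = exp (d / 2))"

definition horocycle :: "bdry \<Rightarrow> real \<Rightarrow> (real^3) set"
  where "horocycle z r = horosphere z r \<inter> U2"

definition signed_distance :: "bdry \<times> (real^3) set \<Rightarrow> bdry \<times> (real^3) set \<Rightarrow> real"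
  where "signed_distance S T = (case (S, T) of ((z, C), (z', C')) \<Rightarrow>
    THE \<rho>. \<exists>r r' p q. r > 0 \<and> r' > 0 \<and> C = horocycle z r \<and> C' = horocycle z' r' \<and>
      p \<in> geodesic z z' \<inter> C \<and> q \<in> geodesic z z' \<inter> C' \<and>
      \<rho> = (if horoball z r \<inter> horoball z' r' \<inter> U2 = {} then hyp_dist p q else - hyp_dist p q))"

definition real_lambda :: "bdry \<times> (real^3) set \<Rightarrow> bdry \<times> (real^3) set \<Rightarrow> real"
  where "real_lambda S T = exp (signed_distance S T / 2)"


section \<open>Decorated ideal polygons\<close>

(* With s m the index m steps after k in the cyclic order of {1..d}: either z (s 0) > \<dots> > z (s (d-1))
   are all real, or z (s 0) = \<infinity> and z (s 1) > \<dots> > z (s (d-1)) are real. *)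
definition ideal_polygon :: "nat \<Rightarrow> (nat \<Rightarrow> bdry) \<Rightarrow> bool"
  where "ideal_polygon d z \<longleftrightarrow>
    (\<exists>k\<in>{1..d}. \<exists>x :: nat \<Rightarrow> real. let s = (\<lambda>m. (k - 1 + m) mod d + 1) in
      ((\<forall>m\<in>{0..<d}. z (s m) = Fin (of_real (x m))) \<and>
        (\<forall>m n. m < n \<and> n < d \<longrightarrow> x m > x n)) \<or>
      (z k = Infty \<and> (\<forall>m\<in>{1..<d}. z (s m) = Fin (of_real (x m))) \<and>
        (\<forall>m n. 1 \<le> m \<and> m < n \<and> n < d \<longrightarrow> x m > x n)))"

definition dec_polygons :: "nat \<Rightarrow> (nat \<Rightarrow> bdry \<times> (real^3) set) set"
  where "dec_polygons d = {P \<in> extensional {1..d}.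
    ideal_polygon d (\<lambda>i. fst (P i)) \<and>
    (\<forall>i\<in>{1..d}. \<exists>r>0. snd (P i) = horocycle (fst (P i)) r)}"

definition dec_polygon_rel ::
    "nat \<Rightarrow> ((nat \<Rightarrow> bdry \<times> (real^3) set) \<times> (nat \<Rightarrow> bdry \<times> (real^3) set)) set"
  where "dec_polygon_rel d = {(P, Q). P \<in> dec_polygons d \<and> Q \<in> dec_polygons d \<and>
    (\<exists>A :: real^2^2 \<in> SL2. let A' = map_matrix complex_of_real A in
      \<forall>i\<in>{1..d}. Q i = (mobius A' (fst (P i)), act A' ` snd (P i)))}"

definition Teich2 :: "nat \<Rightarrow> (nat \<Rightarrow> bdry \<times> (real^3) set) set set"
  where "Teich2 d = dec_polygons d // dec_polygon_rel d"

definition spin_polygons :: "nat \<Rightarrow> (nat \<Rightarrow> bdry \<times> spin_horosphere) set"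
  where "spin_polygons d = {P \<in> extensional {1..d}.
    inj_on (\<lambda>i. fst (P i)) {1..d} \<and> (\<forall>i\<in>{1..d}. snd (P i) \<in> HorS_at (fst (P i)))}"

definition spin_polygon_rel ::
    "nat \<Rightarrow> ((nat \<Rightarrow> bdry \<times> spin_horosphere) \<times> (nat \<Rightarrow> bdry \<times> spin_horosphere)) set"
  where "spin_polygon_rel d = {(P, Q). P \<in> spin_polygons d \<and> Q \<in> spin_polygons d \<and>
    (\<exists>A\<in>SL2. \<forall>i\<in>{1..d}. Q i = (mobius A (fst (P i)), act_spin_horosphere A (snd (P i))))}"

definition Teich3 :: "nat \<Rightarrow> (nat \<Rightarrow> bdry \<times> spin_horosphere) set set"
  where "Teich3 d = spin_polygons d // spin_polygon_rel d"

definition horocycle_polygon :: "nat \<Rightarrow> (nat \<Rightarrow> real^2) \<Rightarrow> nat \<Rightarrow> bdry \<times> (real^3) set"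
  where "horocycle_polygon d M =
    (\<lambda>i\<in>{1..d}. (spinor_centre (cvec (M i)), spinor_horosphere (cvec (M i)) \<inter> U2))"

definition horosphere_polygon ::
    "(complex^2 \<Rightarrow> spin_horosphere) \<Rightarrow> nat \<Rightarrow> (nat \<Rightarrow> complex^2) \<Rightarrow> nat \<Rightarrow> bdry \<times> spin_horosphere"
  where "horosphere_polygon \<Phi> d M = (\<lambda>i\<in>{1..d}. (spinor_centre (M i), \<Phi> (M i)))"


section \<open>Affine cones on Grassmannians\<close>

(* a 2 x d matrix is the family of its columns M i, i \<in> {1..d} *)
definition plucker :: "(nat \<Rightarrow> ('a::comm_ring_1)^2) \<Rightarrow> nat \<Rightarrow> nat \<Rightarrow> 'a"
  where "plucker M i j = det (transpose (vector [M i, M j]))"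

definition Mat_pos :: "nat \<Rightarrow> (nat \<Rightarrow> real^2) set"
  where "Mat_pos d = {M \<in> extensional {1..d}. \<forall>i\<in>{1..d}. \<forall>j\<in>{1..d}. i < j \<longrightarrow> plucker M i j > 0}"

definition Mat_nz :: "nat \<Rightarrow> (nat \<Rightarrow> complex^2) set"
  where "Mat_nz d = {M \<in> extensional {1..d}. \<forall>i\<in>{1..d}. \<forall>j\<in>{1..d}. i < j \<longrightarrow> plucker M i j \<noteq> 0}"

(* \<Lambda>^2(K^d) as the antisymmetric d x d arrays, with u \<and> v = u \<otimes> v - v \<otimes> u *)
definition wedge :: "nat \<Rightarrow> (nat \<Rightarrow> 'a::comm_ring_1) \<Rightarrow> (nat \<Rightarrow> 'a) \<Rightarrow> nat \<times> nat \<Rightarrow> 'a"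
  where "wedge d u v = (\<lambda>(i, j)\<in>{1..d} \<times> {1..d}. u i * v j - v i * u j)"

definition row_wedge :: "nat \<Rightarrow> (nat \<Rightarrow> ('a::comm_ring_1)^2) \<Rightarrow> nat \<times> nat \<Rightarrow> 'a"
  where "row_wedge d M = wedge d (\<lambda>i. M i $ 1) (\<lambda>i. M i $ 2)"

definition cone_pos :: "nat \<Rightarrow> (nat \<times> nat \<Rightarrow> real) set"
  where "cone_pos d = row_wedge d ` Mat_pos d"

definition cone_nz :: "nat \<Rightarrow> (nat \<times> nat \<Rightarrow> complex) set"
  where "cone_nz d = row_wedge d ` Mat_nz d"

end

theory Submission
  imports Defs
begin

text \<open>
Both identifications come from one observation: a spin frame is a matrix \<open>F \<in> SL(2,\<complex>)\<close>, and the inward spin frames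
of a spin-decorated horosphere are exactly the matrices \<open>G ** rot2 (pi / 2)\<close> where \<open>G\<close> has a fixed first column \<open>\<kappa>\<close>. This
column is the spinor. The relation \<open>carries \<kappa> S\<close> expresses this description; it is visibly equivariant under left
multiplication, and a spin-decorated horosphere and its spinor determine each other.

That every spin decoration arises in this way (\<open>spin_decoration_carries\<close>) rests on three facts. The inward normal determines
the centre and the size of \<open>\<kappa>\<close> (\<open>inward_normal_iff\<close>); a decoration is invariant under parabolics, hence determined by its value at
one point (\<open>decoration_parallel\<close>); and a frame determines its spin frame up to sign (\<open>frame_vec_inj_up_to_sign\<close>), where the sign is
constant along the connected horosphere. The same sign argument on \<open>\<complex>\<^sup>2 - {0}\<close> shows that any spinor correspondence is the
canonical bijection up to one global sign (\<open>spinor_correspondence_carries\<close>).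

Lambda lengths are computed in coordinates in which the geodesic between the centres runs from \<open>0\<close> to \<open>\<infinity>\<close>. There, translation
by \<open>\<rho>\<close> followed by rotation by \<open>\<theta>\<close> is the diagonal matrix with entry \<open>exp ((\<rho> + \<i>\<theta>) / 2)\<close>, and it takes the inward frame of
the first horosphere to the outward frame of the second exactly if this entry is the determinant of the two spinors
(\<open>complex_lambda_carries\<close>). In the real case the hyperbolic distance and the position of the horodiscs are read off from the
functions \<open>busemann \<kappa>\<close>, whose level sets are the horospheres (\<open>real_lambda_det2\<close>).

The polygons are then families of spinors. Two matrices have the same minors if and only if they differ by \<open>SL(2)\<close>
(\<open>equal_minors_SL2\<close>, \<open>det2_SL2\<close>), so classes of polygons correspond to points of the cone. In three dimensions distinctness of
the centres means that the minors are nonzero. In two dimensions the spinors are determined only up to individual signs, and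
the point is that the cyclic order of the vertices holds exactly if the signs can be chosen to make all minors positive
(\<open>Mat_pos_ideal_polygon\<close>, \<open>ideal_polygon_Mat_pos\<close>).
\<close>

section \<open>Two by two matrices of determinant one\<close>

definition mat22 :: "'a \<Rightarrow> 'a \<Rightarrow> 'a \<Rightarrow> 'a \<Rightarrow> 'a::zero^2^2"
  where "mat22 a b c d = vector [vector [a, b], vector [c, d]]"

text \<open>The adjugate, which for determinant \<open>1\<close> is an explicit inverse.\<close>

definition adj22 :: "'a::comm_ring_1^2^2 \<Rightarrow> 'a^2^2"
  where "adj22 A = mat22 (A$2$2) (- A$1$2) (- A$2$1) (A$1$1)"

lemma mat22_nth [simp]:
  "mat22 a b c d $ 1 $ 1 = a" "mat22 a b c d $ 1 $ 2 = b"
  "mat22 a b c d $ 2 $ 1 = c" "mat22 a b c d $ 2 $ 2 = d"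
  by (simp_all add: mat22_def)

lemma mat22_eqI:
  "A$1$1 = B$1$1 \<Longrightarrow> A$1$2 = B$1$2 \<Longrightarrow> A$2$1 = B$2$1 \<Longrightarrow> A$2$2 = B$2$2 \<Longrightarrow> A = (B::'a^2^2)"
  by (simp add: vec_eq_iff forall_2)

lemma mat22_cases:
  obtains a b c d where "A = mat22 a b c d"
  by (rule that, rule mat22_eqI) simp_all

lemma vec2_eqI: "x$1 = y$1 \<Longrightarrow> x$2 = y$2 \<Longrightarrow> x = (y::'a^2)"
  by (simp add: vec_eq_iff forall_2)

lemma mat22_mult:
  "mat22 a b c d ** mat22 a' b' c' d' =
    mat22 (a*a' + b*c') (a*b' + b*d') (c*a' + d*c') (c*b' + d*d' :: 'a::comm_ring_1)"
  by (rule mat22_eqI) (simp_all add: matrix_matrix_mult_def sum_2)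

lemma mat22_one: "mat 1 = mat22 1 0 0 (1::'a::comm_ring_1)"
  by (rule mat22_eqI) (simp_all add: mat_def)

lemma mat22_uminus: "- mat22 a b c d = mat22 (-a) (-b) (-c) (- d :: 'a::comm_ring_1)"
  by (rule mat22_eqI) simp_all

lemma mat22_in_SL2_iff: "mat22 a b c d \<in> SL2 \<longleftrightarrow> a * d - b * c = 1"
  by (simp add: SL2_def det_2)

lemma SL2_cases:
  assumes "A \<in> SL2"
  obtains a b c d where "A = mat22 a b c d" "a * d - b * c = 1"
  using assms mat22_in_SL2_iff by (metis mat22_cases)

lemma SL2_mult: "A \<in> SL2 \<Longrightarrow> B \<in> SL2 \<Longrightarrow> A ** B \<in> SL2"
  by (simp add: SL2_def det_mul)

lemma adj22_in_SL2: "A \<in> SL2 \<Longrightarrow> adj22 A \<in> SL2"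
  by (simp add: SL2_def adj22_def det_2 algebra_simps)

lemma adj22_inverse:
  assumes "A \<in> SL2"
  shows "A ** adj22 A = mat 1" "adj22 A ** A = mat 1"
  using assms by (auto elim!: SL2_cases simp: adj22_def mat22_mult mat22_one algebra_simps)

lemma matrix_inv_SL2:
  assumes "A \<in> SL2"
  shows "matrix_inv A = adj22 A"
proof -
  have "A ** matrix_inv A = mat 1 \<and> matrix_inv A ** A = mat 1"
    unfolding matrix_inv_def by (rule someI) (use adj22_inverse[OF assms] in blast)
  then show ?thesis
    by (metis adj22_inverse(2)[OF assms] matrix_mul_assoc matrix_mul_lid matrix_mul_rid)
qed

lemma adj22_cancel:
  assumes "A \<in> SL2"
  shows "adj22 A ** (A ** B) = B" "A ** (adj22 A ** B) = B"
    "B ** A ** adj22 A = B" "B ** adj22 A ** A = B"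
proof -
  show "adj22 A ** (A ** B) = B" "A ** (adj22 A ** B) = B"
    by (simp_all add: adj22_inverse[OF assms] matrix_mul_assoc)
  show "B ** A ** adj22 A = B" "B ** adj22 A ** A = B"
    by (simp_all add: adj22_inverse[OF assms] flip: matrix_mul_assoc)
qed

lemma adj22_cancel_vec:
  assumes "A \<in> SL2"
  shows "adj22 A *v (A *v x) = x" "A *v (adj22 A *v x) = x"
  by (simp_all add: adj22_inverse[OF assms] matrix_vector_mul_assoc)

lemma SL2_nonzero: "A \<in> SL2 \<Longrightarrow> A \<noteq> (0 :: 'a::comm_ring_1^2^2)"
  by (auto simp: SL2_def det_2)

lemma SL2_vec_nonzero:
  fixes A :: "complex^2^2"
  assumes "A \<in> SL2" "x \<noteq> 0" shows "A *v x \<noteq> 0"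
  using adj22_cancel_vec(1)[OF assms(1), of x] assms(2) by auto

lemma uminus_matrix_mult: "(- A) ** B = - (A ** B)" "A ** (- B) = - (A ** B)"
  for A B :: "'a::comm_ring_1^2^2"
  by (auto intro!: mat22_eqI simp: matrix_matrix_mult_def sum_2)

lemma uminus_matrix_vec: "(- A) *v x = - (A *v x)" "A *v (- x) = - (A *v x)"
  for A :: "'a::comm_ring_1^2^2"
  by (auto intro!: vec2_eqI simp: matrix_vector_mult_def sum_2)

abbreviation det2 :: "'a::comm_ring_1^2 \<Rightarrow> 'a^2 \<Rightarrow> 'a"
  where "det2 x y \<equiv> x$1 * y$2 - y$1 * x$2"

lemma det2_SL2:
  assumes "A \<in> SL2" shows "det2 (A *v x) (A *v y) = det2 x y"
proof -
  obtain a b c d where A: "A = mat22 a b c d" "a * d - b * c = 1" using SL2_cases[OF assms] .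
  have "det2 (A *v x) (A *v y) = (a * d - b * c) * det2 x y"
    by (simp add: A(1) matrix_vector_mult_def sum_2 algebra_simps)
  then show ?thesis using A(2) by simp
qed

lemma vec2_nonzero_iff: "x \<noteq> 0 \<longleftrightarrow> x$1 \<noteq> 0 \<or> x$2 \<noteq> 0" for x :: "'a::zero^2"
  by (auto simp: vec_eq_iff forall_2)

lemma SL2_first_column:
  fixes \<kappa> :: "'a::field^2"
  assumes "\<kappa> \<noteq> 0"
  obtains x y where "mat22 (\<kappa>$1) x (\<kappa>$2) y \<in> SL2"
proof (cases "\<kappa>$1 = 0")
  case True
  then show ?thesis using assms that[of "- 1 / \<kappa>$2" 0]
    by (simp add: mat22_in_SL2_iff vec2_nonzero_iff)
next
  case False
  then show ?thesis using that[of 0 "1 / \<kappa>$1"] by (simp add: mat22_in_SL2_iff)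
qed

section \<open>The action on upper half space\<close>

text \<open>Every point of upper half space is the image of the base point \<open>(0,0,1)\<close> under some \<open>F \<in> SL(2,\<complex>)\<close>, so that
identities between points become identities between matrices. Concretely \<open>pt F\<close> records the second column of the
Hermitian matrix \<open>F F\<^sup>*\<close>, which has determinant \<open>1\<close>.\<close>

definition pt :: "complex^2^2 \<Rightarrow> real^3"
  where "pt F = act F (upt3 0 1)"

lemma upt3_nth [simp]: "upt3 z t $ 1 = Re z" "upt3 z t $ 2 = Im z" "upt3 z t $ 3 = t"
  by (simp_all add: upt3_def)

lemma upt3_eta: "upt3 (Complex (p$1) (p$2)) (p$3) = p"
  by (simp add: vec_eq_iff forall_3)

lemma upt3_eq_iff [simp]: "upt3 z t = upt3 w s \<longleftrightarrow> z = w \<and> t = s"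
  by (auto simp: vec_eq_iff forall_3 complex_eq_iff)

lemma Complex_upt3 [simp]: "Complex (Re z) (Im z) = z" by (simp add: complex_eq_iff)

lemma upt3_cases: obtains z t where "p = upt3 z t"
  using upt3_eta by metis

lemma upt3_in_U3 [simp]: "upt3 z t \<in> U3 \<longleftrightarrow> t > 0"
  by (simp add: U3_def)

lemma act_upt3:
  "act (mat22 a b c d) (upt3 z t) =
    (let D = (cmod (c * z + d))\<^sup>2 + (cmod c)\<^sup>2 * t\<^sup>2
     in upt3 (((a * z + b) * cnj (c * z + d) + a * cnj c * of_real (t\<^sup>2)) / of_real D) (t / D))"
  by (simp add: act_def)

lemma pt_mat22:
  "pt (mat22 a b c d) = (let D = (cmod c)\<^sup>2 + (cmod d)\<^sup>2
     in upt3 ((b * cnj d + a * cnj c) / of_real D) (1 / D))"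
  by (simp add: pt_def act_upt3 Let_def add.commute)

lemma SL2_row_pos:
  fixes a b c d :: complex
  assumes "a * d - b * c = 1"
  shows "(cmod c)\<^sup>2 + (cmod d)\<^sup>2 > 0"
  using assms by (cases "c = 0") (auto simp: add_pos_nonneg)

lemma pt_in_U3: "F \<in> SL2 \<Longrightarrow> pt F \<in> U3"
  by (elim SL2_cases) (simp add: pt_mat22 Let_def SL2_row_pos)

lemma pt_surj:
  assumes "p \<in> U3"
  obtains F where "F \<in> SL2" "pt F = p"
proof -
  obtain z t where p: "p = upt3 z t" by (rule upt3_cases)
  let ?s = "complex_of_real (sqrt t)"
  have t: "t > 0" using assms p by simp
  let ?F = "mat22 ?s (z / ?s) 0 (1 / ?s)"
  have ss: "?s * ?s = of_real t" using t by (metis abs_of_pos of_real_mult real_sqrt_mult_self)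
  have "?F \<in> SL2" using t by (simp add: mat22_in_SL2_iff)
  moreover have "pt ?F = p"
    using t ss by (simp add: pt_mat22 p Let_def norm_divide power_divide field_simps)
  ultimately show ?thesis by (rule that)
qed

text \<open>With \<open>D\<close>, \<open>Z\<close>, \<open>N\<close> the entries of \<open>F F\<^sup>*\<close>, the identity reduces to \<open>|Z|\<^sup>2 + 1 = D N\<close>, that is
\<open>det (F F\<^sup>*) = 1\<close>. Since every point has the form \<open>pt F\<close>, this yields the group action law.\<close>

lemma act_pt:
  assumes "A \<in> SL2" "F \<in> SL2"
  shows "act A (pt F) = pt (A ** F)"
proof -
  obtain \<alpha> \<beta> \<gamma> \<delta> where A: "A = mat22 \<alpha> \<beta> \<gamma> \<delta>" "\<alpha> * \<delta> - \<beta> * \<gamma> = 1" using SL2_cases[OF assms(1)] .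
  obtain a b c d where F: "F = mat22 a b c d" "a * d - b * c = 1" using SL2_cases[OF assms(2)] .
  define D where "D = (cmod c)\<^sup>2 + (cmod d)\<^sup>2"
  define Z where "Z = b * cnj d + a * cnj c"
  define E where "E = (cmod (\<gamma> * a + \<delta> * c))\<^sup>2 + (cmod (\<gamma> * b + \<delta> * d))\<^sup>2"
  have D: "D > 0" unfolding D_def by (rule SL2_row_pos[OF F(2)])
  have DC: "complex_of_real D = c * cnj c + d * cnj d"
    by (simp only: D_def of_real_add complex_norm_square)
  have EC: "complex_of_real E = (\<gamma> * a + \<delta> * c) * cnj (\<gamma> * a + \<delta> * c) + (\<gamma> * b + \<delta> * d) * cnj (\<gamma> * b + \<delta> * d)"
    by (simp only: E_def of_real_add complex_norm_square)
  have F2: "cnj a * cnj d - cnj b * cnj c = 1" using F(2) by (metis complex_cnj_diff complex_cnj_mult complex_cnj_one)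
  define N where "N = a * cnj a + b * cnj b"
  have "Z * cnj Z + (a * d - b * c) * (cnj a * cnj d - cnj b * cnj c) = of_real D * N"
    unfolding DC N_def Z_def complex_cnj_add complex_cnj_mult complex_cnj_cnj by algebra
  then have key: "Z * cnj Z + 1 = of_real D * N" by (simp only: F(2) F2 mult_1)
  have E': "of_real E = \<gamma> * cnj \<gamma> * N + \<gamma> * cnj \<delta> * Z + \<delta> * cnj \<gamma> * cnj Z + \<delta> * cnj \<delta> * of_real D"
    unfolding EC DC N_def Z_def complex_cnj_add complex_cnj_mult complex_cnj_cnj by algebra
  have den: "(\<gamma> * Z + \<delta> * of_real D) * cnj (\<gamma> * Z + \<delta> * of_real D) + \<gamma> * cnj \<gamma> = of_real D * of_real E"
    unfolding E' complex_cnj_add complex_cnj_mult complex_cnj_complex_of_real using key by algebra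
  have "(\<alpha> * b + \<beta> * d) * cnj (\<gamma> * b + \<delta> * d) + (\<alpha> * a + \<beta> * c) * cnj (\<gamma> * a + \<delta> * c)
      = \<alpha> * cnj \<gamma> * N + \<alpha> * cnj \<delta> * Z + \<beta> * cnj \<gamma> * cnj Z + \<beta> * cnj \<delta> * of_real D"
    unfolding DC N_def Z_def complex_cnj_add complex_cnj_mult complex_cnj_cnj by algebra
  then have num: "(\<alpha> * Z + \<beta> * of_real D) * cnj (\<gamma> * Z + \<delta> * of_real D) + \<alpha> * cnj \<gamma>
     = of_real D * ((\<alpha> * b + \<beta> * d) * cnj (\<gamma> * b + \<delta> * d) + (\<alpha> * a + \<beta> * c) * cnj (\<gamma> * a + \<delta> * c))"
    unfolding complex_cnj_add[of "\<gamma> * Z"] complex_cnj_mult[of \<gamma> Z] complex_cnj_mult[of \<delta> "of_real D"]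
      complex_cnj_complex_of_real using key by algebra
  have E: "E > 0" unfolding E_def by (rule SL2_row_pos[of "\<alpha> * a + \<beta> * c" _ "\<alpha> * b + \<beta> * d"]) (use A(2) F(2) in algebra)
  \<comment> \<open>the denominator in the definition of the action\<close>
  define G where "G = (cmod (\<gamma> * (Z / of_real D) + \<delta>))\<^sup>2 + (cmod \<gamma>)\<^sup>2 * (1 / D)\<^sup>2"
  have "complex_of_real G = ((\<gamma> * Z + \<delta> * of_real D) * cnj (\<gamma> * Z + \<delta> * of_real D) + \<gamma> * cnj \<gamma>) / (of_real D)^2"
    using D unfolding G_def of_real_add of_real_mult complex_norm_square
    by (simp add: power2_eq_square field_simps)
  also have "\<dots> = of_real (E / D)" unfolding den using D by (simp add: power2_eq_square)
  finally have G: "G = E / D" by (simp only: of_real_eq_iff)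
  have ZN: "((\<alpha> * (Z / of_real D) + \<beta>) * cnj (\<gamma> * (Z / of_real D) + \<delta>) + \<alpha> * cnj \<gamma> * of_real ((1 / D)\<^sup>2))
    = ((\<alpha> * Z + \<beta> * of_real D) * cnj (\<gamma> * Z + \<delta> * of_real D) + \<alpha> * cnj \<gamma>) / (of_real D)^2"
    using D by (simp add: power2_eq_square field_simps)
  have "act A (pt F) = upt3 (((\<alpha> * b + \<beta> * d) * cnj (\<gamma> * b + \<delta> * d) + (\<alpha> * a + \<beta> * c) * cnj (\<gamma> * a + \<delta> * c)) / E) (1 / E)"
    unfolding A(1) F(1) pt_mat22 Let_def D_def[symmetric] Z_def[symmetric] act_upt3 G_def[symmetric]
      ZN num G using D E by (simp add: power2_eq_square)
  also have "\<dots> = pt (A ** F)"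
    unfolding A(1) F(1) mat22_mult pt_mat22 Let_def E_def by simp
  finally show ?thesis .
qed

lemma act_mult:
  assumes "A \<in> SL2" "B \<in> SL2" "p \<in> U3"
  shows "act A (act B p) = act (A ** B) p" 
proof -
  obtain F where "F \<in> SL2" "pt F = p" using pt_surj[OF assms(3)] .
  then show ?thesis using assms(1,2) by (auto simp: act_pt SL2_mult matrix_mul_assoc)
qed

lemma act_one: "act (mat 1) p = p"
  unfolding mat22_one by (rule upt3_cases[of p]) (simp add: act_upt3 Let_def)

lemma act_in_U3: "A \<in> SL2 \<Longrightarrow> p \<in> U3 \<Longrightarrow> act A p \<in> U3"
  by (erule pt_surj) (auto simp: act_pt intro!: pt_in_U3 SL2_mult)

lemma act_adj22:
  assumes "A \<in> SL2" "p \<in> U3"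
  shows "act A (act (adj22 A) p) = p" "act (adj22 A) (act A p) = p"
  using assms by (simp_all add: act_mult adj22_in_SL2 adj22_inverse act_one)

section \<open>Horospheres as level sets\<close>

text \<open>The exponential of the Busemann function of the centre of \<open>\<kappa>\<close> that vanishes on the horosphere of \<open>\<kappa>\<close>: moving a point along
a geodesic towards the centre by hyperbolic distance \<open>s\<close> divides it by \<open>exp s\<close>; the horosphere of \<open>\<kappa>\<close> is the level
set \<open>1\<close> and its horoball the sublevel set, which treats the centres \<open>\<infinity>\<close> and \<open>\<xi>/\<eta>\<close> at once.\<close>

definition busemann :: "complex^2 \<Rightarrow> real^3 \<Rightarrow> real"
  where "busemann \<kappa> p = ((cmod (\<kappa>$1 - \<kappa>$2 * Complex (p$1) (p$2)))\<^sup>2 + (cmod (\<kappa>$2))\<^sup>2 * (p$3)\<^sup>2) / p$3"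

lemma busemann_upt3:
  "busemann \<kappa> (upt3 z t) = ((cmod (\<kappa>$1 - \<kappa>$2 * z))\<^sup>2 + (cmod (\<kappa>$2))\<^sup>2 * t\<^sup>2) / t"
  by (simp add: busemann_def)

lemma norm_vec2_sq: "(norm x)\<^sup>2 = (cmod (x$1))\<^sup>2 + (cmod (x$2))\<^sup>2" for x :: "complex^2"
  by (simp add: norm_vec_def L2_set_def sum_2)

text \<open>In terms of the Hermitian form, \<open>busemann \<kappa> (pt F) = \<kappa>\<^sup>* (F F\<^sup>*)\<^sup>-\<^sup>1 \<kappa>\<close>; from this form the equivariance in
\<open>busemann_act\<close> is immediate.\<close>

lemma busemann_pt:
  assumes "F \<in> SL2"
  shows "busemann \<kappa> (pt F) = (norm (adj22 F *v \<kappa>))\<^sup>2"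
proof -
  obtain a b c d where F: "F = mat22 a b c d" "a * d - b * c = 1" using SL2_cases[OF assms(1)] .
  define D where "D = (cmod c)\<^sup>2 + (cmod d)\<^sup>2"
  define Z where "Z = b * cnj d + a * cnj c"
  define x y where "x = \<kappa>$1" and "y = \<kappa>$2"
  have D: "D > 0" unfolding D_def by (rule SL2_row_pos[OF F(2)])
  have DC: "complex_of_real D = c * cnj c + d * cnj d"
    by (simp only: D_def of_real_add complex_norm_square)
  have F2: "cnj a * cnj d - cnj b * cnj c = 1"
    using F(2) by (metis complex_cnj_diff complex_cnj_mult complex_cnj_one)
  have "Z * cnj Z + (a * d - b * c) * (cnj a * cnj d - cnj b * cnj c) = of_real D * (a * cnj a + b * cnj b)"
    unfolding DC Z_def complex_cnj_add complex_cnj_mult complex_cnj_cnj by algebra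
  then have key: "Z * cnj Z + 1 = of_real D * (a * cnj a + b * cnj b)" by (simp only: F(2) F2 mult_1)
  have "of_real D * ((d * x - b * y) * cnj (d * x - b * y) + (a * y - c * x) * cnj (a * y - c * x))
     = (of_real D * x - y * Z) * cnj (of_real D * x - y * Z) + y * cnj y
       + (of_real D * (a * cnj a + b * cnj b) - (Z * cnj Z + 1)) * y * cnj y"
    unfolding DC Z_def complex_cnj_add complex_cnj_mult complex_cnj_cnj complex_cnj_diff complex_cnj_complex_of_real
    by algebra
  then have e: "of_real D * ((d * x - b * y) * cnj (d * x - b * y) + (a * y - c * x) * cnj (a * y - c * x))
     = (of_real D * x - y * Z) * cnj (of_real D * x - y * Z) + y * cnj y"
    by (simp only: key) simp
  have "complex_of_real (D * ((cmod (d * x - b * y))\<^sup>2 + (cmod (a * y - c * x))\<^sup>2)) =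
     of_real ((cmod (of_real D * x - y * Z))\<^sup>2 + (cmod y)\<^sup>2)"
    unfolding of_real_add of_real_mult complex_norm_square by (rule e)
  then have e2: "D * ((cmod (d * x - b * y))\<^sup>2 + (cmod (a * y - c * x))\<^sup>2) =
     (cmod (of_real D * x - y * Z))\<^sup>2 + (cmod y)\<^sup>2"
    by (simp only: of_real_eq_iff)
  have "x - y * (Z / of_real D) = (of_real D * x - y * Z) / of_real D"
    using D by (simp add: field_simps)
  then have "(cmod (x - y * (Z / of_real D)))\<^sup>2 = (cmod (of_real D * x - y * Z))\<^sup>2 / D\<^sup>2"
    by (simp add: norm_divide power_divide)
  then have "busemann \<kappa> (pt F) = ((cmod (of_real D * x - y * Z))\<^sup>2 + (cmod y)\<^sup>2) / D"
    using D unfolding F(1) pt_mat22 Let_def D_def[symmetric] Z_def[symmetric] busemann_upt3 x_def[symmetric] y_def[symmetric]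
    by (simp add: power2_eq_square field_simps)
  also have "\<dots> = (cmod (d * x - b * y))\<^sup>2 + (cmod (a * y - c * x))\<^sup>2"
    using D by (simp flip: e2)
  finally show ?thesis
    by (simp add: norm_vec2_sq F(1) adj22_def matrix_vector_mult_def sum_2 x_def y_def)
qed

lemma adj22_mult: "adj22 (A ** B) = adj22 B ** adj22 A" for A B :: "'a::comm_ring_1^2^2"
  by (rule mat22_eqI) (simp_all add: adj22_def matrix_matrix_mult_def sum_2 algebra_simps)

lemma busemann_act:
  assumes A: "A \<in> SL2" and p: "p \<in> U3"
  shows "busemann (A *v \<kappa>) (act A p) = busemann \<kappa> p"
proof -
  obtain F where "F \<in> SL2" "pt F = p" using pt_surj[OF p] .
  then show ?thesis using A
    by (auto simp: act_pt busemann_pt SL2_mult adj22_mult matrix_vector_mul_assoc adj22_cancel)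
qed

lemma spinor_size_pos: "\<kappa> \<noteq> 0 \<Longrightarrow> spinor_size \<kappa> > 0"
  by (auto simp: spinor_size_def vec2_nonzero_iff)

lemma norm_upt3_sq: "(norm (upt3 z t))\<^sup>2 = (cmod z)\<^sup>2 + t\<^sup>2"
  by (simp add: norm_vec_def L2_set_def sum_3 cmod_power2)

lemma upt3_diff: "upt3 z t - upt3 w s = upt3 (z - w) (t - s)"
  by (simp add: vec_eq_iff forall_3)

lemma dist_upt3_sq: "(dist (upt3 z t) (upt3 w s))\<^sup>2 = (cmod (z - w))\<^sup>2 + (t - s)\<^sup>2"
  by (simp add: dist_norm upt3_diff norm_upt3_sq)

text \<open>For \<open>\<eta> \<noteq> 0\<close> the sphere has radius \<open>1 / (2 |\<eta>|\<^sup>2)\<close>; compare the squared distance of the point from its Euclidean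
centre with the squared radius: on the upper half space their difference is a positive
multiple of \<open>busemann \<kappa> p - 1\<close>.\<close>

lemma
  assumes "\<kappa> \<noteq> 0"
  shows spinor_horosphere_busemann: "spinor_horosphere \<kappa> = {p \<in> U3. busemann \<kappa> p = 1}"
    and horoball_busemann: "horoball (spinor_centre \<kappa>) (spinor_size \<kappa>) = {p \<in> U3. busemann \<kappa> p < 1}"
proof -
  have "(p \<in> spinor_horosphere \<kappa> \<longleftrightarrow> p \<in> U3 \<and> busemann \<kappa> p = 1) \<and>
    (p \<in> horoball (spinor_centre \<kappa>) (spinor_size \<kappa>) \<longleftrightarrow> p \<in> U3 \<and> busemann \<kappa> p < 1)" for p
  proof -
    obtain z t where p: "p = upt3 z t" by (rule upt3_cases)
    show ?thesis
    proof (cases "\<kappa>$2 = 0")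
      case True
      then have k: "(cmod (\<kappa>$1))\<^sup>2 > 0" using assms by (simp add: vec2_nonzero_iff)
      have "t > 0 \<and> (cmod (\<kappa>$1))\<^sup>2 / t < 1 \<longleftrightarrow> t > (cmod (\<kappa>$1))\<^sup>2"
        using k by (metis divide_less_eq_1_pos order.strict_trans)
      then show ?thesis using True k
        by (auto simp: p spinor_horosphere_def horosphere_def horoball_def spinor_centre_def spinor_size_def
          busemann_upt3)
    next
      case False
      define x y where "x = \<kappa>$1" and "y = \<kappa>$2"
      define r where "r = spinor_size \<kappa> / 2"
      have y: "y \<noteq> 0" using False y_def by simp
      have r: "r = 1 / (2 * (cmod y)\<^sup>2)" "r > 0"
        using False by (simp_all add: r_def spinor_size_def y_def)
      have ball: "p \<in> sphere (upt3 (x / y) r) r \<longleftrightarrow> (dist (upt3 (x/y) r) p)\<^sup>2 = r\<^sup>2"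
         "p \<in> ball (upt3 (x / y) r) r \<longleftrightarrow> (dist (upt3 (x/y) r) p)\<^sup>2 < r\<^sup>2"
        using r(2) power2_eq_iff_nonneg[of "dist (upt3 (x/y) r) p" r]
          by (auto simp: abs_le_square_iff abs_less_iff intro: power_strict_mono power2_less_imp_less)
      have "x - y * z = y * (x / y - z)" using y by (simp add: field_simps)
      then have "(cmod (x - y * z))\<^sup>2 = (cmod y)\<^sup>2 * (cmod (x / y - z))\<^sup>2"
        by (simp add: norm_mult power_mult_distrib)
      then have bus: "busemann \<kappa> p = (cmod y)\<^sup>2 * ((cmod (x / y - z))\<^sup>2 + t\<^sup>2) / t"
        by (simp add: busemann_def p x_def y_def algebra_simps)
      have d: "(dist (upt3 (x/y) r) p)\<^sup>2 - r\<^sup>2 = (cmod (x / y - z))\<^sup>2 + t\<^sup>2 - t / (cmod y)\<^sup>2"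
      proof -
        have "2 * r * t = t / (cmod y)\<^sup>2" by (simp add: r(1))
        then show ?thesis unfolding p dist_upt3_sq by (simp add: power2_diff)
      qed
      have t: "t > 0" if "(dist (upt3 (x/y) r) p)\<^sup>2 < r\<^sup>2"
      proof (rule ccontr)
        assume "\<not> t > 0"
        then have "(t / (cmod y)\<^sup>2) \<le> 0" by (simp add: divide_nonpos_nonneg)
        then have "(dist (upt3 (x/y) r) p)\<^sup>2 - r\<^sup>2 \<ge> 0" unfolding d
          using zero_le_power2[of "cmod (x / y - z)"] zero_le_power2[of t] by linarith
        then show False using that by simp
      qed
      have "(cmod y)\<^sup>2 > 0" using y by simp
      have "t > 0 \<Longrightarrow> busemann \<kappa> p = 1 \<longleftrightarrow> (dist (upt3 (x/y) r) p)\<^sup>2 - r\<^sup>2 = 0"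
        "t > 0 \<Longrightarrow> busemann \<kappa> p < 1 \<longleftrightarrow> (dist (upt3 (x/y) r) p)\<^sup>2 - r\<^sup>2 < 0"
        unfolding bus d using \<open>(cmod y)\<^sup>2 > 0\<close> by (auto simp: field_simps)
      then show ?thesis using t ball False
        by (auto simp: p spinor_horosphere_def horosphere_def horoball_def spinor_centre_def x_def y_def r_def)
    qed
  qed
  then show "spinor_horosphere \<kappa> = {p \<in> U3. busemann \<kappa> p = 1}"
    "horoball (spinor_centre \<kappa>) (spinor_size \<kappa>) = {p \<in> U3. busemann \<kappa> p < 1}"
    by blast+
qed

lemma spinor_centre_eq_iff:
  assumes "\<kappa> \<noteq> 0" "\<kappa>' \<noteq> 0"
  shows "spinor_centre \<kappa> = spinor_centre \<kappa>' \<longleftrightarrow> det2 \<kappa> \<kappa>' = 0"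
  using assms by (auto simp: spinor_centre_def vec2_nonzero_iff field_simps)

lemma mobius_spinor_centre:
  assumes "A \<in> SL2" "\<kappa> \<noteq> 0"
  shows "mobius A (spinor_centre \<kappa>) = spinor_centre (A *v \<kappa>)"
proof -
  obtain a b c d where A: "A = mat22 a b c d" "a * d - b * c = 1" using SL2_cases[OF assms(1)] .
  show ?thesis
  proof (cases "\<kappa>$2 = 0")
    case True
    then show ?thesis using assms
      by (simp add: A(1) mobius_def spinor_centre_def matrix_vector_mult_def sum_2 vec2_nonzero_iff)
  next
    case False
    have "(c * (\<kappa>$1 / \<kappa>$2) + d) * \<kappa>$2 = c * \<kappa>$1 + d * \<kappa>$2" "(a * (\<kappa>$1 / \<kappa>$2) + b) * \<kappa>$2 = a * \<kappa>$1 + b * \<kappa>$2"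
      using False by (simp_all add: field_simps)
    then show ?thesis using False
      by (auto simp add: A(1) mobius_def spinor_centre_def matrix_vector_mult_def sum_2) 
        (metis mult_divide_mult_cancel_right mult_eq_0_iff)+
  qed
qed

lemma act_spinor_horosphere:
  assumes "A \<in> SL2" "\<kappa> \<noteq> 0"
  shows "act A ` spinor_horosphere \<kappa> = spinor_horosphere (A *v \<kappa>)"
proof -
  have sub: "act B ` spinor_horosphere x \<subseteq> spinor_horosphere (B *v x)" if "B \<in> SL2" "x \<noteq> 0" for B x
    using that by (auto simp: spinor_horosphere_busemann SL2_vec_nonzero busemann_act act_in_U3)
  have "p \<in> act A ` spinor_horosphere \<kappa>" if p: "p \<in> spinor_horosphere (A *v \<kappa>)" for p
  proof -
    have "act (adj22 A) p \<in> spinor_horosphere \<kappa>"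
      using sub[of "adj22 A" "A *v \<kappa>"] p assms
      by (auto simp: adj22_cancel_vec SL2_vec_nonzero adj22_in_SL2)
    moreover have "p = act A (act (adj22 A) p)"
      using p assms by (simp add: act_adj22 spinor_horosphere_busemann SL2_vec_nonzero)
    ultimately show ?thesis by blast
  qed
  then show ?thesis using sub[OF assms] by blast
qed

lemma spinor_horosphere_subset_U3: "\<kappa> \<noteq> 0 \<Longrightarrow> spinor_horosphere \<kappa> \<subseteq> U3"
  by (auto simp: spinor_horosphere_busemann)

text \<open>The images of the base point under these parabolic matrices sweep out the horosphere of \<open>(1, 0)\<close>, the plane of
height \<open>1\<close>. Transporting it by a matrix \<open>G\<close> with first column \<open>\<kappa>\<close> parametrises every other horosphere.\<close>

definition shear :: "complex \<Rightarrow> complex^2^2"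
  where "shear b = mat22 1 b 0 1"

lemma shear_in_SL2: "shear b \<in> SL2"
  by (simp add: shear_def mat22_in_SL2_iff)

lemma pt_shear: "pt (shear b) = upt3 b 1"
  by (simp add: shear_def pt_mat22)

lemma matrix_vec_e1: "A *v vector [1, 0] = vector [A$1$1, A$2$1]" for A :: "'a::comm_ring_1^2^2"
  by (rule vec2_eqI) (simp_all add: matrix_vector_mult_def sum_2)

lemma spinor_horosphere_eq_range:
  assumes "G \<in> SL2" "G *v vector [1, 0] = \<kappa>"
  shows "spinor_horosphere \<kappa> = range (\<lambda>b. pt (G ** shear b))"
proof -
  have ne: "(vector [1, 0] :: complex^2) \<noteq> 0" by (simp add: vec2_nonzero_iff)
  have "p \<in> spinor_horosphere (vector [1, 0]) \<longleftrightarrow> p \<in> range (\<lambda>b. pt (shear b))" for p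
    by (rule upt3_cases[of p]) (auto simp: spinor_horosphere_busemann ne busemann_def pt_shear)
  then have "spinor_horosphere (vector [1, 0]) = range (\<lambda>b. pt (shear b))" by blast
  then have "spinor_horosphere \<kappa> = act G ` range (\<lambda>b. pt (shear b))"
    using act_spinor_horosphere[OF assms(1) ne] assms(2) by simp
  then show ?thesis using assms(1) by (simp add: image_image act_pt shear_in_SL2)
qed

section \<open>Differentials and frames\<close>

definition frame_vec :: "complex^2^2 \<Rightarrow> real^3 \<Rightarrow> real^3"
  where "frame_vec F = act_tangent F (upt3 0 1)"

lemma frame_of_eq:
  "frame_of F = (pt F, frame_vec F (axis 1 1), frame_vec F (axis 2 1), frame_vec F (axis 3 1))"
  by (simp add: frame_of_def base_frame_def pt_def frame_vec_def)

lemma bounded_linear_upt3: "bounded_linear (\<lambda>x. upt3 (fst x) (snd x))"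
  by (rule linear_conv_bounded_linear[THEN iffD1], rule linearI) (simp_all add: vec_eq_iff forall_3)

lemma bounded_linear_horizontal: "bounded_linear (\<lambda>p::real^3. Complex (p$1) (p$2))"
  by (rule linear_conv_bounded_linear[THEN iffD1], rule linearI) (simp_all add: complex_eq_iff)

lemma has_derivative_upt3:
  assumes "(f has_derivative f') (at x within S)" "(g has_derivative g') (at x within S)"
  shows "((\<lambda>x. upt3 (f x) (g x)) has_derivative (\<lambda>x. upt3 (f' x) (g' x))) (at x within S)"
  using bounded_linear.has_derivative[OF bounded_linear_upt3 has_derivative_Pair[OF assms]] by simp

lemma act_has_derivative:
  fixes a b c d :: complex and p :: "real^3"
  defines "z \<equiv> Complex (p$1) (p$2)" and "t \<equiv> p$3"
  defines "D \<equiv> (cmod (c * z + d))\<^sup>2 + (cmod c)\<^sup>2 * t\<^sup>2"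
    and "Z \<equiv> (a * z + b) * cnj (c * z + d) + a * cnj c * of_real (t\<^sup>2)"
  assumes D: "D \<noteq> 0"
  shows "(act (mat22 a b c d) has_derivative (\<lambda>h.
      let w = Complex (h$1) (h$2); s = h$3;
          Z' = a * w * cnj (c * z + d) + (a * z + b) * cnj (c * w) + a * cnj c * of_real (2 * t * s);
          D' = 2 * Re (c * w * cnj (c * z + d)) + (cmod c)\<^sup>2 * (2 * t * s)
      in upt3 ((Z' * of_real D - Z * of_real D') / of_real (D\<^sup>2)) ((s * D - t * D') / D\<^sup>2))) (at p)"
proof -
  have hz: "((\<lambda>p::real^3. Complex (p$1) (p$2)) has_derivative (\<lambda>h. Complex (h$1) (h$2))) (at p)"
    by (rule bounded_linear.has_derivative[OF bounded_linear_horizontal has_derivative_ident])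
  have ht: "((\<lambda>p::real^3. p$3) has_derivative (\<lambda>h. h$3)) (at p)"
    by (rule bounded_linear.has_derivative[OF bounded_linear_vec_nth has_derivative_ident])
  have ht2: "((\<lambda>p::real^3. (p$3)\<^sup>2) has_derivative (\<lambda>h. 2 * t * h$3)) (at p)"
    unfolding t_def by (rule has_derivative_eq_rhs[OF has_derivative_power[OF ht]]) auto
  have hw: "((\<lambda>p. c * Complex (p$1) (p$2) + d) has_derivative (\<lambda>h. c * Complex (h$1) (h$2))) (at p)"
    "((\<lambda>p. a * Complex (p$1) (p$2) + b) has_derivative (\<lambda>h. a * Complex (h$1) (h$2))) (at p)"
    by (auto intro!: derivative_eq_intros hz)
  have hn: "((\<lambda>p. (cmod (c * Complex (p$1) (p$2) + d))\<^sup>2) has_derivative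
      (\<lambda>h. 2 * Re (c * Complex (h$1) (h$2) * cnj (c * z + d)))) (at p)"
    unfolding cmod_power2
    by (rule has_derivative_eq_rhs,
      (rule has_derivative_add has_derivative_power bounded_linear.has_derivative[OF bounded_linear_Re]
        bounded_linear.has_derivative[OF bounded_linear_Im] hw)+)
      (auto simp: z_def algebra_simps)
  have hD: "((\<lambda>p. (cmod (c * Complex (p$1) (p$2) + d))\<^sup>2 + (cmod c)\<^sup>2 * (p$3)\<^sup>2) has_derivative
      (\<lambda>h. 2 * Re (c * Complex (h$1) (h$2) * cnj (c * z + d)) + (cmod c)\<^sup>2 * (2 * t * h$3))) (at p)"
    by (rule has_derivative_add[OF hn has_derivative_mult_right[OF ht2]])
  have hZ: "((\<lambda>p. (a * Complex (p$1) (p$2) + b) * cnj (c * Complex (p$1) (p$2) + d)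
        + a * cnj c * of_real ((p$3)\<^sup>2)) has_derivative
      (\<lambda>h. a * Complex (h$1) (h$2) * cnj (c * z + d) + (a * z + b) * cnj (c * Complex (h$1) (h$2))
        + a * cnj c * of_real (2 * t * h$3))) (at p)"
    by (rule has_derivative_eq_rhs,
      (rule has_derivative_add[OF has_derivative_mult[OF hw(2) bounded_linear.has_derivative[OF bounded_linear_cnj hw(1)]]
          has_derivative_mult_right[OF bounded_linear.has_derivative[OF bounded_linear_of_real ht2]]]))
      (auto simp: z_def)
  have hDc: "((\<lambda>p. of_real ((cmod (c * Complex (p$1) (p$2) + d))\<^sup>2 + (cmod c)\<^sup>2 * (p$3)\<^sup>2) :: complex) has_derivative
      (\<lambda>h. of_real (2 * Re (c * Complex (h$1) (h$2) * cnj (c * z + d)) + (cmod c)\<^sup>2 * (2 * t * h$3)))) (at p)"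
    by (rule bounded_linear.has_derivative[OF bounded_linear_of_real hD])
  have D0: "(cmod (c * Complex (p$1) (p$2) + d))\<^sup>2 + (cmod c)\<^sup>2 * (p$3)\<^sup>2 \<noteq> 0"
    using D by (simp add: D_def z_def t_def)
  then have D0': "of_real ((cmod (c * Complex (p$1) (p$2) + d))\<^sup>2 + (cmod c)\<^sup>2 * (p$3)\<^sup>2) \<noteq> (0::complex)"
    by (simp only: of_real_eq_0_iff not_False_eq_True)
  have "(act (mat22 a b c d) has_derivative (\<lambda>h. upt3
     (((a * Complex (h$1) (h$2) * cnj (c * z + d) + (a * z + b) * cnj (c * Complex (h$1) (h$2))
        + a * cnj c * of_real (2 * t * h$3)) * of_real D - Z * of_real (2 * Re (c * Complex (h$1) (h$2) * cnj (c * z + d)) + (cmod c)\<^sup>2 * (2 * t * h$3)))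
        / (of_real D * of_real D))
     ((h$3 * D - t * (2 * Re (c * Complex (h$1) (h$2) * cnj (c * z + d)) + (cmod c)\<^sup>2 * (2 * t * h$3))) / (D * D)))) (at p)"
    unfolding act_def[abs_def] Let_def mat22_nth D_def Z_def z_def t_def
    by (rule has_derivative_upt3[OF has_derivative_divide'[OF hZ hDc D0'] has_derivative_divide'[OF ht hD D0],
       unfolded z_def t_def])
  then show ?thesis by (simp add: Let_def power2_eq_square)
qed

lemma act_differentiable:
  assumes "A \<in> SL2" "p \<in> U3"
  shows "act A differentiable at p"
proof -
  obtain a b c d where A: "A = mat22 a b c d" "a * d - b * c = 1" using SL2_cases[OF assms(1)] .
  have "(cmod (c * Complex (p$1) (p$2) + d))\<^sup>2 + (cmod c)\<^sup>2 * (p$3)\<^sup>2 \<noteq> 0"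
    using A(2) assms(2) by (cases "c = 0") (auto simp: U3_def sum_power2_eq_zero_iff simp flip: power_mult_distrib)
  from act_has_derivative[OF this] show ?thesis
    unfolding A(1) by (rule differentiableI)
qed

lemma open_U3: "open U3"
  unfolding U3_def by (intro open_Collect_less continuous_intros)

lemma act_tangent_mult:
  assumes "A \<in> SL2" "B \<in> SL2" "p \<in> U3"
  shows "act_tangent (A ** B) p h = act_tangent A (act B p) (act_tangent B p h)"
proof -
  have "((act A \<circ> act B) has_derivative (act_tangent A (act B p) \<circ> act_tangent B p)) (at p)"
    unfolding act_tangent_def using assms act_differentiable act_in_U3
    by (intro diff_chain_at) (auto simp: frechet_derivative_works[symmetric])
  then have "(act (A ** B) has_derivative (act_tangent A (act B p) \<circ> act_tangent B p)) (at p)"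
    by (rule has_derivative_transform_within_open[OF _ open_U3]) (use assms act_mult in auto)
  then show ?thesis
    unfolding act_tangent_def[of "A ** B"] using frechet_derivative_at by (metis comp_apply)
qed

lemma act_tangent_frame_vec:
  assumes "A \<in> SL2" "F \<in> SL2"
  shows "act_tangent A (pt F) (frame_vec F h) = frame_vec (A ** F) h"
  using act_tangent_mult[OF assms, of "upt3 0 1" h] by (simp add: frame_vec_def pt_def)

lemma act_frame_frame_of:
  "A \<in> SL2 \<Longrightarrow> F \<in> SL2 \<Longrightarrow> act_frame A (frame_of F) = frame_of (A ** F)"
  by (simp add: frame_of_eq act_pt act_tangent_frame_vec)

text \<open>The numerator of the differential contains the factor \<open>a d - b c = 1\<close>, so the frame vectors depend on the second row of
the matrix alone. The first row only enters the base point.\<close>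

lemma frame_vec_mat22:
  assumes "a * d - b * c = 1"
  defines "D \<equiv> (cmod c)\<^sup>2 + (cmod d)\<^sup>2"
  shows "frame_vec (mat22 a b c d) h =
    (let w = Complex (h$1) (h$2); s = h$3 in
      upt3 ((cnj d ^ 2 * w - cnj c ^ 2 * cnj w + 2 * cnj c * cnj d * of_real s) / of_real D ^ 2)
        ((s * ((cmod d)\<^sup>2 - (cmod c)\<^sup>2) - 2 * Re (c * cnj d * w)) / D\<^sup>2))"
proof -
  define w s where "w = Complex (h$1) (h$2)" and "s = h$3"
  have D: "D > 0" unfolding D_def by (rule SL2_row_pos[OF assms(1)])
  have DC: "complex_of_real D = c * cnj c + d * cnj d"
    by (simp only: D_def of_real_add complex_norm_square)
  define Z' where "Z' = a * w * cnj d + b * cnj (c * w) + a * cnj c * of_real (2 * s)"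
  define D' where "D' = 2 * Re (c * w * cnj d) + (cmod c)\<^sup>2 * (2 * s)"
  have R: "complex_of_real (2 * Re x) = x + cnj x" for x by (simp add: complex_add_cnj)
  have DC': "complex_of_real D' = c * w * cnj d + cnj c * cnj w * d + c * cnj c * of_real (2 * s)"
    unfolding D'_def of_real_add R of_real_mult[of "(cmod c)\<^sup>2"] complex_norm_square by simp
  have base: "Complex 0 0 = 0" "(cmod d)\<^sup>2 + (cmod c)\<^sup>2 = D" by (simp_all add: complex_eq_iff D_def)
  have "(act (mat22 a b c d) has_derivative (\<lambda>h. upt3
      (((a * Complex (h$1) (h$2) * cnj d + b * cnj (c * Complex (h$1) (h$2)) + a * cnj c * of_real (2 * h$3)) * of_real D
        - (b * cnj d + a * cnj c) * of_real (2 * Re (c * Complex (h$1) (h$2) * cnj d) + (cmod c)\<^sup>2 * (2 * h$3))) / of_real (D\<^sup>2))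
      ((h$3 * D - (2 * Re (c * Complex (h$1) (h$2) * cnj d) + (cmod c)\<^sup>2 * (2 * h$3))) / D\<^sup>2))) (at (upt3 0 1))"
    by (rule has_derivative_eq_rhs[OF act_has_derivative]) (use D in \<open>simp_all add: base Let_def fun_eq_iff\<close>)
  note der = fun_cong[OF frechet_derivative_at[OF this], symmetric]
  have "frame_vec (mat22 a b c d) h = upt3
      ((Z' * of_real D - (b * cnj d + a * cnj c) * of_real D') / of_real (D\<^sup>2)) ((s * D - D') / D\<^sup>2)"
    unfolding frame_vec_def act_tangent_def Z'_def D'_def w_def s_def by (rule der)
  moreover have "Z' * of_real D - (b * cnj d + a * cnj c) * of_real D'
     = (a * d - b * c) * (cnj d ^ 2 * w - cnj c ^ 2 * cnj w + 2 * cnj c * cnj d * of_real s)"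
    unfolding DC DC' Z'_def complex_cnj_mult of_real_mult of_real_numeral by algebra
  moreover have "s * D - D' = s * ((cmod d)\<^sup>2 - (cmod c)\<^sup>2) - 2 * Re (c * cnj d * w)"
    by (simp add: D_def D'_def algebra_simps)
  ultimately show ?thesis
    by (simp add: assms(1) w_def s_def Let_def)
qed

lemma axis3_nth [simp]:
  "(axis 1 1 :: real^3) $ 1 = 1" "(axis 1 1 :: real^3) $ 2 = 0" "(axis 1 1 :: real^3) $ 3 = 0"
  "(axis 2 1 :: real^3) $ 1 = 0" "(axis 2 1 :: real^3) $ 2 = 1" "(axis 2 1 :: real^3) $ 3 = 0"
  "(axis 3 1 :: real^3) $ 1 = 0" "(axis 3 1 :: real^3) $ 2 = 0" "(axis 3 1 :: real^3) $ 3 = 1"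
  by (simp_all add: axis_def)

section \<open>Spin frames over a frame and lifted paths\<close>

text \<open>Together with the height of the base point, the first two frame vectors determine \<open>c\<^sup>2\<close>, \<open>d\<^sup>2\<close> and \<open>c \<cdot> cnj d\<close>, hence the second row \<open>(c, d)\<close> up to a common
sign. Given this row, the base point and \<open>det = 1\<close> are two linear equations for the first row, whose determinant is
\<open>|c|\<^sup>2 + |d|\<^sup>2 \<noteq> 0\<close>.\<close>

lemma frame_vec_inj_up_to_sign:
  assumes F: "F \<in> SL2" and F': "F' \<in> SL2" and "pt F' = pt F"
    and "frame_vec F' (axis 1 1) = frame_vec F (axis 1 1)" "frame_vec F' (axis 2 1) = frame_vec F (axis 2 1)"
  shows "F' = F \<or> F' = - F"
proof -
  obtain a b c d where F: "F = mat22 a b c d" "a * d - b * c = 1" using SL2_cases[OF F] .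
  obtain a' b' c' d' where F': "F' = mat22 a' b' c' d'" "a' * d' - b' * c' = 1" using SL2_cases[OF F'] .
  define D where "D = (cmod c)\<^sup>2 + (cmod d)\<^sup>2"
  have D: "D > 0" unfolding D_def by (rule SL2_row_pos[OF F(2)])
  have e: "(b' * cnj d' + a' * cnj c') / of_real ((cmod c')\<^sup>2 + (cmod d')\<^sup>2) = (b * cnj d + a * cnj c) / of_real D \<and>
      1 / ((cmod c')\<^sup>2 + (cmod d')\<^sup>2) = 1 / D"
    using assms(3) unfolding F(1) F'(1) pt_mat22 Let_def D_def[symmetric] upt3_eq_iff .
  then have D': "(cmod c')\<^sup>2 + (cmod d')\<^sup>2 = D"
    using D SL2_row_pos[OF F'(2)] by (simp add: field_simps)
  then have pz: "b' * cnj d' + a' * cnj c' = b * cnj d + a * cnj c"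
    using D conjunct1[OF e] unfolding D' by simp
  have I: "Complex 1 0 = 1" "Complex 0 1 = \<i>" by (simp_all add: complex_eq_iff)
  have "(cnj d')\<^sup>2 - (cnj c')\<^sup>2 = (cnj d)\<^sup>2 - (cnj c)\<^sup>2" and "Re (c' * cnj d') = Re (c * cnj d)"
    using assms(4) D unfolding F(1) F'(1) frame_vec_mat22[OF F(2)] frame_vec_mat22[OF F'(2)] D' D_def[symmetric]
    by (simp_all add: Let_def I)
  moreover have "(cnj d')\<^sup>2 * \<i> + (cnj c')\<^sup>2 * \<i> = (cnj d)\<^sup>2 * \<i> + (cnj c)\<^sup>2 * \<i>" and "Re (c' * cnj d' * \<i>) = Re (c * cnj d * \<i>)"
    using assms(5) D unfolding F(1) F'(1) frame_vec_mat22[OF F(2)] frame_vec_mat22[OF F'(2)] D' D_def[symmetric]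
    by (simp_all add: Let_def I)
  ultimately have "(cnj d')\<^sup>2 - (cnj c')\<^sup>2 = (cnj d)\<^sup>2 - (cnj c)\<^sup>2" "(cnj d')\<^sup>2 + (cnj c')\<^sup>2 = (cnj d)\<^sup>2 + (cnj c)\<^sup>2"
    and cd: "c' * cnj d' = c * cnj d"
    by (simp_all add: complex_eq_iff flip: distrib_right)
  then have sq: "(cnj d')\<^sup>2 = (cnj d)\<^sup>2" "(cnj c')\<^sup>2 = (cnj c)\<^sup>2" by algebra+
  then have "d' = d \<or> d' = - d" "c' = c \<or> c' = - c"
    by (auto simp: power2_eq_iff simp flip: complex_cnj_minus)
  moreover have "c = 0 \<or> d = 0 \<or> c' \<noteq> - c \<or> d' \<noteq> d" "c = 0 \<or> d = 0 \<or> c' \<noteq> c \<or> d' \<noteq> - d"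
    using cd by auto
  ultimately have "(c' = c \<and> d' = d) \<or> (c' = - c \<and> d' = - d)"
    by auto
  moreover have row: "x = a \<and> y = b" if "x * d - y * c = 1" "y * cnj d + x * cnj c = b * cnj d + a * cnj c" for x y
  proof -
    have "(x - a) * (c * cnj c + d * cnj d) = 0" "(y - b) * (c * cnj c + d * cnj d) = 0"
      using that F(2) by algebra+
    moreover have "c * cnj c + d * cnj d = of_real D"
      by (simp only: D_def of_real_add complex_norm_square)
    ultimately show ?thesis using D by simp
  qed
  ultimately consider "c' = c" "d' = d" "a' = a" "b' = b" | "c' = - c" "d' = - d" "- a' = a" "- b' = b"
    using row[of a' b'] row[of "-a'" "-b'"] F'(2) pz by auto
  then show ?thesis by cases (auto simp: F(1) F'(1) mat22_uminus)
qed

lemma frame_of_eq_iff: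
  assumes "F \<in> SL2" "F' \<in> SL2"
  shows "frame_of F' = frame_of F \<longleftrightarrow> F' = F \<or> F' = - F"
proof
  assume "F' = F \<or> F' = - F"
  moreover have "frame_of (- F) = frame_of F"
  proof -
    have m: "(- A) $ i $ 1 * z + (- A) $ i $ 2 = - (A $ i $ 1 * z + A $ i $ 2)" for A :: "complex^2^2" and i z
      by simp
    have "act (- A) = act A" for A
      unfolding act_def[abs_def] Let_def m
      by (simp only: complex_cnj_minus norm_minus_cancel minus_mult_minus vector_uminus_component)
    then show ?thesis by (simp add: frame_of_eq pt_def frame_vec_def act_tangent_def)
  qed
  ultimately show "frame_of F' = frame_of F" by auto
qed (use frame_vec_inj_up_to_sign[OF assms] in \<open>auto simp: frame_of_eq\<close>)

lemma continuous_on_mat22 [continuous_intros]: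
  assumes "continuous_on S f" "continuous_on S g" "continuous_on S h" "continuous_on S k"
  shows "continuous_on S (\<lambda>x. mat22 (f x) (g x) (h x) (k x :: complex))"
proof -
  have "mat22 a b c d = (\<chi> i j. if i = 1 then if j = 1 then a else b else if j = 1 then c else (d::complex))" for a b c d
    by (rule mat22_eqI) simp_all
  then show ?thesis using assms
    by (simp only:) (intro continuous_on_vec_lambda, rename_tac i j, case_tac "i = 1"; case_tac "j = 1"; simp)
qed

lemma continuous_on_matrix_mult [continuous_intros]:
  assumes "continuous_on S f" "continuous_on S g"
  shows "continuous_on S (\<lambda>x. f x ** (g x :: complex^2^2) :: complex^2^2)"
  unfolding matrix_matrix_mult_def by (intro continuous_intros assms)

lemma continuous_on_matrix_vec [continuous_intros]:
  assumes "continuous_on S f" "continuous_on S g"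
  shows "continuous_on S (\<lambda>x. f x *v (g x :: complex^2) :: complex^2)"
  unfolding matrix_vector_mult_def by (intro continuous_intros assms)

text \<open>The general principle behind uniqueness of lifts to a double cover whose deck transformation is \<open>-1\<close>. It is applied to
paths of spin frames, to the inward frames along a horosphere, and to the spinor correspondence itself.\<close>

lemma constant_sign:
  fixes f g :: "'a::topological_space \<Rightarrow> 'b::real_inner"
  assumes "connected S" "continuous_on S f" "continuous_on S g"
    and "\<And>x. x \<in> S \<Longrightarrow> f x \<noteq> 0" "\<And>x. x \<in> S \<Longrightarrow> g x = f x \<or> g x = - f x"
  shows "(\<forall>x\<in>S. g x = f x) \<or> (\<forall>x\<in>S. g x = - f x)"
proof -
  define s where "s x = (g x \<bullet> f x) / (f x \<bullet> f x)" for x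
  have "continuous_on S s" unfolding s_def using assms by (intro continuous_intros) auto
  moreover have s: "s x = 1 \<and> g x = f x \<or> s x = - 1 \<and> g x = - f x" if "x \<in> S" for x
    using assms(4,5)[OF that] by (auto simp: s_def)
  then have "s ` S \<subseteq> {1, -1}" by auto
  then have "finite (s ` S)" by (rule finite_subset) simp
  ultimately have "s constant_on S" using assms(1) continuous_finite_range_constant by blast
  then obtain y where "\<And>x. x \<in> S \<Longrightarrow> s x = y" unfolding constant_on_def by blast
  then have "g x = (if y = 1 then f x else - f x)" if "x \<in> S" for x using s that by fastforce
  then show ?thesis by (cases "y = 1") auto
qed

text \<open>A path of frames with a known continuous lift has no other lift with the same starting point; this evaluates the
rotations and translations of spin frames, which are defined by lifting paths.\<close>

lemma lifts_path_iff:
  assumes h: "continuous_on {0..1} h" and hS: "\<And>t. t \<in> {0..1} \<Longrightarrow> h t \<in> SL2"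
    and c: "\<And>t. t \<in> {0..1} \<Longrightarrow> c t = frame_of (h t)" and "h 0 = F"
  shows "lifts_path c F G \<longleftrightarrow> G = h 1"
proof
  assume "lifts_path c F G"
  then obtain g where g: "path g" "\<And>t. t \<in> {0..1} \<Longrightarrow> g t \<in> SL2" "pathstart g = F" "pathfinish g = G"
    "\<And>t. t \<in> {0..1} \<Longrightarrow> frame_of (g t) = c t"
    unfolding lifts_path_def path_image_def by blast
  have "(\<forall>t\<in>{0..1}. g t = h t) \<or> (\<forall>t\<in>{0..1}. g t = - h t)"
  proof (rule constant_sign[OF _ h])
    show "continuous_on {0..1} g" using g(1) by (simp add: path_def)
    show "g t = h t \<or> g t = - h t" if "t \<in> {0..1}" for t
      using frame_of_eq_iff[OF hS[OF that] g(2)[OF that]] g(5)[OF that] c[OF that] by auto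
  qed (use hS SL2_nonzero in auto)
  moreover have "g 0 = h 0" using g(3) assms(4) by (simp add: pathstart_def)
  moreover have "h 0 \<noteq> - h 0"
    using scaleR_2[of "h 0"] hS[of 0] SL2_nonzero[of "h 0"] by (auto simp: eq_neg_iff_add_eq_0)
  ultimately show "G = h 1" using g(4) by (force simp: pathfinish_def)
next
  assume "G = h 1"
  then show "lifts_path c F G" unfolding lifts_path_def
    using assms by (intro exI[of _ h]) (auto simp: path_def path_image_def pathstart_def pathfinish_def)
qed

text \<open>The one-parameter groups of \<open>SU(2)\<close> that rotate the base frame by \<open>\<theta>\<close> about its first and second vector. Right
multiplication by them rotates an arbitrary frame about its own vectors.\<close>

definition rot1 :: "real \<Rightarrow> complex^2^2"
  where "rot1 \<theta> = mat22 (of_real (cos (\<theta>/2))) (\<i> * of_real (sin (\<theta>/2))) (\<i> * of_real (sin (\<theta>/2))) (of_real (cos (\<theta>/2)))"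

definition rot2 :: "real \<Rightarrow> complex^2^2"
  where "rot2 \<theta> = mat22 (of_real (cos (\<theta>/2))) (- of_real (sin (\<theta>/2))) (of_real (sin (\<theta>/2))) (of_real (cos (\<theta>/2)))"

lemma rot1_det: "complex_of_real (cos x) * complex_of_real (cos x) - \<i> * of_real (sin x) * (\<i> * of_real (sin x)) = 1"
  by (simp add: complex_eq_iff power_mult_distrib flip: power2_eq_square)

lemma rot2_det: "complex_of_real (cos x) * complex_of_real (cos x) - (- of_real (sin x)) * (of_real (sin x)) = 1"
  by (simp add: complex_eq_iff flip: power2_eq_square)

lemma rot_in_SL2: "rot1 \<theta> \<in> SL2" "rot2 \<theta> \<in> SL2"
  by (simp_all only: rot1_def rot2_def mat22_in_SL2_iff rot1_det rot2_det)

lemma pt_rot: "pt (rot1 \<theta>) = upt3 0 1" "pt (rot2 \<theta>) = upt3 0 1"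
  by (simp_all add: rot1_def rot2_def pt_mat22 Let_def norm_mult)

lemma rot2_add: "rot2 a ** rot2 b = rot2 (a + b)"
  by (auto simp: rot2_def mat22_mult add_divide_distrib cos_add sin_add intro!: mat22_eqI)

lemma rot_0: "rot1 0 = mat 1" "rot2 0 = mat 1"
  by (simp_all add: rot1_def rot2_def mat22_one)

lemma continuous_on_rot1 [continuous_intros]:
  "continuous_on S f \<Longrightarrow> continuous_on S (\<lambda>x. rot1 (f x))" for f :: "real \<Rightarrow> real"
  unfolding rot1_def by (auto intro!: continuous_intros)

lemma continuous_on_rot2 [continuous_intros]:
  "continuous_on S f \<Longrightarrow> continuous_on S (\<lambda>x. rot2 (f x))" for f :: "real \<Rightarrow> real"
  unfolding rot2_def by (auto intro!: continuous_intros)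

lemma frame_vec_rot2:
  "frame_vec (rot2 \<theta>) (axis 1 1) = cos \<theta> *\<^sub>R axis 1 1 - sin \<theta> *\<^sub>R axis 3 1"
  "frame_vec (rot2 \<theta>) (axis 2 1) = axis 2 1"
  "frame_vec (rot2 \<theta>) (axis 3 1) = cos \<theta> *\<^sub>R axis 3 1 + sin \<theta> *\<^sub>R axis 1 1"
proof -
  define x where "x = \<theta> / 2"
  have x: "\<theta> = 2 * x" by (simp add: x_def)
  have n: "(cmod (of_real (sin x)))\<^sup>2 + (cmod (of_real (cos x)))\<^sup>2 = 1" by simp
  have c: "(sin x)\<^sup>2 = 1 - (cos x)\<^sup>2" by (simp add: sin_squared_eq)
  show "frame_vec (rot2 \<theta>) (axis 1 1) = cos \<theta> *\<^sub>R axis 1 1 - sin \<theta> *\<^sub>R axis 3 1"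
    "frame_vec (rot2 \<theta>) (axis 2 1) = axis 2 1"
    "frame_vec (rot2 \<theta>) (axis 3 1) = cos \<theta> *\<^sub>R axis 3 1 + sin \<theta> *\<^sub>R axis 1 1"
    unfolding rot2_def x_def[symmetric] frame_vec_mat22[OF rot2_det] n
    by (simp_all add: Let_def vec_eq_iff forall_3 x cos_double sin_double c flip: power2_eq_square)
qed

lemma frame_vec_rot1:
  "frame_vec (rot1 \<theta>) (axis 1 1) = axis 1 1"
  "frame_vec (rot1 \<theta>) (axis 2 1) = cos \<theta> *\<^sub>R axis 2 1 + sin \<theta> *\<^sub>R axis 3 1"
  "frame_vec (rot1 \<theta>) (axis 3 1) = cos \<theta> *\<^sub>R axis 3 1 - sin \<theta> *\<^sub>R axis 2 1"
proof -
  define x where "x = \<theta> / 2"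
  have x: "\<theta> = 2 * x" by (simp add: x_def)
  have n: "(cmod (\<i> * of_real (sin x)))\<^sup>2 + (cmod (of_real (cos x)))\<^sup>2 = 1" by (simp add: norm_mult)
  have c: "(sin x)\<^sup>2 = 1 - (cos x)\<^sup>2" by (simp add: sin_squared_eq)
  show "frame_vec (rot1 \<theta>) (axis 1 1) = axis 1 1"
  "frame_vec (rot1 \<theta>) (axis 2 1) = cos \<theta> *\<^sub>R axis 2 1 + sin \<theta> *\<^sub>R axis 3 1"
  "frame_vec (rot1 \<theta>) (axis 3 1) = cos \<theta> *\<^sub>R axis 3 1 - sin \<theta> *\<^sub>R axis 2 1"
    unfolding rot1_def x_def[symmetric] frame_vec_mat22[OF rot1_det] n
    by (simp_all add: Let_def vec_eq_iff forall_3 x cos_double sin_double c norm_mult power_mult_distrib flip: power2_eq_square)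
qed

lemma frame_vec_linear: "F \<in> SL2 \<Longrightarrow> linear (frame_vec F)"
  unfolding frame_vec_def act_tangent_def by (intro linear_frechet_derivative act_differentiable) auto

lemma frame_vec_mult_stabiliser:
  assumes "F \<in> SL2" "X \<in> SL2" "pt X = upt3 0 1"
  shows "pt (F ** X) = pt F" "frame_vec (F ** X) h = frame_vec F (frame_vec X h)"
  using act_pt[OF assms(1,2)] act_tangent_frame_vec[OF assms(1,2), of h] assms(3)
  by (simp_all add: pt_def frame_vec_def)

lemma frame_of_rot:
  assumes "F \<in> SL2"
  shows "frame_of (F ** rot1 \<theta>) = rot_first \<theta> (frame_of F)"
    "frame_of (F ** rot2 \<theta>) = rot_second \<theta> (frame_of F)"
  by (simp_all add: frame_of_eq frame_vec_mult_stabiliser[OF assms rot_in_SL2(1) pt_rot(1)]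
      frame_vec_mult_stabiliser[OF assms rot_in_SL2(2) pt_rot(2)] frame_vec_rot1 frame_vec_rot2
      linear_add[OF frame_vec_linear[OF assms]] linear_diff[OF frame_vec_linear[OF assms]]
      linear_cmul[OF frame_vec_linear[OF assms]])

lemma spin_rot_iff:
  assumes "F \<in> SL2"
  shows "spin_rot_first \<theta> F G \<longleftrightarrow> G = F ** rot1 \<theta>"
    and "spin_rot_second \<theta> F G \<longleftrightarrow> G = F ** rot2 \<theta>"
proof -
  have "lifts_path (\<lambda>t. rot_first (t * \<theta>) (frame_of F)) F G \<longleftrightarrow> G = F ** rot1 (1 * \<theta>)"
    by (rule lifts_path_iff)
      (auto intro!: continuous_intros SL2_mult assms rot_in_SL2 simp: frame_of_rot[OF assms] rot_0)
  then show "spin_rot_first \<theta> F G \<longleftrightarrow> G = F ** rot1 \<theta>" by (simp add: spin_rot_first_def)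
  have "lifts_path (\<lambda>t. rot_second (t * \<theta>) (frame_of F)) F G \<longleftrightarrow> G = F ** rot2 (1 * \<theta>)"
    by (rule lifts_path_iff)
      (auto intro!: continuous_intros SL2_mult assms rot_in_SL2 simp: frame_of_rot[OF assms] rot_0)
  then show "spin_rot_second \<theta> F G \<longleftrightarrow> G = F ** rot2 \<theta>" by (simp add: spin_rot_second_def)
qed

definition diag :: "complex \<Rightarrow> complex^2^2"
  where "diag u = mat22 u 0 0 (1 / u)"

lemma diag_in_SL2: "u \<noteq> 0 \<Longrightarrow> diag u \<in> SL2"
  by (simp add: diag_def mat22_in_SL2_iff)

lemma diag_mult: "diag u ** diag v = diag (u * v)"
  by (simp add: diag_def mat22_mult)

lemma axis_translation_eq: "axis_translation \<rho> = diag (exp (of_real \<rho> / 2))"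
  by (rule mat22_eqI) (simp_all add: axis_translation_def diag_def exp_minus inverse_eq_divide flip: exp_of_real)

lemma spin_translate_iff:
  assumes "F \<in> SL2"
  shows "spin_translate z w \<rho> F G \<longleftrightarrow>
    (\<exists>B\<in>SL2. mobius B (Fin 0) = z \<and> mobius B Infty = w \<and> G = B ** axis_translation \<rho> ** adj22 B ** F)"
proof -
  have "lifts_path (\<lambda>t. act_frame (B ** axis_translation (t * \<rho>) ** matrix_inv B) (frame_of F)) F G
     \<longleftrightarrow> G = B ** axis_translation (1 * \<rho>) ** adj22 B ** F" if B: "B \<in> SL2" for B
  proof (rule lifts_path_iff)
    show "continuous_on {0..1} (\<lambda>t. B ** axis_translation (t * \<rho>) ** adj22 B ** F)"
      unfolding axis_translation_eq diag_def by (intro continuous_intros) auto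
    have T: "B ** axis_translation (t * \<rho>) ** adj22 B \<in> SL2" for t
      unfolding axis_translation_eq by (intro SL2_mult B diag_in_SL2 adj22_in_SL2) simp
    show "B ** axis_translation (t * \<rho>) ** adj22 B ** F \<in> SL2" for t
      by (intro SL2_mult T assms)
    show "act_frame (B ** axis_translation (t * \<rho>) ** matrix_inv B) (frame_of F) =
        frame_of (B ** axis_translation (t * \<rho>) ** adj22 B ** F)" for t
      by (simp add: matrix_inv_SL2[OF B] act_frame_frame_of T assms)
    show "B ** axis_translation (0 * \<rho>) ** adj22 B ** F = F"
      by (simp add: axis_translation_eq diag_def adj22_inverse B flip: mat22_one)
  qed
  then show ?thesis unfolding spin_translate_def by auto
qed

section \<open>The spinor of an inward spin frame\<close>

text \<open>Right multiplication by \<open>rot2 (pi / 2)\<close> turns the standard basis into \<open>(-e\<^sub>3, e\<^sub>2, e\<^sub>1)\<close>, the inward frame of the horosphere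
of \<open>(1, 0)\<close> at the base point. If an inward spin frame is written as \<open>G ** rot2 (pi / 2)\<close>, then the
spinor of its horosphere is the first column of \<open>G\<close>; see \<open>inward_normal_iff\<close>.\<close>

definition spinor_of :: "spin_frame \<Rightarrow> complex^2"
  where "spinor_of F = (F ** rot2 (- pi / 2)) *v vector [1, 0]"

lemma spinor_of_mult: "spinor_of (A ** F) = A *v spinor_of F"
  by (simp add: spinor_of_def matrix_mul_assoc matrix_vector_mul_assoc)

lemma spinor_of_uminus: "spinor_of (- F) = - spinor_of F"
  by (simp add: spinor_of_def uminus_matrix_mult uminus_matrix_vec)

lemma spinor_of_nonzero: "F \<in> SL2 \<Longrightarrow> spinor_of F \<noteq> 0"
  unfolding spinor_of_def by (intro SL2_vec_nonzero SL2_mult rot_in_SL2) (simp_all add: vec2_nonzero_iff)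

lemma spinor_of_rot2: "spinor_of (G ** rot2 (pi / 2)) = vector [G$1$1, G$2$1]"
  by (simp add: spinor_of_def rot2_add rot_0 matrix_vec_e1 flip: matrix_mul_assoc)

lemma spin_frame_cases:
  assumes "F \<in> SL2"
  obtains x y u v where "F = mat22 x u y v ** rot2 (pi / 2)" "x * v - u * y = 1"
    "x = spinor_of F $ 1" "y = spinor_of F $ 2"
proof -
  define G where "G = F ** rot2 (- pi / 2)"
  have "G \<in> SL2" unfolding G_def by (intro SL2_mult assms rot_in_SL2)
  then obtain x u y v where G: "G = mat22 x u y v" "x * v - u * y = 1" by (rule SL2_cases)
  have F: "F = mat22 x u y v ** rot2 (pi / 2)"
    unfolding G(1)[symmetric] G_def by (simp add: rot2_add rot_0 flip: matrix_mul_assoc)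
  have "spinor_of F = vector [x, y]" unfolding F spinor_of_rot2 by simp
  then show ?thesis by (intro that[OF F G(2)]) simp_all
qed

lemma pt_in_spinor_horosphere:
  assumes "F \<in> SL2" shows "pt F \<in> spinor_horosphere (spinor_of F)"
proof -
  have "adj22 F *v spinor_of F = rot2 (- pi / 2) *v vector [1, 0]"
    by (simp add: adj22_inverse assms flip: spinor_of_mult) (simp add: spinor_of_def)
  moreover have "(norm (rot2 (- pi / 2) *v vector [1, 0]))\<^sup>2 = 1"
    by (simp add: norm_vec2_sq matrix_vec_e1 rot2_def)
  ultimately show ?thesis
    using assms by (simp add: spinor_horosphere_busemann spinor_of_nonzero pt_in_U3 busemann_pt)
qed

lemma spin_frame_exists:
  assumes "\<kappa> \<noteq> 0" "p \<in> spinor_horosphere \<kappa>"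
  obtains F where "F \<in> SL2" "pt F = p" "spinor_of F = \<kappa>"
proof -
  obtain x y where G: "mat22 (\<kappa>$1) x (\<kappa>$2) y \<in> SL2" (is "?G \<in> _") using SL2_first_column[OF assms(1)] .
  have "?G *v vector [1, 0] = \<kappa>" by (simp add: matrix_vec_e1 vec2_eqI)
  then obtain b where b: "p = pt (?G ** shear b)"
    using assms(2) spinor_horosphere_eq_range[OF G] by auto
  have S: "?G ** shear b \<in> SL2" by (intro SL2_mult G shear_in_SL2)
  show ?thesis
  proof (rule that[of "?G ** shear b ** rot2 (pi / 2)"])
    show "?G ** shear b ** rot2 (pi / 2) \<in> SL2" by (intro SL2_mult S rot_in_SL2)
    show "pt (?G ** shear b ** rot2 (pi / 2)) = p"
      by (simp add: frame_vec_mult_stabiliser[OF S] rot_in_SL2 pt_rot b)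
    show "spinor_of (?G ** shear b ** rot2 (pi / 2)) = \<kappa>"
      by (auto simp: spinor_of_rot2 shear_def mat22_mult intro: vec2_eqI)
  qed
qed

text \<open>Two matrices of determinant \<open>1\<close> with the same first column differ by a shear, and a nontrivial shear moves the base
point.\<close>

lemma spin_frame_unique:
  assumes F: "F \<in> SL2" and F': "F' \<in> SL2" and pt: "pt F' = pt F" and sp: "spinor_of F' = spinor_of F"
  shows "F' = F"
proof -
  obtain x y u v where G: "F = mat22 x u y v ** rot2 (pi / 2)" "x * v - u * y = 1"
    "x = spinor_of F $ 1" "y = spinor_of F $ 2" using spin_frame_cases[OF F] .
  obtain x' y' u' v' where G': "F' = mat22 x' u' y' v' ** rot2 (pi / 2)" "x' * v' - u' * y' = 1"
    "x' = spinor_of F' $ 1" "y' = spinor_of F' $ 2" using spin_frame_cases[OF F'] .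
  have xy: "x' = x" "y' = y" using G G' sp by auto
  have S: "mat22 x u y v \<in> SL2" "mat22 x' u' y' v' \<in> SL2" using G(2) G'(2) by (simp_all add: mat22_in_SL2_iff)
  define b where "b = v * u' - u * v'"
  have G'b: "mat22 x' u' y' v' = mat22 x u y v ** shear b"
    unfolding shear_def mat22_mult b_def xy
    by (rule mat22_eqI; simp; use G(2) G'(2) xy in algebra)
  have "pt (mat22 x u y v ** shear b) = pt (mat22 x u y v)"
    using pt by (simp add: G(1) G'(1) frame_vec_mult_stabiliser[OF S(1)] frame_vec_mult_stabiliser[OF SL2_mult[OF S(1) shear_in_SL2]] rot_in_SL2 pt_rot G'b)
  then have "act (mat22 x u y v) (upt3 b 1) = act (mat22 x u y v) (upt3 0 1)"
    by (simp add: act_pt[OF S(1) shear_in_SL2, symmetric] pt_shear pt_def[of "mat22 x u y v"])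
  then have "upt3 b 1 = upt3 0 1"
    using act_adj22(2)[OF S(1), of "upt3 b 1"] act_adj22(2)[OF S(1), of "upt3 0 1"] by simp
  then have "b = 0" by simp
  then show ?thesis unfolding G(1) G'(1) G'b by (simp add: shear_def flip: mat22_one)
qed

section \<open>Spin-decorated horospheres are spinors\<close>

text \<open>The spin decoration attached to \<open>\<kappa>\<close>: the inward spin frames are exactly those with spinor \<open>\<kappa>\<close>. It is a
relation and not a function because a spin horosphere that carries \<open>\<kappa>\<close> is read off from a given spinor correspondence;
uniqueness is \<open>carries_unique\<close>, equivariance is \<open>carries_act\<close>.\<close>

definition carries :: "complex^2 \<Rightarrow> spin_horosphere \<Rightarrow> bool"
  where "carries \<kappa> S \<longleftrightarrow> (case S of (H, Win, Wout) \<Rightarrow>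
    H = spinor_horosphere \<kappa> \<and> Win \<in> extensional H \<and> Wout \<in> extensional H \<and>
    (\<forall>p\<in>H. Win p \<in> SL2 \<and> pt (Win p) = p \<and> spinor_of (Win p) = \<kappa> \<and> Wout p = Win p ** rot2 (- pi)))"

lemma spinor_horosphere_nonempty:
  assumes "\<kappa> \<noteq> 0" obtains p where "p \<in> spinor_horosphere \<kappa>"
proof -
  obtain x y where G: "mat22 (\<kappa>$1) x (\<kappa>$2) y \<in> SL2" (is "?G \<in> _") using SL2_first_column[OF assms(1)] .
  have "?G *v vector [1, 0] = \<kappa>" by (simp add: matrix_vec_e1 vec2_eqI)
  then show ?thesis using that spinor_horosphere_eq_range[OF G] by auto
qed

lemma carries_inj:
  assumes "carries \<kappa> S" "carries \<kappa>' S" "\<kappa> \<noteq> 0" shows "\<kappa> = \<kappa>'"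
  using assms spinor_horosphere_nonempty[OF assms(3)] unfolding carries_def by (auto split: prod.splits)

lemma carries_unique:
  assumes "carries \<kappa> S" "carries \<kappa> S'" shows "S = S'"
proof -
  obtain H W V where S: "S = (H, W, V)" by (cases S)
  obtain H' W' V' where S': "S' = (H', W', V')" by (cases S')
  have H: "H = H'" using assms by (simp add: carries_def S S')
  have "W p = W' p \<and> V p = V' p" for p
  proof (cases "p \<in> H")
    case True
    then have "W p = W' p"
      using assms H by (intro spin_frame_unique) (auto simp: carries_def S S')
    then show ?thesis using assms H True by (simp add: carries_def S S')
  next
    case False
    then show ?thesis using assms H by (simp add: carries_def S S' extensional_def)
  qed
  then show ?thesis by (auto simp: S S' H)
qed

lemma carries_act:
  assumes A: "A \<in> SL2" and "\<kappa> \<noteq> 0" and S: "carries \<kappa> S"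
  shows "carries (A *v \<kappa>) (act_spin_horosphere A S)"
proof -
  obtain H W V where S': "S = (H, W, V)" by (cases S)
  have H: "H = spinor_horosphere \<kappa>" "act A ` H = spinor_horosphere (A *v \<kappa>)"
    using S act_spinor_horosphere[OF A assms(2)] by (auto simp: carries_def S')
  have W: "W p \<in> SL2" "pt (W p) = p" "spinor_of (W p) = \<kappa>" "V p = W p ** rot2 (- pi)" if "p \<in> H" for p
    using S that by (auto simp: carries_def S')
  have "p \<in> U3" if "p \<in> H" for p using that H(1) spinor_horosphere_subset_U3[OF assms(2)] by auto
  then show ?thesis
    unfolding carries_def S' using W A
    by (auto simp: H(2)[symmetric] matrix_inv_SL2 act_adj22 spinor_of_mult matrix_mul_assoc SL2_mult simp flip: act_pt)
qed

lemma frame_vec_inward: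
  assumes "G \<in> SL2"
  shows "frame_vec (G ** rot2 (pi / 2)) (axis 1 1) = - frame_vec G (axis 3 1)"
    "frame_vec (G ** rot2 (pi / 2)) (axis 2 1) = frame_vec G (axis 2 1)"
  by (simp_all add: frame_vec_mult_stabiliser[OF assms rot_in_SL2(2) pt_rot(2)] frame_vec_rot2
      linear_neg[OF frame_vec_linear[OF assms]])

text \<open>Comparing vertical components of the two normals forces \<open>|\<eta>|\<^sup>2 = 1 / r\<close>; given this, comparing horizontal components
forces the centre to be \<open>\<xi> / \<eta>\<close>.\<close>

lemma normal_Fin:
  assumes det: "\<xi> * \<delta> - \<beta> * \<eta> = 1" and r: "r > 0"
  shows "- frame_vec (mat22 \<xi> \<beta> \<eta> \<delta>) (axis 3 1) = Nin (Fin w) r (pt (mat22 \<xi> \<beta> \<eta> \<delta>)) \<longleftrightarrow>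
    \<eta> \<noteq> 0 \<and> r = 1 / (cmod \<eta>)\<^sup>2 \<and> w = \<xi> / \<eta>"
proof -
  define D where "D = (cmod \<eta>)\<^sup>2 + (cmod \<delta>)\<^sup>2"
  have D: "D > 0" unfolding D_def by (rule SL2_row_pos[OF det])
  have DC: "complex_of_real D = \<eta> * cnj \<eta> + \<delta> * cnj \<delta>"
    by (simp only: D_def of_real_add complex_norm_square)
  define Z where "Z = (\<beta> * cnj \<delta> + \<xi> * cnj \<eta>) / of_real D"
  have I: "Complex 0 0 = 0" by (simp add: complex_eq_iff)
  have neg: "- upt3 z t = upt3 (- z) (- t)" and scale: "k *\<^sub>R upt3 z t = upt3 (of_real k * z) (k * t)" for z t k
    by (simp_all add: vec_eq_iff forall_3)
  have "- frame_vec (mat22 \<xi> \<beta> \<eta> \<delta>) (axis 3 1) = Nin (Fin w) r (pt (mat22 \<xi> \<beta> \<eta> \<delta>)) \<longleftrightarrow>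
     2 * cnj \<eta> * cnj \<delta> / of_real D ^ 2 = of_real (1 / D / (r / 2)) * (w - Z) \<and>
     ((cmod \<delta>)\<^sup>2 - (cmod \<eta>)\<^sup>2) / D\<^sup>2 = 1 / D / (r / 2) * (r / 2 - 1 / D)"
    unfolding frame_vec_mat22[OF det] D_def[symmetric] pt_mat22 Let_def Z_def[symmetric] Nin_def Nout_def
      bdry.case upt3_nth axis3_nth upt3_diff scale I neg_equal_iff_equal upt3_eq_iff by simp
  also have "((cmod \<delta>)\<^sup>2 - (cmod \<eta>)\<^sup>2) / D\<^sup>2 = 1 / D / (r / 2) * (r / 2 - 1 / D) \<longleftrightarrow> (cmod \<delta>)\<^sup>2 - (cmod \<eta>)\<^sup>2 = D - 2 / r"
  proof -
    have "1 / D / (r / 2) * (r / 2 - 1 / D) = (D - 2 / r) / D\<^sup>2"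
      using D r by (simp add: field_simps power2_eq_square)
    then show ?thesis using D by simp
  qed
  also have "\<dots> \<longleftrightarrow> (cmod \<eta>)\<^sup>2 = 1 / r" by (auto simp: D_def)
  also have "\<dots> \<longleftrightarrow> \<eta> \<noteq> 0 \<and> r = 1 / (cmod \<eta>)\<^sup>2" using r by (auto simp: eq_divide_eq divide_eq_eq mult.commute)
  also have "2 * cnj \<eta> * cnj \<delta> / of_real D ^ 2 = of_real (1 / D / (r / 2)) * (w - Z) \<longleftrightarrow>
      w = Z + of_real r * cnj \<eta> * cnj \<delta> / of_real D"
  proof -
    have "2 * cnj \<eta> * cnj \<delta> / of_real D ^ 2
      = of_real (1 / D / (r / 2)) * (of_real r * cnj \<eta> * cnj \<delta> / of_real D)"
      using D r by (simp add: power2_eq_square)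
    moreover have "complex_of_real (1 / D / (r / 2)) \<noteq> 0" using D r by simp
    ultimately show ?thesis by (simp only: mult_cancel_left) auto
  qed
  finally have *: "- frame_vec (mat22 \<xi> \<beta> \<eta> \<delta>) (axis 3 1) = Nin (Fin w) r (pt (mat22 \<xi> \<beta> \<eta> \<delta>)) \<longleftrightarrow>
    w = Z + of_real r * cnj \<eta> * cnj \<delta> / of_real D \<and> \<eta> \<noteq> 0 \<and> r = 1 / (cmod \<eta>)\<^sup>2" .
  moreover have "Z + of_real r * cnj \<eta> * cnj \<delta> / of_real D = \<xi> / \<eta>" if "\<eta> \<noteq> 0" "r = 1 / (cmod \<eta>)\<^sup>2"
  proof -
    have "complex_of_real r = 1 / (\<eta> * cnj \<eta>)"
      using that(2) by (simp only: of_real_divide complex_norm_square of_real_1)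
    then have "of_real r * cnj \<eta> * cnj \<delta> = cnj \<delta> / \<eta>" using that(1) by simp
    moreover have "(\<beta> * cnj \<delta> + \<xi> * cnj \<eta>) * \<eta> + cnj \<delta> = \<xi> * of_real D"
      unfolding DC using det by algebra
    then have "(\<beta> * cnj \<delta> + \<xi> * cnj \<eta> + cnj \<delta> / \<eta>) / of_real D = \<xi> / \<eta>"
      using that(1) D by (simp add: field_simps)
    ultimately show ?thesis by (simp add: Z_def add_divide_distrib)
  qed
  ultimately show ?thesis by auto
qed

lemma normal_Infty:
  assumes det: "\<xi> * \<delta> - \<beta> * \<eta> = 1"
  shows "- frame_vec (mat22 \<xi> \<beta> \<eta> \<delta>) (axis 3 1) = Nin Infty r (pt (mat22 \<xi> \<beta> \<eta> \<delta>)) \<longleftrightarrow> \<eta> = 0"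
proof -
  define D where "D = (cmod \<eta>)\<^sup>2 + (cmod \<delta>)\<^sup>2"
  have D: "D > 0" unfolding D_def by (rule SL2_row_pos[OF det])
  have I: "Complex 0 0 = 0" by (simp add: complex_eq_iff)
  have ax: "k *\<^sub>R axis 3 1 = upt3 0 k" for k
    by (simp add: vec_eq_iff forall_3)
  have "- frame_vec (mat22 \<xi> \<beta> \<eta> \<delta>) (axis 3 1) = Nin Infty r (pt (mat22 \<xi> \<beta> \<eta> \<delta>)) \<longleftrightarrow>
     2 * cnj \<eta> * cnj \<delta> / of_real D ^ 2 = 0 \<and> ((cmod \<delta>)\<^sup>2 - (cmod \<eta>)\<^sup>2) / D\<^sup>2 = 1 / D"
    unfolding frame_vec_mat22[OF det] D_def[symmetric] pt_mat22 Let_def Nin_def Nout_def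
      bdry.case upt3_nth axis3_nth ax I neg_equal_iff_equal upt3_eq_iff by simp
  also have "((cmod \<delta>)\<^sup>2 - (cmod \<eta>)\<^sup>2) / D\<^sup>2 = 1 / D \<longleftrightarrow> (cmod \<delta>)\<^sup>2 - (cmod \<eta>)\<^sup>2 = D"
  proof -
    have "1 / D = D / D\<^sup>2" using D by (simp add: power2_eq_square)
    then show ?thesis using D by (simp only: divide_cancel_right) simp
  qed
  also have "\<dots> \<longleftrightarrow> \<eta> = 0" by (auto simp: D_def)
  finally show ?thesis by auto
qed

text \<open>For the centre \<open>\<infinity>\<close> the normal does not see the height of the plane, which comes from the hypothesis that the point lies on
the horosphere.\<close>

lemma inward_normal_iff:
  assumes F: "F \<in> SL2" and r: "r > 0" and p: "pt F \<in> horosphere z r"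
  shows "frame_vec F (axis 1 1) = Nin z r (pt F) \<longleftrightarrow>
    z = spinor_centre (spinor_of F) \<and> r = spinor_size (spinor_of F)"
proof -
  obtain x y u v where G: "F = mat22 x u y v ** rot2 (pi / 2)" "x * v - u * y = 1"
    "x = spinor_of F $ 1" "y = spinor_of F $ 2" using spin_frame_cases[OF F] .
  have S: "mat22 x u y v \<in> SL2" using G(2) by (simp add: mat22_in_SL2_iff)
  have ptF: "pt F = pt (mat22 x u y v)" unfolding G(1) by (rule frame_vec_mult_stabiliser[OF S rot_in_SL2(2) pt_rot(2)])
  have *: "frame_vec F (axis 1 1) = - frame_vec (mat22 x u y v) (axis 3 1)"
    using frame_vec_inward(1)[OF S] G(1) by simp
  show ?thesis
  proof (cases z)
    case (Fin w)
    show ?thesis unfolding * ptF Fin normal_Fin[OF G(2) r]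
      by (auto simp: spinor_centre_def spinor_size_def simp flip: G(3,4))
  next
    case Infty
    have "r = (cmod x)\<^sup>2" if "y = 0"
    proof -
      have "r = 1 / (cmod v)\<^sup>2" using p that by (simp add: Infty ptF horosphere_def pt_mat22)
      moreover have "cmod x * cmod v = 1" using G(2) that by (simp flip: norm_mult)
      then have "(cmod x)\<^sup>2 * (cmod v)\<^sup>2 = 1" by (simp flip: power_mult_distrib)
      moreover have "(cmod v)\<^sup>2 \<noteq> 0" using G(2) that by auto
      ultimately show ?thesis by (simp add: divide_eq_eq)
    qed
    then show ?thesis unfolding * ptF Infty normal_Infty[OF G(2)]
      by (auto simp: spinor_centre_def spinor_size_def simp flip: G(3,4))
  qed
qed

text \<open>One eigenvalue is \<open>1\<close>, hence so is the other, by \<open>det A = 1\<close>.\<close>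

lemma trace_fixing_vector:
  fixes A :: "complex^2^2"
  assumes A: "A \<in> SL2" and fixk: "A *v \<kappa> = \<kappa>" and "\<kappa> \<noteq> 0"
  shows "trace A = 2"
proof -
  obtain a b c d where A: "A = mat22 a b c d" "a * d - b * c = 1" using SL2_cases[OF A] .
  define x y where "x = \<kappa>$1" and "y = \<kappa>$2"
  have e: "a * x + b * y = x" "c * x + d * y = y"
    using arg_cong[OF fixk, of "\<lambda>v. v$1"] arg_cong[OF fixk, of "\<lambda>v. v$2"]
    by (simp_all add: A(1) matrix_vector_mult_def sum_2 x_def y_def)
  have "(a * d - b * c) * x = d * (a * x + b * y) - b * (c * x + d * y)"
    "(a * d - b * c) * y = a * (c * x + d * y) - c * (a * x + b * y)" by algebra+
  then have "x - (d * x - b * y) = 0" "y - (a * y - c * x) = 0" unfolding e A(2) by simp_all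
  moreover have "(2 - (a + d)) * x = (x - (d * x - b * y)) + (x - (a * x + b * y))"
    "(2 - (a + d)) * y = (y - (a * y - c * x)) + (y - (c * x + d * y))" by algebra+
  ultimately have "(2 - (a + d)) * x = 0" "(2 - (a + d)) * y = 0" unfolding e by simp_all
  moreover have "x \<noteq> 0 \<or> y \<noteq> 0" using assms(3) by (simp add: vec2_nonzero_iff x_def y_def)
  ultimately show ?thesis by (auto simp: A(1) trace_def sum_2)
qed

text \<open>The element of \<open>SL(2,\<complex>)\<close> that takes one inward spin frame with spinor \<open>\<kappa>\<close> to another fixes \<open>\<kappa>\<close>, so it is parabolic or
the identity, and it preserves the horosphere. A decoration is invariant under it; hence it agrees with the second frame
vector everywhere as soon as it does at one point.\<close>

lemma decoration_parallel:
  assumes dec: "decoration z r v" and H: "horosphere z r = spinor_horosphere \<kappa>"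
    and F0: "F0 \<in> SL2" "spinor_of F0 = \<kappa>" and v0: "v (pt F0) = frame_vec F0 (axis 2 1)"
    and F: "F \<in> SL2" "spinor_of F = \<kappa>"
  shows "v (pt F) = frame_vec F (axis 2 1)"
proof -
  \<comment> \<open>the isometry taking the first spin frame to the second\<close>
  define A where "A = F ** adj22 F0"
  have A: "A \<in> SL2" unfolding A_def by (intro SL2_mult F(1) adj22_in_SL2 F0(1))
  have AF: "A ** F0 = F" by (simp add: A_def adj22_cancel F0(1))
  have fixk: "A *v \<kappa> = \<kappa>" using AF F0(2) F(2) spinor_of_mult by metis
  have k: "\<kappa> \<noteq> 0" using spinor_of_nonzero[OF F(1)] F(2) by simp
  have pF0: "pt F0 \<in> horosphere z r" using pt_in_spinor_horosphere[OF F0(1)] F0(2) H by simp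
  show ?thesis
  proof (cases "A = mat 1")
    case True
    then show ?thesis using AF v0 by simp
  next
    case False
    have "trace A = 2" by (rule trace_fixing_vector[OF A fixk k])
    moreover have "A \<noteq> - mat 1"
    proof
      assume "A = - mat 1"
      then have "trace A = - 2" by (simp add: trace_def sum_2 mat_def)
      then show False using \<open>trace A = 2\<close> by simp
    qed
    ultimately have "parabolic A" using A False by (simp add: parabolic_def)
    moreover have "act A ` horosphere z r = horosphere z r"
      unfolding H act_spinor_horosphere[OF A k] fixk ..
    ultimately have "act_tangent A (pt F0) (v (pt F0)) = v (act A (pt F0))"
      using dec pF0 by (simp add: decoration_def)
    then show ?thesis by (simp add: v0 act_tangent_frame_vec A F0 act_pt AF)
  qed
qed

lemma connected_spinor_horosphere:
  assumes "\<kappa> \<noteq> 0" shows "connected (spinor_horosphere \<kappa>)"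
proof -
  obtain x y where G: "mat22 (\<kappa>$1) x (\<kappa>$2) y \<in> SL2" (is "?G \<in> _") using SL2_first_column[OF assms(1)] .
  have "?G *v vector [1, 0] = \<kappa>" by (simp add: matrix_vec_e1 vec2_eqI)
  then have H: "spinor_horosphere \<kappa> = (\<lambda>b. act ?G (upt3 b 1)) ` UNIV"
    using spinor_horosphere_eq_range[OF G] by (simp add: act_pt[OF G shear_in_SL2, symmetric] pt_shear)
  have "continuous_on U3 (act ?G)"
    by (intro continuous_at_imp_continuous_on ballI differentiable_imp_continuous_within act_differentiable[OF G])
  moreover have "continuous_on UNIV (\<lambda>b. upt3 b 1)"
    using bounded_linear.continuous_on[OF bounded_linear_upt3, of UNIV "\<lambda>b. (b, 1)"] by (simp add: continuous_intros)
  ultimately have "continuous_on UNIV (\<lambda>b. act ?G (upt3 b 1))"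
    by (rule continuous_on_compose2) auto
  then show ?thesis unfolding H by (rule connected_continuous_image) (simp add: convex_connected)
qed

lemma continuous_spinor_of [continuous_intros]:
  "continuous_on S f \<Longrightarrow> continuous_on S (\<lambda>x. spinor_of (f x))"
  unfolding spinor_of_def by (intro continuous_intros)

text \<open>Let \<open>\<kappa>\<close> be the spinor of the inward frame at one point. At any other point the decoration and the normal determine the
inward spin frame up to sign, so its spinor is \<open>\<plusminus>\<kappa>\<close>; the sign is constant because a horosphere is connected.\<close>

lemma spin_decoration_carries:
  assumes r: "r > 0" and dec: "decoration z r v" and spin: "spin_decoration z r v Win Wout"
  obtains \<kappa> where "\<kappa> \<noteq> 0" "spinor_centre \<kappa> = z" "spinor_size \<kappa> = r"
    "carries \<kappa> (horosphere z r, Win, Wout)"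
proof -
  define H where "H = horosphere z r"
  obtain p0 where p0: "p0 \<in> H"
  proof (cases z)
    case (Fin w)
    have "(dist (upt3 w (r / 2)) (upt3 w r))\<^sup>2 = (r / 2)\<^sup>2"
      unfolding dist_upt3_sq by (simp add: power2_eq_square field_simps)
    then have "dist (upt3 w (r / 2)) (upt3 w r) = r / 2"
      by (rule power2_eq_imp_eq) (use r in simp_all)
    then show ?thesis using that[of "upt3 w r"] r by (simp add: H_def Fin horosphere_def)
  next
    case Infty
    then show ?thesis using that[of "upt3 0 r"] by (simp add: H_def horosphere_def)
  qed
  have W: "Win \<in> H \<rightarrow>\<^sub>E SL2" "Wout \<in> H \<rightarrow>\<^sub>E SL2" "continuous_on H Win"
    using spin by (simp_all add: spin_decoration_def H_def Let_def)
  have WS: "Win p \<in> SL2" if "p \<in> H" for p using W(1) that by auto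
  have fr: "pt (Win p) = p" "frame_vec (Win p) (axis 1 1) = Nin z r p" "frame_vec (Win p) (axis 2 1) = v p"
    and rot: "spin_rot_second (- pi) (Win p) (Wout p)" if "p \<in> H" for p
    using spin that by (simp_all add: spin_decoration_def H_def Let_def frame_of_eq)
  have out: "Wout p = Win p ** rot2 (- pi)" if "p \<in> H" for p
    using rot[OF that] spin_rot_iff(2)[OF WS[OF that]] by blast
  define \<kappa> where "\<kappa> = spinor_of (Win p0)"
  have k: "\<kappa> \<noteq> 0" using spinor_of_nonzero[OF WS[OF p0]] by (simp add: \<kappa>_def)
  have zr: "z = spinor_centre \<kappa>" "r = spinor_size \<kappa>"
    using inward_normal_iff[OF WS[OF p0] r, of z] fr[OF p0] p0 by (simp_all add: H_def \<kappa>_def)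
  have H: "H = spinor_horosphere \<kappa>" unfolding H_def zr spinor_horosphere_def ..
  have Hr: "horosphere z r = spinor_horosphere \<kappa>" using H H_def by blast
  have v0: "v (pt (Win p0)) = frame_vec (Win p0) (axis 2 1)" using fr[OF p0] by simp
  have pm: "spinor_of (Win p) = \<kappa> \<or> spinor_of (Win p) = - \<kappa>" if p: "p \<in> H" for p
  proof -
    obtain F where F: "F \<in> SL2" "pt F = p" "spinor_of F = \<kappa>"
      using spin_frame_exists[OF k] p unfolding H by blast
    have "v (pt F) = frame_vec F (axis 2 1)"
      by (rule decoration_parallel[OF dec Hr WS[OF p0] \<kappa>_def[symmetric] v0 F(1,3)])
    moreover have "frame_vec F (axis 1 1) = Nin z r (pt F)"
      using inward_normal_iff[OF F(1) r] zr p unfolding F(2,3) H_def by blast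
    ultimately have "Win p = F \<or> Win p = - F"
      using fr[OF p] F(1,2) by (intro frame_vec_inj_up_to_sign WS[OF p]) simp_all
    then show ?thesis using F(3) by (auto simp: spinor_of_uminus)
  qed
  have "(\<forall>p\<in>H. spinor_of (Win p) = \<kappa>) \<or> (\<forall>p\<in>H. spinor_of (Win p) = - \<kappa>)"
    by (rule constant_sign[where f = "\<lambda>_. \<kappa>"])
      (use k W(3) pm connected_spinor_horosphere[OF k] H in \<open>simp_all add: continuous_intros\<close>)
  moreover have "\<kappa> \<noteq> - \<kappa>" using k scaleR_2[of \<kappa>] by (auto simp: eq_neg_iff_add_eq_0)
  ultimately have "\<forall>p\<in>H. spinor_of (Win p) = \<kappa>" using p0 \<kappa>_def by metis
  then have "carries \<kappa> (H, Win, Wout)"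
    unfolding carries_def prod.case using H W WS fr(1) out \<open>\<forall>p\<in>H. spinor_of (Win p) = \<kappa>\<close> PiE_iff by blast
  then show ?thesis using that[of \<kappa>] k zr H_def by simp
qed

lemma HorS_at_carries:
  assumes "S \<in> HorS_at z"
  obtains \<kappa> where "\<kappa> \<noteq> 0" "spinor_centre \<kappa> = z" "carries \<kappa> S"
proof -
  obtain r v Win Wout where "S = (horosphere z r, Win, Wout)" "r > 0" "decoration z r v" "spin_decoration z r v Win Wout"
    using assms by (auto simp: HorS_at_def)
  then show ?thesis using that spin_decoration_carries by metis
qed

lemma lies_over_spinor_HorS_at:
  assumes "\<kappa> \<noteq> 0" "lies_over_spinor S \<kappa>"
  shows "S \<in> HorS_at (spinor_centre \<kappa>)"
  using assms spinor_size_pos by (auto simp: lies_over_spinor_def HorS_at_def spinor_horosphere_def)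

lemma positive_multiple_same_norm:
  assumes "z = of_real k * w" "k > 0" "cmod z = cmod w" shows "z = w"
  using assms by (auto simp: norm_mult)

text \<open>The carried spinor \<open>\<kappa>'\<close> has the centre and the size of \<open>\<kappa>\<close>. The decoration at the north pole (at a point of the plane if
the centre is \<open>\<infinity>\<close>) equals \<open>\<i> / \<eta>'\<^sup>2\<close> (respectively \<open>\<i> \<xi>'\<^sup>2\<close>), and comparing it with the direction of \<open>\<kappa>\<close> gives
\<open>\<kappa>' = \<plusminus>\<kappa>\<close>.\<close>

lemma lies_over_spinor_carries:
  assumes "\<kappa> \<noteq> 0" "lies_over_spinor S \<kappa>"
  shows "carries \<kappa> S \<or> carries (- \<kappa>) S"
proof -
  define z r where "z = spinor_centre \<kappa>" and "r = spinor_size \<kappa>"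
  obtain Win Wout v where S: "S = (horosphere z r, Win, Wout)" and dec: "decoration z r v"
    and dir: "specified_by z r v (spinor_direction \<kappa>)" and spin: "spin_decoration z r v Win Wout"
    using assms(2) by (auto simp: lies_over_spinor_def spinor_horosphere_def z_def r_def)
  have r: "r > 0" using spinor_size_pos[OF assms(1)] by (simp add: r_def)
  obtain \<kappa>' where k': "\<kappa>' \<noteq> 0" "spinor_centre \<kappa>' = z" "spinor_size \<kappa>' = r" "carries \<kappa>' S"
    using spin_decoration_carries[OF r dec spin] S by metis
  have W: "Win p \<in> SL2" "pt (Win p) = p" "spinor_of (Win p) = \<kappa>'" "frame_vec (Win p) (axis 2 1) = v p"
    if "p \<in> horosphere z r" for p
    using k'(4) spin that by (simp_all add: carries_def S spin_decoration_def Let_def frame_of_eq)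
  have vG: "v (pt G) = frame_vec G (axis 2 1)" if G: "G \<in> SL2" "G$1$1 = \<kappa>'$1" "G$2$1 = \<kappa>'$2" for G
  proof -
    have sp: "spinor_of (G ** rot2 (pi / 2)) = \<kappa>'" using G by (auto simp: spinor_of_rot2 intro: vec2_eqI)
    have S2: "G ** rot2 (pi / 2) \<in> SL2" by (intro SL2_mult G rot_in_SL2)
    have pt: "pt (G ** rot2 (pi / 2)) = pt G" by (rule frame_vec_mult_stabiliser[OF G(1) rot_in_SL2(2) pt_rot(2)])
    have H: "pt G \<in> horosphere z r"
      using pt_in_spinor_horosphere[OF S2] k' by (simp add: pt sp spinor_horosphere_def)
    have "G ** rot2 (pi / 2) = Win (pt G)"
      using W[OF H] S2 pt sp by (intro spin_frame_unique) simp_all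
    then show ?thesis using W(4)[OF H] frame_vec_inward(2)[OF G(1)] by simp
  qed
  have I: "Complex 0 1 = \<i>" by (simp add: complex_eq_iff)
  have scale: "k *\<^sub>R upt3 z t = upt3 (of_real k * z) (k * t)" for z t k
    by (simp add: vec_eq_iff forall_3)
  have "\<kappa>' = \<kappa> \<or> \<kappa>' = - \<kappa>"
  proof (cases "\<kappa>$2 = 0")
    case True
    then have z: "z = Infty" by (simp add: z_def spinor_centre_def)
    then have k2: "\<kappa>'$2 = 0" using k'(2) by (simp add: spinor_centre_def split: if_splits)
    then have x: "\<kappa>'$1 \<noteq> 0" using k'(1) by (simp add: vec2_nonzero_iff)
    define G where "G = mat22 (\<kappa>'$1) 0 0 (1 / \<kappa>'$1)"
    have G: "\<kappa>'$1 * (1 / \<kappa>'$1) - 0 * 0 = 1" "G \<in> SL2" unfolding G_def mat22_in_SL2_iff using x by simp_all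
    have ptH: "pt G \<in> horosphere z r"
      using k'(3) x k2 by (simp add: G_def pt_mat22 z horosphere_def spinor_size_def norm_divide power_divide)
    have "v (pt G) = frame_vec G (axis 2 1)" by (rule vG[OF G(2)]) (simp_all add: G_def k2)
    also have "\<dots> = upt3 (cnj (1 / \<kappa>'$1) ^ 2 * \<i> / of_real ((cmod (1 / \<kappa>'$1))\<^sup>2) ^ 2) 0"
      unfolding G_def frame_vec_mat22[OF G(1)] by (simp add: Let_def I)
    also have "cnj (1 / \<kappa>'$1) ^ 2 * \<i> / of_real ((cmod (1 / \<kappa>'$1))\<^sup>2) ^ 2 = \<i> * (\<kappa>'$1)\<^sup>2"
      using x unfolding complex_norm_square by (simp add: field_simps power2_eq_square)
    finally obtain c where c: "c > 0" "\<i> * (\<kappa>'$1)\<^sup>2 = of_real c * (\<i> * (\<kappa>$1)\<^sup>2)"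
      using dir ptH z True by (auto simp: specified_by_def spinor_direction_def scale)
    have "\<i> * (\<kappa>'$1)\<^sup>2 = \<i> * (\<kappa>$1)\<^sup>2"
      by (rule positive_multiple_same_norm[OF c(2,1)])
        (use k'(3) k2 True in \<open>simp add: norm_mult norm_power spinor_size_def r_def\<close>)
    then have "\<kappa>'$1 = \<kappa>$1 \<or> \<kappa>'$1 = - \<kappa>$1" by (simp add: power2_eq_iff)
    then show ?thesis using True k2 by (auto intro!: vec2_eqI)
  next
    case False
    then have z: "z = Fin (\<kappa>$1 / \<kappa>$2)" by (simp add: z_def spinor_centre_def)
    then have k2: "\<kappa>'$2 \<noteq> 0" "\<kappa>'$1 / \<kappa>'$2 = \<kappa>$1 / \<kappa>$2"
      using k'(2) by (simp_all add: spinor_centre_def split: if_splits)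
    define G where "G = mat22 (\<kappa>'$1) (- 1 / \<kappa>'$2) (\<kappa>'$2) 0"
    have G: "\<kappa>'$1 * 0 - (- 1 / \<kappa>'$2) * \<kappa>'$2 = 1" "G \<in> SL2" unfolding G_def mat22_in_SL2_iff using k2 by simp_all
    have "\<kappa>'$1 * cnj (\<kappa>'$2) / of_real ((cmod (\<kappa>'$2))\<^sup>2) = \<kappa>$1 / \<kappa>$2"
      unfolding complex_norm_square k2(2)[symmetric] using k2(1) by simp
    then have ptG: "pt G = upt3 (\<kappa>$1 / \<kappa>$2) r"
      using k'(3) k2(1) by (simp add: G_def pt_mat22 spinor_size_def)
    have "v (pt G) = frame_vec G (axis 2 1)" by (rule vG[OF G(2)]) (simp_all add: G_def)
    also have "\<dots> = upt3 (cnj (\<kappa>'$2) ^ 2 * \<i> / of_real ((cmod (\<kappa>'$2))\<^sup>2) ^ 2) 0"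
      unfolding G_def frame_vec_mat22[OF G(1)] by (simp add: Let_def I)
    also have "cnj (\<kappa>'$2) ^ 2 * \<i> / of_real ((cmod (\<kappa>'$2))\<^sup>2) ^ 2 = \<i> / (\<kappa>'$2)\<^sup>2"
      using k2(1) unfolding complex_norm_square by (simp add: field_simps power2_eq_square)
    finally obtain c where c: "c > 0" "\<i> / (\<kappa>'$2)\<^sup>2 = of_real c * (\<i> / (\<kappa>$2)\<^sup>2)"
      using dir ptG z False by (auto simp: specified_by_def spinor_direction_def scale)
    have "\<i> / (\<kappa>'$2)\<^sup>2 = \<i> / (\<kappa>$2)\<^sup>2"
      by (rule positive_multiple_same_norm[OF c(2,1)])
        (use k'(3) k2 False in \<open>simp add: norm_divide norm_power spinor_size_def r_def\<close>)
    then have "\<kappa>'$2 = \<kappa>$2 \<or> \<kappa>'$2 = - \<kappa>$2" by (simp add: power2_eq_iff)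
    moreover have "\<kappa>'$1 = \<kappa>$1 / \<kappa>$2 * \<kappa>'$2" using k2 by (simp add: nonzero_eq_divide_eq flip: k2(2))
    ultimately show ?thesis using False by (auto intro!: vec2_eqI)
  qed
  then show ?thesis using k'(4) by auto
qed

text \<open>A correspondence is the canonical bijection up to one global sign. The sign is locally constant since, for \<open>U\<close> open, the
spin horospheres whose carried spinor lies in \<open>U\<close> form an open set of \<open>HorS_topology\<close>, and \<open>\<complex>\<^sup>2 - {0}\<close> is connected.\<close>

lemma spinor_correspondence_carries:
  assumes "spinor_correspondence \<Phi>"
  shows "(\<forall>\<kappa>. \<kappa> \<noteq> 0 \<longrightarrow> carries \<kappa> (\<Phi> \<kappa>)) \<or> (\<forall>\<kappa>. \<kappa> \<noteq> 0 \<longrightarrow> carries (- \<kappa>) (\<Phi> \<kappa>))"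
proof -
  have cont: "continuous_map (top_of_set (- {0})) HorS_topology \<Phi>"
    and lies: "lies_over_spinor (\<Phi> \<kappa>) \<kappa>" if "\<kappa> \<noteq> 0" for \<kappa>
    using assms that by (auto simp: spinor_correspondence_def)
  \<comment> \<open>the spinor carried by \<open>\<Phi> \<kappa>\<close>\<close>
  define \<sigma> where "\<sigma> \<kappa> = (if carries \<kappa> (\<Phi> \<kappa>) then \<kappa> else - \<kappa>)" for \<kappa>
  have \<sigma>: "carries (\<sigma> \<kappa>) (\<Phi> \<kappa>)" if "\<kappa> \<noteq> 0" for \<kappa>
    using lies_over_spinor_carries[OF that lies[OF that]] by (auto simp: \<sigma>_def)
  have "continuous_map (top_of_set (- {0})) euclidean \<sigma>"
    unfolding continuous_map_def
  proof (intro conjI allI impI)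
    fix U :: "(complex^2) set"
    assume "openin euclidean U"
    then have U: "open U" by simp
    let ?V = "{F. spinor_of F \<in> U}"
    define B where "B = {(H, Win, Wout) \<in> HorS. \<exists>p\<in>H. Win p \<in> ?V}"
    have "?V = spinor_of -` U" by auto
    then have "open ?V" using U by (simp add: open_vimage continuous_intros)
    then have "openin HorS_topology B"
      unfolding HorS_topology_def B_def
      by (intro topology_generated_by_Basis CollectI exI[of _ ?V]) auto
    then have "openin (top_of_set (- {0})) {\<kappa> \<in> topspace (top_of_set (- {0})). \<Phi> \<kappa> \<in> B}"
      using assms by (intro openin_continuous_map_preimage) (auto simp: spinor_correspondence_def)
    moreover have "\<Phi> \<kappa> \<in> B \<longleftrightarrow> \<sigma> \<kappa> \<in> U" if k: "\<kappa> \<noteq> 0" for \<kappa>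
    proof -
      obtain H Win Wout where S: "\<Phi> \<kappa> = (H, Win, Wout)" by (cases "\<Phi> \<kappa>")
      have "\<Phi> \<kappa> \<in> HorS" using lies_over_spinor_HorS_at[OF k lies[OF k]] by (auto simp: HorS_def)
      moreover have "\<sigma> \<kappa> \<noteq> 0" using k by (simp add: \<sigma>_def)
      then obtain p where "p \<in> H" using \<sigma>[OF k] spinor_horosphere_nonempty by (auto simp: carries_def S)
      ultimately show ?thesis using \<sigma>[OF k] by (auto simp: S carries_def B_def)
    qed
    then have "{\<kappa> \<in> topspace (top_of_set (- {0})). \<Phi> \<kappa> \<in> B} = {\<kappa> \<in> topspace (top_of_set (- {0})). \<sigma> \<kappa> \<in> U}"
      by auto
    ultimately show "openin (top_of_set (- {0})) {\<kappa> \<in> topspace (top_of_set (- {0})). \<sigma> \<kappa> \<in> U}" by simp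
  qed auto
  then have "continuous_on (- {0}) \<sigma>" by simp
  moreover have "connected (- {0 :: complex^2})" by (rule connected_punctured_universe) simp
  ultimately have "(\<forall>\<kappa>\<in>- {0}. \<sigma> \<kappa> = \<kappa>) \<or> (\<forall>\<kappa>\<in>- {0}. \<sigma> \<kappa> = - \<kappa>)"
    by (intro constant_sign) (auto simp: \<sigma>_def continuous_intros)
  then show ?thesis using \<sigma> by auto
qed

section \<open>Complex lambda lengths\<close>

lemma pt_diag: "u \<noteq> 0 \<Longrightarrow> pt (diag u) = upt3 0 ((cmod u)\<^sup>2)"
  by (simp add: diag_def pt_mat22 norm_divide power_divide)

lemma mobius_columns:
  assumes "B \<in> SL2"
  shows "mobius B Infty = spinor_centre (vector [B$1$1, B$2$1])"
    "mobius B (Fin 0) = spinor_centre (vector [B$1$2, B$2$2])"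
  by (simp_all add: mobius_def spinor_centre_def)

text \<open>The isometry taking the geodesic from \<open>0\<close> to \<open>\<infinity>\<close> to the one from the centre of \<open>\<kappa>\<close> to the centre of \<open>\<kappa>'\<close>, normalised so
that the base point lands on the horosphere of \<open>\<kappa>\<close>: the columns represent \<open>\<kappa>'\<close> and \<open>\<kappa>\<close>, and the factors make the
determinant \<open>1\<close>.\<close>

definition geodesic_frame :: "complex^2 \<Rightarrow> complex^2 \<Rightarrow> complex^2^2"
  where "geodesic_frame \<kappa> \<kappa>' = mat22 (\<kappa>'$1 / det2 \<kappa> \<kappa>') (- \<kappa>$1) (\<kappa>'$2 / det2 \<kappa> \<kappa>') (- \<kappa>$2)"

context
  fixes \<kappa> \<kappa>' :: "complex^2" and \<delta> E
  assumes det: "det2 \<kappa> \<kappa>' \<noteq> 0"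
  defines "\<delta> \<equiv> det2 \<kappa> \<kappa>'" and "E \<equiv> geodesic_frame \<kappa> \<kappa>'"
begin

lemma det_nonzero: "\<delta> \<noteq> 0" using det by (simp add: \<delta>_def)

lemma spinors_nonzero: "\<kappa> \<noteq> 0" "\<kappa>' \<noteq> 0"
  using det by auto

lemma geodesic_frame_eq: "E = mat22 (\<kappa>'$1 / \<delta>) (- \<kappa>$1) (\<kappa>'$2 / \<delta>) (- \<kappa>$2)"
  by (simp add: E_def geodesic_frame_def \<delta>_def)

lemma geodesic_frame_in_SL2: "E \<in> SL2"
proof -
  have "\<kappa>'$1 / \<delta> * - \<kappa>$2 - (- \<kappa>$1) * (\<kappa>'$2 / \<delta>) = (\<kappa>$1 * \<kappa>'$2 - \<kappa>'$1 * \<kappa>$2) / \<delta>"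
    by (simp add: diff_divide_distrib)
  also have "\<dots> = 1" using det_nonzero by (simp add: \<delta>_def)
  finally show ?thesis unfolding geodesic_frame_eq mat22_in_SL2_iff .
qed

lemma geodesic_frame_diag_in_SL2: "u \<noteq> 0 \<Longrightarrow> E ** diag u \<in> SL2"
  by (intro SL2_mult geodesic_frame_in_SL2 diag_in_SL2)

text \<open>An isometry is determined by the images of \<open>0\<close> and \<open>\<infinity>\<close> up to the diagonal matrices, which fix both.\<close>

lemma geodesic_isometry_iff:
  assumes B: "B \<in> SL2"
  shows "mobius B (Fin 0) = spinor_centre \<kappa> \<and> mobius B Infty = spinor_centre \<kappa>' \<longleftrightarrow> (\<exists>u. u \<noteq> 0 \<and> B = E ** diag u)"
proof
  obtain a b c d where B: "B = mat22 a b c d" "a * d - b * c = 1" using SL2_cases[OF B] .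
  have ne: "(vector [a, c] :: complex^2) \<noteq> 0" "(vector [b, d] :: complex^2) \<noteq> 0"
    using B(2) by (auto simp: vec2_nonzero_iff)
  assume "mobius B (Fin 0) = spinor_centre \<kappa> \<and> mobius B Infty = spinor_centre \<kappa>'"
  then have "det2 (vector [a, c]) \<kappa>' = 0" "det2 (vector [b, d]) \<kappa> = 0"
    using mobius_columns[OF assms] by (simp_all add: B(1) spinor_centre_eq_iff ne spinors_nonzero del: vector_2)
  then have z: "a * \<kappa>'$2 - \<kappa>'$1 * c = 0" "b * \<kappa>$2 - \<kappa>$1 * d = 0" by simp_all
  define C where "C = adj22 E ** B"
  have BC: "B = E ** C" by (simp add: C_def adj22_cancel geodesic_frame_in_SL2)
  have "C$1$2 = 0" "C$2$1 = 0"
    using z by (simp_all add: C_def geodesic_frame_eq adj22_def B(1) mat22_mult algebra_simps flip: diff_divide_distrib)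
  moreover have "C \<in> SL2" unfolding C_def by (intro SL2_mult adj22_in_SL2 geodesic_frame_in_SL2 assms)
  ultimately have "C$1$1 \<noteq> 0 \<and> C = diag (C$1$1)"
    by (auto elim!: SL2_cases simp: diag_def eq_divide_eq mult.commute intro!: mat22_eqI)
  then show "\<exists>u. u \<noteq> 0 \<and> B = E ** diag u" using BC by metis
next
  assume "\<exists>u. u \<noteq> 0 \<and> B = E ** diag u"
  then obtain u where u: "u \<noteq> 0" "B = E ** diag u" by blast
  have "(vector [\<kappa>'$1 / \<delta> * u, \<kappa>'$2 / \<delta> * u] :: complex^2) \<noteq> 0" "(vector [- (\<kappa>$1 / u), - (\<kappa>$2 / u)] :: complex^2) \<noteq> 0"
    using spinors_nonzero u(1) det_nonzero by (auto simp: vec2_nonzero_iff)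
  then show "mobius B (Fin 0) = spinor_centre \<kappa> \<and> mobius B Infty = spinor_centre \<kappa>'"
    unfolding mobius_columns[OF B]
    by (simp add: spinor_centre_eq_iff spinors_nonzero u(2) geodesic_frame_eq diag_def mat22_mult)
qed

lemma geodesic_eq:
  "geodesic (spinor_centre \<kappa>) (spinor_centre \<kappa>') = {pt (E ** diag u) | u. u \<noteq> 0}"
proof -
  have T: "upt3 0 (exp s) = pt (diag (exp (of_real s / 2)))" for s
  proof -
    have "(cmod (exp (complex_of_real s / 2)))\<^sup>2 = exp s"
      by (simp flip: exp_double)
    then show ?thesis by (simp add: pt_diag)
  qed
  have "p \<in> geodesic (spinor_centre \<kappa>) (spinor_centre \<kappa>') \<longleftrightarrow>
     (\<exists>B s. B \<in> SL2 \<and> (mobius B (Fin 0) = spinor_centre \<kappa> \<and> mobius B Infty = spinor_centre \<kappa>') \<and> p = act B (upt3 0 (exp s)))" for p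
    unfolding geodesic_def unit_geodesic_def by auto
  also have "\<dots> p \<longleftrightarrow> (\<exists>u s. u \<noteq> 0 \<and> p = act (E ** diag u) (upt3 0 (exp s)))" for p
    using geodesic_isometry_iff geodesic_frame_diag_in_SL2 by metis
  also have "\<dots> p \<longleftrightarrow> (\<exists>u s. u \<noteq> 0 \<and> p = pt (E ** diag (u * exp (of_real s / 2))))" for p
    unfolding T by (simp add: act_pt geodesic_frame_diag_in_SL2 diag_in_SL2 diag_mult flip: matrix_mul_assoc cong: conj_cong)
  also have "\<dots> p \<longleftrightarrow> (\<exists>u. u \<noteq> 0 \<and> p = pt (E ** diag u))" for p
  proof
    assume "\<exists>u. u \<noteq> 0 \<and> p = pt (E ** diag u)"
    then obtain u where "u \<noteq> 0 \<and> p = pt (E ** diag (u * exp (of_real 0 / 2)))" by auto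
    then show "\<exists>u s. u \<noteq> 0 \<and> p = pt (E ** diag (u * exp (of_real s / 2)))" by blast
  qed (metis exp_not_eq_zero mult_eq_0_iff)
  finally show ?thesis by auto
qed

lemma pt_geodesic_frame: "u \<noteq> 0 \<Longrightarrow> pt (E ** diag u) = act E (upt3 0 ((cmod u)\<^sup>2))"
  by (simp add: geodesic_frame_in_SL2 diag_in_SL2 flip: act_pt pt_diag)

lemma busemann_geodesic_frame:
  assumes "u \<noteq> 0"
  shows "busemann \<kappa> (pt (E ** diag u)) = (cmod u)\<^sup>2" "busemann \<kappa>' (pt (E ** diag u)) = (cmod \<delta>)\<^sup>2 / (cmod u)\<^sup>2"
proof -
  have e: "E *v vector [0, -1] = \<kappa>" "E *v vector [\<delta>, 0] = \<kappa>'"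
    using det_nonzero by (auto simp: geodesic_frame_eq matrix_vector_mult_def sum_2 intro: vec2_eqI)
  have U: "upt3 0 ((cmod u)\<^sup>2) \<in> U3" using assms by simp
  show "busemann \<kappa> (pt (E ** diag u)) = (cmod u)\<^sup>2" "busemann \<kappa>' (pt (E ** diag u)) = (cmod \<delta>)\<^sup>2 / (cmod u)\<^sup>2"
    using busemann_act[OF geodesic_frame_in_SL2 U, of "vector [0, -1]"] busemann_act[OF geodesic_frame_in_SL2 U, of "vector [\<delta>, 0]"] assms
    by (simp_all add: e pt_geodesic_frame busemann_upt3 power2_eq_square)
qed

lemma geodesic_horosphere:
  "geodesic (spinor_centre \<kappa>) (spinor_centre \<kappa>') \<inter> spinor_horosphere \<kappa> = {pt E}"
  "geodesic (spinor_centre \<kappa>) (spinor_centre \<kappa>') \<inter> spinor_horosphere \<kappa>' = {pt (E ** diag \<delta>)}"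
proof -
  have U: "pt (E ** diag u) \<in> U3" if "u \<noteq> 0" for u by (intro pt_in_U3 geodesic_frame_diag_in_SL2 that)
  have H: "pt (E ** diag u) \<in> spinor_horosphere \<kappa> \<longleftrightarrow> (cmod u)\<^sup>2 = 1"
    "pt (E ** diag u) \<in> spinor_horosphere \<kappa>' \<longleftrightarrow> (cmod u)\<^sup>2 = (cmod \<delta>)\<^sup>2" if "u \<noteq> 0" for u
    using U[OF that] that by (simp_all add: spinor_horosphere_busemann spinors_nonzero busemann_geodesic_frame)
  have E1: "pt E = pt (E ** diag 1)" by (simp add: diag_def flip: mat22_one)
  have "pt (E ** diag u) = pt E" if "u \<noteq> 0" "(cmod u)\<^sup>2 = 1" for u
    unfolding E1 using that by (simp add: pt_geodesic_frame)
  moreover have "\<exists>u. u \<noteq> 0 \<and> pt E = pt (E ** diag u)" using E1 one_neq_zero by blast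
  moreover have "pt E \<in> spinor_horosphere \<kappa>" unfolding E1 using H(1)[of 1] by simp
  ultimately show "geodesic (spinor_centre \<kappa>) (spinor_centre \<kappa>') \<inter> spinor_horosphere \<kappa> = {pt E}"
    unfolding geodesic_eq using H(1) by blast
  have "pt (E ** diag u) = pt (E ** diag \<delta>)" if "u \<noteq> 0" "(cmod u)\<^sup>2 = (cmod \<delta>)\<^sup>2" for u
    unfolding pt_geodesic_frame[OF that(1)] pt_geodesic_frame[OF det_nonzero] that(2) ..
  then show "geodesic (spinor_centre \<kappa>) (spinor_centre \<kappa>') \<inter> spinor_horosphere \<kappa>' = {pt (E ** diag \<delta>)}"
    unfolding geodesic_eq using H(2) det_nonzero by blast
qed

text \<open>\<open>rot2 (- pi / 2)\<close> makes the third vector of the base frame, which is tangent to the geodesic from \<open>0\<close> to \<open>\<infinity>\<close>, the first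
vector of the frame.\<close>

lemma adapted_geodesic_frame:
  assumes u: "u \<noteq> 0"
  shows "adapted (spinor_centre \<kappa>) (spinor_centre \<kappa>') (E ** diag u ** rot2 (- pi / 2))"
proof -
  let ?B = "E ** diag u"
  let ?\<gamma> = "\<lambda>s. act ?B (upt3 0 (exp s))"
  have B: "?B \<in> SL2" by (rule geodesic_frame_diag_in_SL2[OF u])
  have "((\<lambda>s::real. upt3 0 (exp s)) has_derivative (\<lambda>h. upt3 0 (h * exp 0))) (at 0)"
    by (rule has_derivative_upt3) (auto intro!: derivative_eq_intros)
  moreover have "(act ?B has_derivative frame_vec ?B) (at (upt3 0 (exp 0)))"
    unfolding frame_vec_def act_tangent_def
    using act_differentiable[OF B, of "upt3 0 1"] by (simp add: frechet_derivative_works)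
  ultimately have "(?\<gamma> has_derivative (\<lambda>h. frame_vec ?B (upt3 0 (h * exp 0)))) (at 0)"
    by (rule has_derivative_compose)
  moreover have "upt3 0 (h * exp 0) = h *\<^sub>R axis 3 1" for h
    by (simp add: vec_eq_iff forall_3)
  ultimately have "(?\<gamma> has_vector_derivative frame_vec ?B (axis 3 1)) (at 0)"
    by (simp add: has_vector_derivative_def linear_cmul[OF frame_vec_linear[OF B]])
  then have der: "vector_derivative ?\<gamma> (at 0) = frame_vec ?B (axis 3 1)" by (rule vector_derivative_at)
  have "unit_geodesic (spinor_centre \<kappa>) (spinor_centre \<kappa>') ?\<gamma>"
    unfolding unit_geodesic_def using B geodesic_isometry_iff[OF B] u by blast
  moreover have "fst (frame_of (?B ** rot2 (- pi / 2))) = ?\<gamma> 0"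
    by (simp add: frame_of_eq frame_vec_mult_stabiliser[OF B rot_in_SL2(2) pt_rot(2)] flip: pt_def)
  moreover have "fst (snd (frame_of (?B ** rot2 (- pi / 2)))) = vector_derivative ?\<gamma> (at 0)"
    unfolding der by (simp add: frame_of_eq frame_vec_mult_stabiliser[OF B rot_in_SL2(2) pt_rot(2)] frame_vec_rot2)
  moreover have "?B ** rot2 (- pi / 2) \<in> SL2" by (intro SL2_mult[of ?B] B rot_in_SL2)
  ultimately show ?thesis unfolding adapted_def by blast
qed

text \<open>Rotation about the first vector of an adapted frame is rotation about the axis of the geodesic, a diagonal matrix.\<close>

lemma rot2_rot1: "rot2 (- pi / 2) ** rot1 \<theta> = diag (exp (\<i> * of_real \<theta> / 2)) ** rot2 (- pi / 2)"
proof -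
  have c: "cos (pi / 4) = sqrt 2 / 2" "sin (pi / 4) = sqrt 2 / 2" by (simp_all add: cos_45 sin_45)
  have e: "exp (\<i> * of_real \<theta> / 2) = of_real (cos (\<theta>/2)) + \<i> * of_real (sin (\<theta>/2))"
  proof -
    have "\<i> * of_real \<theta> / 2 = \<i> * of_real (\<theta>/2)" by simp
    then show ?thesis by (simp only: exp_Euler cos_of_real sin_of_real)
  qed
  have "1 / exp (\<i> * of_real \<theta> / 2) = exp (- (\<i> * of_real \<theta> / 2))" by (simp add: exp_minus inverse_eq_divide)
  also have "\<dots> = exp (\<i> * of_real (- (\<theta>/2)))" by simp
  also have "\<dots> = of_real (cos (\<theta>/2)) - \<i> * of_real (sin (\<theta>/2))"
    by (simp only: exp_Euler cos_of_real sin_of_real cos_minus sin_minus of_real_minus) simp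
  finally have e': "1 / exp (\<i> * of_real \<theta> / 2) = of_real (cos (\<theta>/2)) - \<i> * of_real (sin (\<theta>/2))" .
  show ?thesis
    unfolding diag_def e' unfolding e
    by (auto simp: rot2_def rot1_def mat22_mult c algebra_simps intro!: mat22_eqI)
qed

text \<open>In the coordinates given by \<open>E\<close>, translating by \<open>\<rho>\<close> and rotating by \<open>\<theta>\<close> is multiplication by \<open>diag (exp ((\<rho> + \<i>\<theta>) / 2))\<close>.
The halves are there because \<open>diag u\<close> acts on the boundary as multiplication by \<open>u\<^sup>2\<close>.\<close>

lemma complex_distance_iff:
  assumes u: "u \<noteq> 0"
  shows "complex_distance (spinor_centre \<kappa>) (spinor_centre \<kappa>') (E ** rot2 (- pi / 2)) (E ** diag u ** rot2 (- pi / 2)) l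
    \<longleftrightarrow> exp (l / 2) = u"
proof -
  let ?F = "E ** rot2 (- pi / 2)"
  have E1: "E ** diag 1 = E" by (simp add: diag_def flip: mat22_one)
  have F: "?F \<in> SL2" by (intro SL2_mult geodesic_frame_in_SL2 rot_in_SL2)
  have ad: "adapted (spinor_centre \<kappa>) (spinor_centre \<kappa>') ?F"
    using adapted_geodesic_frame[of 1] by (simp add: E1)
  have trans: "spin_translate (spinor_centre \<kappa>) (spinor_centre \<kappa>') \<rho> ?F X \<longleftrightarrow> X = E ** diag (exp (of_real \<rho> / 2)) ** rot2 (- pi / 2)" for \<rho> X
  proof -
    have *: "(E ** diag v) ** axis_translation \<rho> ** adj22 (E ** diag v) ** ?F = E ** diag (exp (of_real \<rho> / 2)) ** rot2 (- pi / 2)"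
      if v: "v \<noteq> 0" for v
    proof -
      have "adj22 (diag v) = diag (1 / v)" by (simp add: adj22_def diag_def)
      then have "(E ** diag v) ** axis_translation \<rho> ** adj22 (E ** diag v) ** ?F
        = E ** ((diag v ** diag (exp (of_real \<rho> / 2))) ** diag (1 / v)) ** (adj22 E ** E) ** rot2 (- pi / 2)"
        by (simp add: axis_translation_eq adj22_mult matrix_mul_assoc)
      then show ?thesis using v by (simp add: adj22_inverse geodesic_frame_in_SL2 diag_mult)
    qed
    have "spin_translate (spinor_centre \<kappa>) (spinor_centre \<kappa>') \<rho> ?F X \<longleftrightarrow>
      (\<exists>v. v \<noteq> 0 \<and> X = (E ** diag v) ** axis_translation \<rho> ** adj22 (E ** diag v) ** ?F)"
      unfolding spin_translate_iff[OF F] using geodesic_isometry_iff geodesic_frame_diag_in_SL2 by metis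
    also have "\<dots> \<longleftrightarrow> X = E ** diag (exp (of_real \<rho> / 2)) ** rot2 (- pi / 2)"
      using * by (metis one_neq_zero)
    finally show ?thesis .
  qed
  have rot: "spin_rot_first \<theta> (E ** diag v ** rot2 (- pi / 2)) X \<longleftrightarrow> X = E ** diag (v * exp (\<i> * of_real \<theta> / 2)) ** rot2 (- pi / 2)"
    if v: "v \<noteq> 0" for \<theta> X v
  proof -
    have "E ** diag v ** rot2 (- pi / 2) ** rot1 \<theta> = E ** (diag v ** (rot2 (- pi / 2) ** rot1 \<theta>))"
      by (simp add: matrix_mul_assoc)
    also have "\<dots> = E ** (diag v ** diag (exp (\<i> * of_real \<theta> / 2))) ** rot2 (- pi / 2)"
      unfolding rot2_rot1 by (simp add: matrix_mul_assoc)
    finally show ?thesis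
      using spin_rot_iff(1)[OF SL2_mult[OF geodesic_frame_diag_in_SL2[OF v] rot_in_SL2(2)]] by (simp add: diag_mult)
  qed
  have "exp (of_real (Re l) / 2) * exp (\<i> * of_real (Im l) / 2) = exp (l / 2)"
    by (subst complex_eq[of l], simp add: add_divide_distrib exp_add del: complex_eq_iff)
  then have "complex_distance (spinor_centre \<kappa>) (spinor_centre \<kappa>') ?F (E ** diag u ** rot2 (- pi / 2)) l
    \<longleftrightarrow> E ** diag u ** rot2 (- pi / 2) = E ** diag (exp (l / 2)) ** rot2 (- pi / 2)"
    unfolding complex_distance_def using ad adapted_geodesic_frame[OF u] trans rot by auto
  also have "\<dots> \<longleftrightarrow> diag u = diag (exp (l / 2))"
    by (metis geodesic_frame_in_SL2 adj22_cancel(1) adj22_cancel(3) rot_in_SL2(2))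
  also have "\<dots> \<longleftrightarrow> exp (l / 2) = u"
    unfolding diag_def by (metis mat22_nth(1))
  finally show ?thesis .
qed

text \<open>In the coordinates given by \<open>E\<close>, the inward frame of the first horosphere is \<open>rot2 (- pi / 2)\<close>, and the outward frame of the
second is \<open>diag \<delta> ** rot2 (- pi / 2)\<close>: its inward frame is \<open>diag \<delta> ** rot2 (pi / 2)\<close>, and the passage from inward to outward
by the angle \<open>- pi\<close>, with its sign, is what makes the lambda length \<open>\<delta>\<close> and not \<open>- \<delta>\<close>.\<close>

lemma complex_lambda_carries:
  assumes "carries \<kappa> S" "carries \<kappa>' S'"
  shows "complex_lambda (spinor_centre \<kappa>, S) (spinor_centre \<kappa>', S') = \<delta>"
proof -
  obtain H Win Wout where S: "S = (H, Win, Wout)" by (cases S)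
  obtain H' Win' Wout' where S': "S' = (H', Win', Wout')" by (cases S')
  have H: "H = spinor_horosphere \<kappa>" "H' = spinor_horosphere \<kappa>'" using assms by (simp_all add: carries_def S S')
  have pH: "pt E \<in> H" "pt (E ** diag \<delta>) \<in> H'" using geodesic_horosphere unfolding H by blast+
  have F: "E ** rot2 (- pi / 2) \<in> SL2" by (intro SL2_mult geodesic_frame_in_SL2 rot_in_SL2)
  have F': "E ** diag \<delta> ** rot2 (pi / 2) \<in> SL2" by (intro SL2_mult[of "E ** diag \<delta>"] geodesic_frame_diag_in_SL2 det_nonzero rot_in_SL2)
  have J: "rot2 (- pi) *v vector [1, 0] = vector [0, -1]"
    by (auto simp: matrix_vec_e1 rot2_def intro: vec2_eqI)
  have W: "Win (pt E) = E ** rot2 (- pi / 2)"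
  proof (rule spin_frame_unique[OF F])
    show "Win (pt E) \<in> SL2" using assms(1) pH by (simp add: carries_def S)
    show "pt (Win (pt E)) = pt (E ** rot2 (- pi / 2))"
      using assms(1) pH by (simp add: carries_def S frame_vec_mult_stabiliser[OF geodesic_frame_in_SL2 rot_in_SL2(2) pt_rot(2)])
    have "spinor_of (E ** rot2 (- pi / 2)) = \<kappa>"
      by (simp add: spinor_of_def rot2_add J flip: matrix_mul_assoc matrix_vector_mul_assoc)
        (auto simp: geodesic_frame_eq matrix_vector_mult_def sum_2 intro: vec2_eqI)
    then show "spinor_of (Win (pt E)) = spinor_of (E ** rot2 (- pi / 2))"
      using assms(1) pH by (simp add: carries_def S)
  qed
  have "Win' (pt (E ** diag \<delta>)) = E ** diag \<delta> ** rot2 (pi / 2)"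
  proof (rule spin_frame_unique[OF F'])
    show "Win' (pt (E ** diag \<delta>)) \<in> SL2" using assms(2) pH by (simp add: carries_def S')
    show "pt (Win' (pt (E ** diag \<delta>))) = pt (E ** diag \<delta> ** rot2 (pi / 2))"
      using assms(2) pH by (simp add: carries_def S' frame_vec_mult_stabiliser[OF geodesic_frame_diag_in_SL2[OF det_nonzero] rot_in_SL2(2) pt_rot(2)])
    have "spinor_of (E ** diag \<delta> ** rot2 (pi / 2)) = \<kappa>'"
      using det_nonzero by (auto simp: spinor_of_rot2 geodesic_frame_eq diag_def mat22_mult intro: vec2_eqI)
    then show "spinor_of (Win' (pt (E ** diag \<delta>))) = spinor_of (E ** diag \<delta> ** rot2 (pi / 2))"
      using assms(2) pH by (simp add: carries_def S')
  qed
  then have W': "Wout' (pt (E ** diag \<delta>)) = E ** diag \<delta> ** rot2 (- pi / 2)"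
    using assms(2) pH by (simp add: carries_def S' rot2_add flip: matrix_mul_assoc)
  have "complex_lambda (spinor_centre \<kappa>, S) (spinor_centre \<kappa>', S') =
    (THE l. \<exists>d. complex_distance (spinor_centre \<kappa>) (spinor_centre \<kappa>') (E ** rot2 (- pi / 2)) (E ** diag \<delta> ** rot2 (- pi / 2)) d \<and> l = exp (d / 2))"
    unfolding complex_lambda_def S S' prod.case H geodesic_horosphere by (simp add: W W')
  also have "\<dots> = (THE l. \<exists>d. exp (d / 2) = \<delta> \<and> l = exp (d / 2))"
    by (simp only: complex_distance_iff[OF det_nonzero])
  also have "\<dots> = \<delta>"
  proof (rule the_equality)
    show "\<exists>d. exp (d / 2) = \<delta> \<and> \<delta> = exp (d / 2)" using det_nonzero by (intro exI[of _ "2 * Ln \<delta>"]) simp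
  qed auto
  finally show ?thesis .
qed

end

section \<open>Quotients and minors\<close>

text \<open>Both identifications have this shape: the matrices \<open>X\<close> parametrise all polygons \<open>Y\<close>, and two of them give related polygons
exactly when they have the same wedge \<open>w\<close> of rows.\<close>

lemma quotient_bijection:
  assumes h: "h ` X = Y" and R: "R \<subseteq> Y \<times> Y"
    and w: "\<And>M N. M \<in> X \<Longrightarrow> N \<in> X \<Longrightarrow> (h M, h N) \<in> R \<longleftrightarrow> w M = w N"
  obtains f where "bij_betw f (w ` X) (Y // R)" "\<And>M. M \<in> X \<Longrightarrow> f (w M) = R `` {h M}"
    "\<And>M P. M \<in> X \<Longrightarrow> P \<in> f (w M) \<Longrightarrow> \<exists>N\<in>X. w N = w M \<and> P = h N"
proof -
  define g where "g y = (SOME M. M \<in> X \<and> w M = y)" for y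
  define f where "f y = R `` {h (g y)}" for y
  have g: "g (w M) \<in> X \<and> w (g (w M)) = w M" if "M \<in> X" for M
    unfolding g_def by (rule someI[of _ M]) (use that in simp)
  have cls: "R `` {h M} = {h N | N. N \<in> X \<and> w N = w M}" if "M \<in> X" for M
  proof (intro equalityI subsetI)
    fix P assume P: "P \<in> R `` {h M}"
    then obtain N where "N \<in> X" "P = h N" using R h by blast
    then show "P \<in> {h N | N. N \<in> X \<and> w N = w M}" using P w[OF that] by auto
  next
    fix P assume "P \<in> {h N | N. N \<in> X \<and> w N = w M}"
    then show "P \<in> R `` {h M}" using w[OF that] by auto
  qed
  have f: "f (w M) = R `` {h M}" if "M \<in> X" for M
    unfolding f_def using cls[OF that] cls[of "g (w M)"] g[OF that] by simp
  have "inj_on f (w ` X)"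
  proof (rule inj_onI)
    fix y z assume "y \<in> w ` X" "z \<in> w ` X" "f y = f z"
    then obtain M N where MN: "M \<in> X" "N \<in> X" "y = w M" "z = w N" by auto
    then have "h M \<in> R `` {h N}" using \<open>f y = f z\<close> w[OF MN(1,1)] by (auto simp: f)
    then show "y = z" using w[OF MN(2,1)] MN by simp
  qed
  moreover have "f ` (w ` X) = Y // R"
  proof -
    have "f ` (w ` X) = (\<lambda>M. R `` {h M}) ` X" by (simp add: image_image f)
    also have "\<dots> = Y // R" unfolding quotient_def h[symmetric] UNION_singleton_eq_range image_image ..
    finally show ?thesis .
  qed
  ultimately have "bij_betw f (w ` X) (Y // R)" by (simp add: bij_betw_def)
  then show ?thesis
  proof (rule that)
    show "\<exists>N\<in>X. w N = w M \<and> P = h N" if "M \<in> X" "P \<in> f (w M)" for M P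
      using that(2) unfolding f[OF that(1)] cls[OF that(1)] by blast
  qed (rule f)
qed

lemma plucker_eq: "plucker M i j = det2 (M i) (M j)"
  by (simp add: plucker_def det_2 transpose_def)

lemma row_wedge_eq_iff:
  fixes M N :: "nat \<Rightarrow> 'a::comm_ring_1^2"
  shows "row_wedge d M = row_wedge d N \<longleftrightarrow> (\<forall>i\<in>{1..d}. \<forall>j\<in>{1..d}. det2 (M i) (M j) = det2 (N i) (N j))"
proof -
  have "row_wedge d L = (\<lambda>(i, j)\<in>{1..d} \<times> {1..d}. det2 (L i) (L j))" for L :: "nat \<Rightarrow> 'a^2"
    by (simp add: row_wedge_def wedge_def mult.commute)
  then show ?thesis by (auto simp: restrict_def fun_eq_iff)
qed

text \<open>Cramer's rule expresses each column through the columns \<open>i\<close> and \<open>j\<close> with minors as coefficients, so the linear map matching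
these two columns matches all of them.\<close>

lemma equal_minors_SL2:
  fixes M N :: "nat \<Rightarrow> 'a::field^2"
  assumes ij: "i \<in> I" "j \<in> I" and ne: "det2 (M i) (M j) \<noteq> 0"
    and eq: "\<And>k l. k \<in> I \<Longrightarrow> l \<in> I \<Longrightarrow> det2 (M k) (M l) = det2 (N k) (N l)"
  obtains A where "A \<in> SL2" "\<And>k. k \<in> I \<Longrightarrow> N k = A *v M k"
proof -
  define m where "m = det2 (M i) (M j)"
  \<comment> \<open>the matrix with columns \<open>N i, N j\<close> times the inverse of the matrix with columns \<open>M i, M j\<close>\<close>
  define A where "A = mat22
    ((N i$1 * M j$2 - N j$1 * M i$2) / m) ((N j$1 * M i$1 - N i$1 * M j$1) / m)
    ((N i$2 * M j$2 - N j$2 * M i$2) / m) ((N j$2 * M i$1 - N i$2 * M j$1) / m)"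
  have m: "m \<noteq> 0" "det2 (N i) (N j) = m" using ne eq[OF ij] by (simp_all add: m_def)
  have "A$1$1 * A$2$2 - A$1$2 * A$2$1 = (det2 (N i) (N j) * m) / (m * m)"
    by (simp add: A_def m_def diff_divide_distrib[symmetric] algebra_simps)
  then have "A \<in> SL2" using m by (simp add: SL2_def det_2)
  moreover have "N k = A *v M k" if k: "k \<in> I" for k
  proof -
    have e: "det2 (M k) (M j) = det2 (N k) (N j)" "det2 (M i) (M k) = det2 (N i) (N k)"
      using eq k ij by auto
    have "(A *v M k) $ 1 = (N i$1 * det2 (M k) (M j) + N j$1 * det2 (M i) (M k)) / m"
      "(A *v M k) $ 2 = (N i$2 * det2 (M k) (M j) + N j$2 * det2 (M i) (M k)) / m"
      by (simp_all add: A_def matrix_vector_mult_def sum_2 add_divide_distrib[symmetric] algebra_simps)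
    moreover have "N i$1 * det2 (N k) (N j) + N j$1 * det2 (N i) (N k) = N k$1 * det2 (N i) (N j)"
      "N i$2 * det2 (N k) (N j) + N j$2 * det2 (N i) (N k) = N k$2 * det2 (N i) (N j)"
      by (simp_all add: algebra_simps)
    ultimately show ?thesis unfolding e m(2) using m(1) by (intro vec2_eqI) simp_all
  qed
  ultimately show ?thesis by (rule that)
qed

section \<open>Spin-decorated skew ideal polygons\<close>

lemma det2_off_diagonal:
  assumes "M \<in> Mat_nz d" "i \<in> {1..d}" "j \<in> {1..d}" "i \<noteq> j"
  shows "det2 (M i) (M j) \<noteq> 0"
proof -
  have "det2 (M k) (M l) \<noteq> 0" if "k \<in> {1..d}" "l \<in> {1..d}" "k < l" for k l
    using assms(1) that by (simp add: Mat_nz_def plucker_eq)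
  then have "det2 (M i) (M j) \<noteq> 0 \<or> det2 (M j) (M i) \<noteq> 0" using assms(2-4) nat_neq_iff by blast
  then show ?thesis by (metis right_minus_eq)
qed

lemma Mat_nz_nonzero:
  assumes "d \<ge> 2" "M \<in> Mat_nz d" "i \<in> {1..d}" shows "M i \<noteq> 0"
proof -
  define j where "j = (if i = 1 then 2 else 1 :: nat)"
  have "j \<in> {1..d}" "j \<noteq> i" using assms by (auto simp: j_def)
  then show ?thesis using det2_off_diagonal[OF assms(2,3), of j] by auto
qed

text \<open>A spin-decorated skew polygon is a family of spinors with pairwise distinct centres, that is with nonzero minors. The map
\<open>\<tau>\<close>, either the identity or \<open>-1\<close>, absorbs the global sign of the correspondence; minors do not see it.\<close>

lemma skew_polygons:
  assumes d: "d \<ge> 2" and \<Phi>: "spinor_correspondence \<Phi>"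
  shows "\<exists>f. bij_betw f (cone_nz d) (Teich3 d) \<and>
        (\<forall>M\<in>Mat_nz d.
          f (row_wedge d M) = spin_polygon_rel d `` {horosphere_polygon \<Phi> d M} \<and>
          (\<forall>P\<in>f (row_wedge d M). \<forall>i\<in>{1..d}. \<forall>j\<in>{1..d}.
            i < j \<longrightarrow> complex_lambda (P i) (P j) = plucker M i j))"
proof -
  obtain \<tau> :: "complex^2 \<Rightarrow> complex^2" where \<tau>: "\<tau> = (\<lambda>\<kappa>. \<kappa>) \<or> \<tau> = uminus"
    and car: "\<And>\<kappa>. \<kappa> \<noteq> 0 \<Longrightarrow> carries (\<tau> \<kappa>) (\<Phi> \<kappa>)"
    using spinor_correspondence_carries[OF \<Phi>] by (metis (no_types))
  have \<tau>_simps: "\<tau> (\<tau> \<kappa>) = \<kappa>" "\<tau> \<kappa> = 0 \<longleftrightarrow> \<kappa> = 0" "A *v \<tau> \<kappa> = \<tau> (A *v \<kappa>)"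
    "spinor_centre (\<tau> \<kappa>) = spinor_centre \<kappa>" "det2 (\<tau> \<kappa>) (\<tau> \<kappa>') = det2 \<kappa> \<kappa>'" "\<tau> \<kappa> = \<tau> \<kappa>' \<longleftrightarrow> \<kappa> = \<kappa>'" for \<kappa> \<kappa>' A
    using \<tau> by (auto simp: spinor_centre_def uminus_matrix_vec)
  let ?h = "horosphere_polygon \<Phi> d"
  have ne: "M i \<noteq> 0" if "M \<in> Mat_nz d" "i \<in> {1..d}" for M i using Mat_nz_nonzero[OF d that] .
  have surj: "?h ` Mat_nz d = spin_polygons d"
  proof (intro equalityI subsetI)
    fix P assume "P \<in> ?h ` Mat_nz d"
    then obtain M where M: "M \<in> Mat_nz d" "P = ?h M" by blast
    have "inj_on (\<lambda>i. fst (P i)) {1..d}"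
      using det2_off_diagonal[OF M(1)] ne[OF M(1)]
      by (intro inj_onI) (auto simp: M(2) horosphere_polygon_def spinor_centre_eq_iff)
    moreover have "\<Phi> (M i) \<in> HorS_at (spinor_centre (M i))" if "i \<in> {1..d}" for i
      using \<Phi> ne[OF M(1) that] by (intro lies_over_spinor_HorS_at) (auto simp: spinor_correspondence_def)
    ultimately show "P \<in> spin_polygons d"
      by (auto simp: spin_polygons_def M(2) horosphere_polygon_def)
  next
    fix P assume P: "P \<in> spin_polygons d"
    have "\<exists>\<kappa>. \<kappa> \<noteq> 0 \<and> spinor_centre \<kappa> = fst (P i) \<and> carries \<kappa> (snd (P i))" if "i \<in> {1..d}" for i
      using P that HorS_at_carries[of "snd (P i)" "fst (P i)"] by (auto simp: spin_polygons_def)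
    then obtain \<kappa> where \<kappa>: "\<And>i. i \<in> {1..d} \<Longrightarrow> \<kappa> i \<noteq> 0" "\<And>i. i \<in> {1..d} \<Longrightarrow> spinor_centre (\<kappa> i) = fst (P i)"
       "\<And>i. i \<in> {1..d} \<Longrightarrow> carries (\<kappa> i) (snd (P i))" by metis
    define M where "M = (\<lambda>i\<in>{1..d}. \<tau> (\<kappa> i))"
    have Mi: "M i = \<tau> (\<kappa> i)" if "i \<in> {1..d}" for i using that by (simp add: M_def)
    have "\<Phi> (M i) = snd (P i)" if "i \<in> {1..d}" for i
      using car[of "M i"] \<kappa>[OF that] by (intro carries_unique[of "\<kappa> i"]) (simp_all add: Mi[OF that] \<tau>_simps)
    then have "P i = ?h M i" for i
      using P \<kappa>(2) by (cases "i \<in> {1..d}")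
        (auto simp: horosphere_polygon_def Mi \<tau>_simps prod_eq_iff spin_polygons_def extensional_def)
    moreover have "M \<in> Mat_nz d"
    proof -
      have "det2 (M i) (M j) \<noteq> 0" if ij: "i \<in> {1..d}" "j \<in> {1..d}" "i < j" for i j
      proof -
        have "inj_on (\<lambda>i. fst (P i)) {1..d}" using P by (simp add: spin_polygons_def)
        then have "fst (P i) \<noteq> fst (P j)" using ij by (metis inj_on_eq_iff less_irrefl)
        then show ?thesis unfolding Mi[OF ij(1)] Mi[OF ij(2)] \<tau>_simps
          by (simp only: \<kappa>(2)[OF ij(1), symmetric] \<kappa>(2)[OF ij(2), symmetric]
            spinor_centre_eq_iff[OF \<kappa>(1)[OF ij(1)] \<kappa>(1)[OF ij(2)]] not_False_eq_True)
      qed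
      then show ?thesis by (auto simp: Mat_nz_def plucker_eq M_def)
    qed
    ultimately show "P \<in> ?h ` Mat_nz d" by blast
  qed
  have rel: "(?h M, ?h N) \<in> spin_polygon_rel d \<longleftrightarrow> row_wedge d M = row_wedge d N"
    if M: "M \<in> Mat_nz d" and N: "N \<in> Mat_nz d" for M N
  proof -
    have "(?h M, ?h N) \<in> spin_polygon_rel d \<longleftrightarrow> (\<exists>A\<in>SL2. \<forall>i\<in>{1..d}. 
        spinor_centre (N i) = mobius A (spinor_centre (M i)) \<and> \<Phi> (N i) = act_spin_horosphere A (\<Phi> (M i)))"
      using surj M N by (auto simp: spin_polygon_rel_def horosphere_polygon_def)
    also have "\<dots> \<longleftrightarrow> (\<exists>A\<in>SL2. \<forall>i\<in>{1..d}. N i = A *v M i)"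
    proof (intro bex_cong refl ball_cong)
      fix A :: "complex^2^2" and i assume A: "A \<in> SL2" and i: "i \<in> {1..d}"
      have Mi: "M i \<noteq> 0" "N i \<noteq> 0" using ne M N i by auto
      have c: "carries (\<tau> (A *v M i)) (act_spin_horosphere A (\<Phi> (M i)))"
        using carries_act[OF A, of "\<tau> (M i)"] car[OF Mi(1)] Mi(1) by (simp add: \<tau>_simps)
      show "(spinor_centre (N i) = mobius A (spinor_centre (M i)) \<and> \<Phi> (N i) = act_spin_horosphere A (\<Phi> (M i))) \<longleftrightarrow> N i = A *v M i"
      proof
        assume "N i = A *v M i"
        then show "spinor_centre (N i) = mobius A (spinor_centre (M i)) \<and> \<Phi> (N i) = act_spin_horosphere A (\<Phi> (M i))"
          using mobius_spinor_centre[OF A Mi(1)] carries_unique[OF car[OF Mi(2)]] c by simp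
      next
        assume "spinor_centre (N i) = mobius A (spinor_centre (M i)) \<and> \<Phi> (N i) = act_spin_horosphere A (\<Phi> (M i))"
        then have "carries (\<tau> (A *v M i)) (\<Phi> (N i))" using c by simp
        from carries_inj[OF car[OF Mi(2)] this] show "N i = A *v M i" using Mi(2) by (simp add: \<tau>_simps)
      qed
    qed
    also have "\<dots> \<longleftrightarrow> row_wedge d M = row_wedge d N"
    proof
      assume "\<exists>A\<in>SL2. \<forall>i\<in>{1..d}. N i = A *v M i"
      then show "row_wedge d M = row_wedge d N" unfolding row_wedge_eq_iff using det2_SL2 by metis
    next
      assume eq: "row_wedge d M = row_wedge d N"
      have I: "1 \<in> {1..d}" "2 \<in> {1..d}" using d by simp_all
      obtain A where "A \<in> SL2" "\<And>k. k \<in> {1..d} \<Longrightarrow> N k = A *v M k"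
      proof (rule equal_minors_SL2[OF I])
        show "det2 (M 1) (M 2) \<noteq> 0" by (rule det2_off_diagonal[OF M I]) simp
        show "det2 (M k) (M l) = det2 (N k) (N l)" if "k \<in> {1..d}" "l \<in> {1..d}" for k l
          using eq that unfolding row_wedge_eq_iff by blast
      qed blast
      then show "\<exists>A\<in>SL2. \<forall>i\<in>{1..d}. N i = A *v M i" by blast
    qed
    finally show ?thesis .
  qed
  have "spin_polygon_rel d \<subseteq> spin_polygons d \<times> spin_polygons d" by (auto simp: spin_polygon_rel_def)
  from quotient_bijection[where w = "row_wedge d", OF surj this rel]
  obtain f where f: "bij_betw f (row_wedge d ` Mat_nz d) (spin_polygons d // spin_polygon_rel d)"
    "\<And>M. M \<in> Mat_nz d \<Longrightarrow> f (row_wedge d M) = spin_polygon_rel d `` {?h M}"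
    "\<And>M P. M \<in> Mat_nz d \<Longrightarrow> P \<in> f (row_wedge d M) \<Longrightarrow> \<exists>N\<in>Mat_nz d. row_wedge d N = row_wedge d M \<and> P = ?h N"
    by blast
  have "complex_lambda (P i) (P j) = plucker M i j"
    if M: "M \<in> Mat_nz d" and P: "P \<in> f (row_wedge d M)" and ij: "i \<in> {1..d}" "j \<in> {1..d}" "i < j" for M P i j
  proof -
    obtain N where N: "N \<in> Mat_nz d" "row_wedge d N = row_wedge d M" "P = ?h N" using f(3)[OF M P] by blast
    have "det2 (\<tau> (N i)) (\<tau> (N j)) \<noteq> 0" using det2_off_diagonal[OF N(1) ij(1,2)] ij(3) by (simp add: \<tau>_simps)
    from complex_lambda_carries[OF this car[OF ne[OF N(1) ij(1)]] car[OF ne[OF N(1) ij(2)]]]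
    have "complex_lambda (P i) (P j) = det2 (N i) (N j)"
      using ij by (simp add: N(3) horosphere_polygon_def \<tau>_simps)
    then show ?thesis using N(2) ij by (simp add: row_wedge_eq_iff plucker_eq)
  qed
  then show ?thesis using f(1,2) unfolding cone_nz_def Teich3_def by blast
qed

section \<open>Horocycles and their distances\<close>

lemma cvec_nth [simp]: "cvec x $ i = of_real (x $ i)"
  by (simp add: cvec_def)

lemma cvec_eq_0_iff [simp]: "cvec x = 0 \<longleftrightarrow> x = 0"
  by (simp add: vec_eq_iff)

lemma map_matrix_SL2: "A \<in> SL2 \<Longrightarrow> map_matrix complex_of_real A \<in> SL2"
  by (simp add: SL2_def det_2 flip: of_real_mult of_real_diff)

lemma cvec_mult: "map_matrix complex_of_real A *v cvec x = cvec (A *v x)"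
  by (rule vec2_eqI) (simp_all add: matrix_vector_mult_def sum_2)

lemma act_real_U2:
  assumes A: "A \<in> SL2" and p: "p \<in> U2"
  shows "act (map_matrix complex_of_real A) p \<in> U2"
proof -
  obtain a b c d where A': "A = mat22 a b c d" "a * d - b * c = 1" using SL2_cases[OF A] .
  have M: "map_matrix complex_of_real A = mat22 (of_real a) (of_real b) (of_real c) (of_real d)"
    by (rule mat22_eqI) (simp_all add: A')
  obtain z t where z: "p = upt3 z t" by (rule upt3_cases)
  have "z = of_real (Re z)" using p by (simp add: U2_def z complex_eq_iff)
  then obtain x where x: "p = upt3 (of_real x) t" using z by metis
  have "act (map_matrix complex_of_real A) p \<in> U3" using p by (intro act_in_U3 map_matrix_SL2 A) (simp add: U2_def)
  moreover have "act (map_matrix complex_of_real A) p $ 2 = 0"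
    unfolding M x act_upt3 Let_def upt3_nth by (simp flip: of_real_power of_real_mult of_real_add of_real_divide)
  ultimately show ?thesis by (simp add: U2_def)
qed

lemma act_real_horocycle:
  assumes A: "A \<in> SL2" and x: "x \<noteq> 0"
  shows "act (map_matrix complex_of_real A) ` (spinor_horosphere (cvec x) \<inter> U2) = spinor_horosphere (cvec (A *v x)) \<inter> U2"
proof -
  let ?A = "map_matrix complex_of_real A"
  have cx: "cvec x \<noteq> 0" using x by simp
  have im: "act ?A ` spinor_horosphere (cvec x) = spinor_horosphere (cvec (A *v x))"
    using act_spinor_horosphere[OF map_matrix_SL2[OF A] cx] by (simp add: cvec_mult)
  have inv: "map_matrix complex_of_real (adj22 A) = adj22 ?A"
    by (rule mat22_eqI) (simp_all add: adj22_def)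
  have "p \<in> U2" if p: "p \<in> U3" "act ?A p \<in> U2" for p
    using act_real_U2[OF adj22_in_SL2[OF A] p(2)] act_adj22(2)[OF map_matrix_SL2[OF A] p(1)] by (simp add: inv)
  then have "act ?A p \<in> U2 \<longleftrightarrow> p \<in> U2" if "p \<in> spinor_horosphere (cvec x)" for p
    using act_real_U2[OF A, of p] spinor_horosphere_subset_U3[OF cx] that by auto
  then show ?thesis unfolding im[symmetric] by (auto simp: image_iff)
qed

lemma horocycle_inj:
  assumes z: "spinor_centre (cvec x) = z" and r: "r > 0" "r' > 0" and eq: "horocycle z r = horocycle z r'"
  shows "r = r'"
proof (cases z)
  case Infty
  have "upt3 0 r \<in> horocycle z r" using r by (simp add: horocycle_def horosphere_def Infty U2_def)
  then show ?thesis unfolding eq by (simp add: horocycle_def horosphere_def Infty)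
next
  case (Fin w)
  then have w: "Im w = 0" using z by (auto simp: spinor_centre_def split: if_splits)
  have d: "(dist (upt3 w (s / 2)) (upt3 w r))\<^sup>2 = (s / 2 - r)\<^sup>2" for s
    by (simp add: dist_upt3_sq)
  have "(dist (upt3 w (r / 2)) (upt3 w r))\<^sup>2 = (r / 2)\<^sup>2"
    unfolding d[of r] by (simp add: power2_eq_square field_simps)
  then have "dist (upt3 w (r / 2)) (upt3 w r) = r / 2"
    by (rule power2_eq_imp_eq) (use r in simp_all)
  then have "upt3 w r \<in> horocycle z r" using r w by (simp add: horocycle_def horosphere_def Fin U2_def)
  then have "dist (upt3 w (r' / 2)) (upt3 w r) = r' / 2" unfolding eq by (simp add: horocycle_def horosphere_def Fin)
  then have "(r' / 2 - r)\<^sup>2 = (r' / 2)\<^sup>2" by (simp only: d[of r', symmetric])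
  then have "r * (r - r') = 0" by (simp add: power2_eq_square field_simps)
  then show ?thesis using r by simp
qed

lemma real_spinor_up_to_sign:
  assumes "x \<noteq> 0" "y \<noteq> 0" "spinor_centre (cvec x) = spinor_centre (cvec y)" "spinor_size (cvec x) = spinor_size (cvec y)"
  shows "x = y \<or> x = - y"
proof (cases "x$2 = 0")
  case True
  then have y: "y$2 = 0" using assms(3) by (auto simp: spinor_centre_def split: if_splits)
  then have "(x$1)\<^sup>2 = (y$1)\<^sup>2" using True assms(4) by (simp add: spinor_size_def)
  then show ?thesis using True y by (auto simp: power2_eq_iff intro!: vec2_eqI)
next
  case False
  then have y: "y$2 \<noteq> 0" and e: "x$1 / x$2 = y$1 / y$2"
    using assms(3) by (auto simp: spinor_centre_def simp flip: of_real_divide split: if_splits)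
  then have "(x$2)\<^sup>2 = (y$2)\<^sup>2" using False assms(4) by (simp add: spinor_size_def)
  then have "x$2 = y$2 \<or> x$2 = - y$2" by (simp add: power2_eq_iff)
  moreover have "x$1 = y$1 / y$2 * x$2" using False by (simp flip: e)
  ultimately show ?thesis using y by (auto intro!: vec2_eqI)
qed

text \<open>Both sides are the trace of \<open>P\<^sup>-\<^sup>1 Q\<close> minus \<open>2\<close>, where \<open>P\<close> and \<open>Q\<close> are the Hermitian matrices of the two points. The right
side is visibly invariant under isometries, so this computes hyperbolic distances from matrices.\<close>

lemma dist_pt_busemann:
  assumes G: "G \<in> SL2" and p: "p \<in> U3"
  shows "(dist p (pt G))\<^sup>2 / (p$3 * pt G$3) = busemann (vector [G$1$1, G$2$1]) p + busemann (vector [G$1$2, G$2$2]) p - 2"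
proof -
  obtain a b c d where G: "G = mat22 a b c d" "a * d - b * c = 1" using SL2_cases[OF G] .
  obtain z t where z: "p = upt3 z t" by (rule upt3_cases)
  have t: "t > 0" using p by (simp add: z)
  define D where "D = (cmod c)\<^sup>2 + (cmod d)\<^sup>2"
  define Z where "Z = b * cnj d + a * cnj c"
  define N where "N = (cmod a)\<^sup>2 + (cmod b)\<^sup>2"
  have D: "D > 0" unfolding D_def by (rule SL2_row_pos[OF G(2)])
  have DC: "complex_of_real D = c * cnj c + d * cnj d" "complex_of_real N = a * cnj a + b * cnj b"
    by (simp_all only: D_def N_def of_real_add complex_norm_square)
  have F2: "cnj a * cnj d - cnj b * cnj c = 1"
    using G(2) by (metis complex_cnj_diff complex_cnj_mult complex_cnj_one)
  have "Z * cnj Z + (a * d - b * c) * (cnj a * cnj d - cnj b * cnj c) = of_real D * of_real N"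
    unfolding DC Z_def complex_cnj_add complex_cnj_mult complex_cnj_cnj by algebra
  then have "complex_of_real ((cmod Z)\<^sup>2 + 1) = of_real (D * N)"
    unfolding of_real_add complex_norm_square of_real_mult by (simp only: G(2) F2 mult_1 of_real_1)
  then have key: "(cmod Z)\<^sup>2 + 1 = D * N" by (simp only: of_real_eq_iff)
  have "(a - c * z) * cnj (a - c * z) + (b - d * z) * cnj (b - d * z)
     = of_real N - (cnj z * Z + z * cnj Z) + of_real D * (z * cnj z)"
    unfolding DC Z_def complex_cnj_add complex_cnj_mult complex_cnj_diff complex_cnj_cnj by algebra
  also have "cnj z * Z + z * cnj Z = of_real (2 * Re (cnj z * Z))"
    using complex_add_cnj[of "cnj z * Z"] by simp
  finally have "complex_of_real ((cmod (a - c * z))\<^sup>2 + (cmod (b - d * z))\<^sup>2)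
     = of_real (N - 2 * Re (cnj z * Z) + D * (cmod z)\<^sup>2)"
    unfolding of_real_add of_real_diff of_real_mult[of D] complex_norm_square .
  then have b: "(cmod (a - c * z))\<^sup>2 + (cmod (b - d * z))\<^sup>2 = N - 2 * Re (cnj z * Z) + D * (cmod z)\<^sup>2"
    by (simp only: of_real_eq_iff)
  have "busemann (vector [G$1$1, G$2$1]) p + busemann (vector [G$1$2, G$2$2]) p
     = ((cmod (a - c * z))\<^sup>2 + (cmod (b - d * z))\<^sup>2 + D * t\<^sup>2) / t"
    by (simp add: z G(1) busemann_upt3 D_def add_divide_distrib[symmetric] algebra_simps)
  then have l: "busemann (vector [G$1$1, G$2$1]) p + busemann (vector [G$1$2, G$2$2]) p
     = (N - 2 * Re (cnj z * Z) + D * (cmod z)\<^sup>2 + D * t\<^sup>2) / t" unfolding b .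
  have "(cmod (z - Z / of_real D))\<^sup>2 = (cmod z)\<^sup>2 - 2 * Re (cnj z * Z) / D + (cmod Z)\<^sup>2 / D\<^sup>2"
    using D unfolding cmod_power2 by (simp add: power2_eq_square field_simps)
  then have "(dist p (pt G))\<^sup>2 = (cmod z)\<^sup>2 - 2 * Re (cnj z * Z) / D + (cmod Z)\<^sup>2 / D\<^sup>2 + (t - 1 / D)\<^sup>2"
    unfolding z G(1) pt_mat22 Let_def D_def[symmetric] Z_def[symmetric] dist_upt3_sq by simp
  also have "\<dots> = (cmod z)\<^sup>2 - 2 * Re (cnj z * Z) / D + ((cmod Z)\<^sup>2 + 1) / D\<^sup>2 + t\<^sup>2 - 2 * t / D"
    by (simp add: power2_diff power_divide add_divide_distrib)
  also have "((cmod Z)\<^sup>2 + 1) / D\<^sup>2 = N / D" unfolding key using D by (simp add: power2_eq_square)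
  finally have "(dist p (pt G))\<^sup>2 = (N - 2 * Re (cnj z * Z) + D * (cmod z)\<^sup>2 + D * t\<^sup>2 - 2 * t) / D"
    using D by (simp add: diff_divide_distrib add_divide_distrib)
  moreover have "p$3 * pt G$3 = t / D"
    unfolding z G(1) pt_mat22 Let_def D_def[symmetric] by simp
  ultimately have "(dist p (pt G))\<^sup>2 / (p$3 * pt G$3) = (N - 2 * Re (cnj z * Z) + D * (cmod z)\<^sup>2 + D * t\<^sup>2 - 2 * t) / t"
    using D t by simp
  also have "\<dots> = (N - 2 * Re (cnj z * Z) + D * (cmod z)\<^sup>2 + D * t\<^sup>2) / t - 2"
    using t by (simp add: diff_divide_distrib)
  finally show ?thesis unfolding l .
qed

lemma det2_norm_le: "(cmod (det2 x y))\<^sup>2 \<le> (norm x)\<^sup>2 * (norm y)\<^sup>2" for x y :: "complex^2"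
proof -
  define a b c d where "a = cmod (x$1)" and "b = cmod (y$2)" and "c = cmod (x$2)" and "d = cmod (y$1)"
  have "cmod (det2 x y) \<le> a * b + c * d"
    using norm_triangle_ineq4[of "x$1 * y$2" "y$1 * x$2"] by (simp add: norm_mult a_def b_def c_def d_def mult.commute)
  then have "(cmod (det2 x y))\<^sup>2 \<le> (a * b + c * d)\<^sup>2" by (simp add: power_mono)
  also have "\<dots> \<le> (a * b + c * d)\<^sup>2 + (a * d - b * c)\<^sup>2" by simp
  also have "\<dots> = (a\<^sup>2 + c\<^sup>2) * (d\<^sup>2 + b\<^sup>2)" by (simp add: power2_eq_square algebra_simps)
  finally show ?thesis by (simp add: norm_vec2_sq a_def b_def c_def d_def)
qed

text \<open>Hadamard's inequality, read through \<open>busemann_pt\<close>. It shows that two horoballs are disjoint once the minor of their spinors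
has modulus at least \<open>1\<close>.\<close>

lemma det2_le_busemann:
  assumes p: "p \<in> U3"
  shows "(cmod (det2 \<kappa> \<kappa>'))\<^sup>2 \<le> busemann \<kappa> p * busemann \<kappa>' p"
proof -
  obtain F where F: "F \<in> SL2" "pt F = p" using pt_surj[OF p] .
  then show ?thesis
    using det2_norm_le[of "adj22 F *v \<kappa>" "adj22 F *v \<kappa>'"] det2_SL2[OF adj22_in_SL2[OF F(1)], of \<kappa> \<kappa>']
    by (simp add: busemann_pt flip: F(2))
qed

text \<open>The common perpendicular meets the two horocycles at \<open>pt E\<close> and \<open>pt (E ** diag \<delta>)\<close>, which are \<open>2 |ln \<delta>|\<close> apart. The horodiscs
are disjoint exactly for \<open>\<delta> \<ge> 1\<close>, so the sign convention makes the signed distance \<open>2 ln \<delta>\<close> in all cases.\<close>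

lemma real_lambda_det2:
  fixes x y :: "real^2"
  assumes pos: "det2 x y > 0"
  shows "real_lambda (spinor_centre (cvec x), spinor_horosphere (cvec x) \<inter> U2)
    (spinor_centre (cvec y), spinor_horosphere (cvec y) \<inter> U2) = det2 x y"
proof -
  define \<delta> where "\<delta> = det2 x y"
  define E where "E = geodesic_frame (cvec x) (cvec y)"
  have d: "det2 (cvec x) (cvec y) = of_real \<delta>" by (simp add: \<delta>_def)
  have \<delta>: "\<delta> > 0" using pos by (simp add: \<delta>_def)
  have dne: "det2 (cvec x) (cvec y) \<noteq> 0" unfolding d using \<delta> by simp
  note nz = spinors_nonzero[OF dne]
  let ?z = "spinor_centre (cvec x)" and ?w = "spinor_centre (cvec y)"
  let ?r = "spinor_size (cvec x)" and ?s = "spinor_size (cvec y)"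
  let ?q = "pt (E ** diag (of_real \<delta>))"
  have E: "E \<in> SL2" unfolding E_def by (rule geodesic_frame_in_SL2[OF dne])
  have EU: "E ** diag u \<in> SL2" if "u \<noteq> 0" for u unfolding E_def by (rule geodesic_frame_diag_in_SL2[OF dne that])
  have E1: "E ** diag 1 = E" by (simp add: diag_def flip: mat22_one)
  have real: "pt (E ** diag (of_real u)) \<in> U2" if "u \<noteq> 0" for u
  proof -
    have "pt (E ** diag (of_real u)) \<in> U3" using that by (intro pt_in_U3 EU) simp
    moreover have "pt (E ** diag (of_real u)) $ 2 = 0"
      unfolding E_def geodesic_frame_def d diag_def mat22_mult pt_mat22 Let_def upt3_nth
      by (simp flip: of_real_power of_real_mult of_real_add of_real_divide of_real_minus)
    ultimately show ?thesis by (simp add: U2_def)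
  qed
  have pq: "geodesic ?z ?w \<inter> horocycle ?z ?r = {pt E}" "geodesic ?z ?w \<inter> horocycle ?w ?s = {?q}"
    using geodesic_horosphere[OF dne] real[of 1] real[of \<delta>] \<delta>
    unfolding d by (auto simp: horocycle_def E1 simp flip: spinor_horosphere_def E_def)
  have bus: "busemann (cvec x) (pt (E ** diag u)) = (cmod u)\<^sup>2" "busemann (cvec y) (pt (E ** diag u)) = \<delta>\<^sup>2 / (cmod u)\<^sup>2"
    if "u \<noteq> 0" for u
    using busemann_geodesic_frame[OF dne that] \<delta> unfolding d by (simp_all flip: E_def)
  \<comment> \<open>for \<open>\<delta> < 1\<close> the midpoint of the two intersection points, at \<open>u = sqrt \<delta>\<close>, lies in both horoballs\<close>
  have disj: "horoball ?z ?r \<inter> horoball ?w ?s \<inter> U2 = {} \<longleftrightarrow> \<delta> \<ge> 1"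
  proof
    assume "\<delta> \<ge> 1"
    have False if p: "p \<in> U3" "busemann (cvec x) p < 1" "busemann (cvec y) p < 1" for p
    proof -
      have "\<delta>\<^sup>2 \<le> busemann (cvec x) p * busemann (cvec y) p"
        using det2_le_busemann[OF p(1), of "cvec x" "cvec y"] \<delta> unfolding d by simp
      moreover have "0 \<le> busemann (cvec y) p" using p(1) by (simp add: busemann_def U3_def)
      moreover have "0 \<le> busemann (cvec x) p" using p(1) by (simp add: busemann_def U3_def)
      ultimately have "\<delta>\<^sup>2 < 1" using p(2,3) mult_strict_mono'[of "busemann (cvec x) p" 1 "busemann (cvec y) p" 1] by simp
      then show False using \<open>\<delta> \<ge> 1\<close> by (simp add: power2_less_1_iff abs_if split: if_splits)
    qed
    then show "horoball ?z ?r \<inter> horoball ?w ?s \<inter> U2 = {}"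
      unfolding horoball_busemann[OF nz(1)] horoball_busemann[OF nz(2)] by auto
  next
    assume empty: "horoball ?z ?r \<inter> horoball ?w ?s \<inter> U2 = {}"
    show "\<delta> \<ge> 1"
    proof (rule ccontr)
      assume "\<not> \<delta> \<ge> 1"
      let ?u = "sqrt \<delta>"
      have u: "?u \<noteq> 0" "complex_of_real ?u \<noteq> 0" "(cmod (of_real ?u))\<^sup>2 = \<delta>" using \<delta> by simp_all
      have "?u\<^sup>2 = \<delta>" "\<delta>\<^sup>2 / \<delta> = \<delta>" using \<delta> by (simp_all add: power2_eq_square)
      then have "pt (E ** diag (of_real ?u)) \<in> horoball ?z ?r \<inter> horoball ?w ?s \<inter> U2"
        unfolding horoball_busemann[OF nz(1)] horoball_busemann[OF nz(2)]
        using real[OF u(1)] bus[OF u(2)] \<open>\<not> \<delta> \<ge> 1\<close> by (simp add: u(3) U2_def del: real_sqrt_eq_0_iff)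
      then show False using empty by blast
    qed
  qed
  have hd: "hyp_dist (pt E) ?q = \<bar>2 * ln \<delta>\<bar>"
  proof -
    let ?G = "E ** diag (of_real \<delta>)"
    have g: "(vector [?G$1$1, ?G$2$1] :: complex^2) = cvec y" "(vector [?G$1$2, ?G$2$2] :: complex^2) = (- 1 / of_real \<delta>) *s cvec x"
      using \<delta> unfolding E_def geodesic_frame_def d diag_def mat22_mult by (auto intro!: vec2_eqI)
    have sc: "busemann (k *s \<kappa>) p = (cmod k)\<^sup>2 * busemann \<kappa> p" for k \<kappa> p
    proof -
      have "cmod (k * \<kappa>$1 - k * (\<kappa>$2 * Complex (p$1) (p$2))) = cmod k * cmod (\<kappa>$1 - \<kappa>$2 * Complex (p$1) (p$2))"
        by (simp add: right_diff_distrib flip: norm_mult)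
      then show ?thesis
        by (simp add: busemann_def norm_mult power_mult_distrib mult.assoc flip: distrib_left)
    qed
    have bE: "busemann (cvec x) (pt E) = 1" "busemann (cvec y) (pt E) = \<delta>\<^sup>2"
      using bus[of 1] by (simp_all add: E1)
    have "busemann ((- 1 / of_real \<delta>) *s cvec x) (pt E) = 1 / \<delta>\<^sup>2"
      unfolding sc bE by (simp add: norm_divide power_divide)
    then have "(dist (pt E) ?q)\<^sup>2 / (pt E $ 3 * ?q $ 3) = \<delta>\<^sup>2 + 1 / \<delta>\<^sup>2 - 2"
      using dist_pt_busemann[OF EU pt_in_U3[OF E], of "of_real \<delta>"] \<delta> unfolding g bE by simp
    then have "1 + (dist (pt E) ?q)\<^sup>2 / (2 * pt E $ 3 * ?q $ 3) = (\<delta>\<^sup>2 + 1 / \<delta>\<^sup>2) / 2"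
      by (simp add: mult.assoc flip: divide_divide_eq_right)
        (simp add: field_simps)
    also have "\<dots> = cosh (2 * ln \<delta>)"
    proof -
      have "exp (2 * ln \<delta>) = \<delta>\<^sup>2" using \<delta> by (simp add: exp_double)
      then show ?thesis by (simp add: cosh_field_def exp_minus inverse_eq_divide)
    qed
    also have "\<dots> = cosh \<bar>2 * ln \<delta>\<bar>" by simp
    finally show ?thesis unfolding hyp_dist_def by (simp add: arcosh_cosh_real del: cosh_real_abs)
  qed
  have val: "(if horoball ?z ?r \<inter> horoball ?w ?s \<inter> U2 = {} then hyp_dist (pt E) ?q else - hyp_dist (pt E) ?q) = 2 * ln \<delta>"
    unfolding disj hd using \<delta> by (auto simp: abs_if ln_less_zero_iff not_le)
  have sizes: "?r > 0" "?s > 0" using spinor_size_pos nz by auto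
  have "signed_distance (?z, horocycle ?z ?r) (?w, horocycle ?w ?s) = 2 * ln \<delta>"
    unfolding signed_distance_def prod.case
  proof (rule the_equality)
    show "\<exists>r r' p q. 0 < r \<and> 0 < r' \<and> horocycle ?z ?r = horocycle ?z r \<and> horocycle ?w ?s = horocycle ?w r' \<and>
      p \<in> geodesic ?z ?w \<inter> horocycle ?z ?r \<and> q \<in> geodesic ?z ?w \<inter> horocycle ?w ?s \<and>
      2 * ln \<delta> = (if horoball ?z r \<inter> horoball ?w r' \<inter> U2 = {} then hyp_dist p q else - hyp_dist p q)"
      unfolding pq using sizes val by (intro exI[of _ ?r] exI[of _ ?s] exI[of _ "pt E"] exI[of _ ?q]) simp
  next
    fix \<rho>
    assume "\<exists>r r' p q. 0 < r \<and> 0 < r' \<and> horocycle ?z ?r = horocycle ?z r \<and> horocycle ?w ?s = horocycle ?w r' \<and>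
      p \<in> geodesic ?z ?w \<inter> horocycle ?z ?r \<and> q \<in> geodesic ?z ?w \<inter> horocycle ?w ?s \<and>
      \<rho> = (if horoball ?z r \<inter> horoball ?w r' \<inter> U2 = {} then hyp_dist p q else - hyp_dist p q)"
    then obtain r r' where r: "0 < r" "0 < r'" "horocycle ?z ?r = horocycle ?z r" "horocycle ?w ?s = horocycle ?w r'"
      and \<rho>: "\<rho> = (if horoball ?z r \<inter> horoball ?w r' \<inter> U2 = {} then hyp_dist (pt E) ?q else - hyp_dist (pt E) ?q)"
      unfolding pq by blast
    have "?r = r" "?s = r'" using horocycle_inj[OF refl sizes(1) r(1,3)] horocycle_inj[OF refl sizes(2) r(2,4)] .
    then show "\<rho> = 2 * ln \<delta>" using \<rho> val by simp
  qed
  then have "real_lambda (?z, horocycle ?z ?r) (?w, horocycle ?w ?s) = \<delta>"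
    using \<delta> by (simp add: real_lambda_def)
  then show ?thesis by (simp add: horocycle_def spinor_horosphere_def \<delta>_def)
qed

section \<open>Decorated ideal polygons\<close>

lemma Mat_pos_det2:
  assumes "M \<in> Mat_pos d" "i \<in> {1..d}" "j \<in> {1..d}" "i < j"
  shows "det2 (M i) (M j) > 0"
  using assms by (simp add: Mat_pos_def plucker_eq)

lemma Mat_pos_nonzero:
  assumes "d \<ge> 2" "M \<in> Mat_pos d" "i \<in> {1..d}" shows "M i \<noteq> 0"
proof -
  define j where "j = (if i = 1 then 2 else 1 :: nat)"
  have j: "j \<in> {1..d}" "j \<noteq> i" using assms by (auto simp: j_def)
  then have "det2 (M i) (M j) > 0 \<or> det2 (M j) (M i) > 0"
    using Mat_pos_det2[OF assms(2)] assms(3) nat_neq_iff by metis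
  then show ?thesis by auto
qed

text \<open>Steps in the cyclic order of \<open>{1..d}\<close>; the shifts by \<open>1\<close> are there because the indices start at \<open>1\<close>.\<close>

definition cyc :: "nat \<Rightarrow> nat \<Rightarrow> nat \<Rightarrow> nat"
  where "cyc d k m = (k - 1 + m) mod d + 1"

lemma cyc_eq:
  assumes "k \<in> {1..d}" "m < d"
  shows "cyc d k m = (if k + m \<le> d then k + m else k + m - d)"
proof (cases "k + m \<le> d")
  case True
  then have "k - 1 + m < d" using assms by auto
  then show ?thesis using True assms by (simp add: cyc_def)
next
  case False
  then have "(k - 1 + m) mod d = k - 1 + m - d" using assms by (simp add: le_mod_geq)
  then show ?thesis using False assms by (simp add: cyc_def)
qed

lemma cyc_in: "k \<in> {1..d} \<Longrightarrow> m < d \<Longrightarrow> cyc d k m \<in> {1..d}"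
  by (auto simp: cyc_eq)

text \<open>Positivity of all minors is not preserved by rotating the columns cyclically, but it is if the columns that wrap around
change sign. Signs do not affect horocycles, so this turns the linear order of columns into a cyclic order of vertices.\<close>

definition cyc_sign :: "nat \<Rightarrow> nat \<Rightarrow> nat \<Rightarrow> real"
  where "cyc_sign d k m = (if k + m \<le> d then 1 else - 1)"

lemma rotated_det2_pos:
  assumes M: "M \<in> Mat_pos d" and k: "k \<in> {1..d}" and mn: "m < n" "n < d"
  shows "det2 (cyc_sign d k m *\<^sub>R M (cyc d k m)) (cyc_sign d k n *\<^sub>R M (cyc d k n)) > 0"
proof -
  have c: "cyc d k m \<in> {1..d}" "cyc d k n \<in> {1..d}" using cyc_in[OF k] mn by auto
  consider "k + n \<le> d" | "k + m \<le> d" "k + n > d" | "k + m > d" by linarith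
  then show ?thesis
  proof cases
    case 2
    then have "cyc d k n < cyc d k m" using k mn by (auto simp: cyc_eq)
    then show ?thesis using Mat_pos_det2[OF M c(2,1)] 2 by (simp add: cyc_sign_def)
  qed (use Mat_pos_det2[OF M c] k mn in \<open>auto simp: cyc_sign_def cyc_eq split: if_splits\<close>)
qed

text \<open>If the second entries have a constant sign, a minor is a positive multiple of a difference \<open>x\<^sub>m - x\<^sub>n\<close> of centres. The index
\<open>start\<close> is \<open>1\<close> when the first vertex is \<open>\<infinity>\<close> and \<open>0\<close> otherwise.\<close>

lemma ideal_polygonI:
  assumes k: "k \<in> {1..d}"
    and det: "\<And>m n. m < n \<Longrightarrow> n < d \<Longrightarrow> det2 (K m) (K n) > 0"
    and same: "\<And>m n. start \<le> m \<Longrightarrow> m < n \<Longrightarrow> n < d \<Longrightarrow> K m $ 2 * K n $ 2 > (0::real)"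
    and nz: "\<And>m. start \<le> m \<Longrightarrow> m < d \<Longrightarrow> K m $ 2 \<noteq> 0"
    and z: "\<And>m. m < d \<Longrightarrow> z (cyc d k m) = spinor_centre (cvec (K m))"
    and start: "start = 0 \<or> start = 1 \<and> K 0 $ 2 = 0"
  shows "ideal_polygon d z"
proof -
  define x where "x m = K m $ 1 / K m $ 2" for m
  have x: "x m > x n" if "start \<le> m" "m < n" "n < d" for m n
  proof -
    have p: "K m $ 2 * K n $ 2 > 0" using same that by blast
    then have "x m - x n = det2 (K m) (K n) / (K m $ 2 * K n $ 2)"
      by (subst x_def, subst x_def, intro diff_frac_eq) auto
    moreover have "det2 (K m) (K n) / (K m $ 2 * K n $ 2) > 0" by (intro divide_pos_pos det p that)
    ultimately show ?thesis by linarith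
  qed
  have zx: "z (cyc d k m) = Fin (of_real (x m))" if "start \<le> m" "m < d" for m
    using z[OF that(2)] nz[OF that] by (simp add: spinor_centre_def x_def)
  show ?thesis
  proof (cases "start = 0")
    case True
    then show ?thesis unfolding ideal_polygon_def Let_def cyc_def[symmetric]
      using k x zx by (intro bexI[of _ k] exI[of _ x] disjI1) auto
  next
    case False
    then have start: "start = 1" "K 0 $ 2 = 0" using start by auto
    have "cyc d k 0 = k" using k by (auto simp: cyc_eq)
    then have "z k = Infty" using z[of 0] k start by (auto simp: spinor_centre_def)
    then show ?thesis unfolding ideal_polygon_def Let_def cyc_def[symmetric]
      using k x zx start by (intro bexI[of _ k] exI[of _ x] disjI2) auto
  qed
qed

text \<open>The columns turn anticlockwise through less than a half-turn, so the second entry changes sign at most once. Rotate the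
indices to start at the column on the real axis if there is one, and otherwise at the first column \<open>k\<close> whose second entry
has not the sign of that of column \<open>1\<close>, or at column \<open>1\<close> if all signs agree. The three-term relation
\<open>y\<^sub>k p\<^sub>1\<^sub>i = y\<^sub>i p\<^sub>1\<^sub>k + y\<^sub>1 p\<^sub>k\<^sub>i\<close> excludes a second change of sign.\<close>

lemma Mat_pos_ideal_polygon:
  assumes d: "d \<ge> 1" and M: "M \<in> Mat_pos d" and z: "\<And>i. i \<in> {1..d} \<Longrightarrow> z i = spinor_centre (cvec (M i))"
  shows "ideal_polygon d z"
proof -
  define K where "K k m = cyc_sign d k m *\<^sub>R M (cyc d k m)" for k m
  have det: "det2 (K k m) (K k n) > 0" if "k \<in> {1..d}" "m < n" "n < d" for k m n
    unfolding K_def by (rule rotated_det2_pos[OF M that])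
  have zK: "z (cyc d k m) = spinor_centre (cvec (K k m))" if "k \<in> {1..d}" "m < d" for k m
    using z[OF cyc_in[OF that]] by (simp add: K_def spinor_centre_def cyc_sign_def)
  show ?thesis
  proof (cases "\<exists>k\<in>{1..d}. M k $ 2 = 0")
    case True
    then obtain k where k: "k \<in> {1..d}" "M k $ 2 = 0" by blast
    then have K0: "K k 0 = M k" by (auto simp: K_def cyc_sign_def cyc_eq)
    have same: "M k $ 1 * K k n $ 2 > 0" if "1 \<le> n" "n < d" for n
      using det[OF k(1), of 0 n] that k(2) by (simp add: K0)
    show ?thesis
    proof (rule ideal_polygonI[where K = "K k" and start = 1, OF k(1) det[OF k(1)] _ _ zK[OF k(1)]])
      show "K k m $ 2 * K k n $ 2 > 0" if "1 \<le> m" "m < n" "n < d" for m n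
        using same[of m] same[of n] that by (auto simp: zero_less_mult_iff)
      show "K k m $ 2 \<noteq> 0" if "1 \<le> m" "m < d" for m using same[OF that] by auto
    qed (use k K0 in auto)
  next
    case False
    define y where "y i = M i $ 2" for i
    have y: "y i \<noteq> 0" if "i \<in> {1..d}" for i using False that by (auto simp: y_def)
    obtain k \<epsilon> where k: "k \<in> {1..d}" and \<epsilon>: "\<And>m. m < d \<Longrightarrow> K k m $ 2 * \<epsilon> > 0"
    proof (cases "\<forall>i\<in>{1..d}. y i * y 1 > 0")
      case True
      show ?thesis
      proof (rule that[of 1 "y 1"])
        show "1 \<in> {1..d}" using d by simp
        show "K 1 m $ 2 * y 1 > 0" if "m < d" for m
          using True that by (auto simp: K_def cyc_sign_def cyc_eq y_def)
      qed
    next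
      case no: False
      define k where "k = (LEAST i. i \<in> {1..d} \<and> \<not> y i * y 1 > 0)"
      have k: "k \<in> {1..d} \<and> \<not> y k * y 1 > 0" unfolding k_def by (rule LeastI_ex) (use no in blast)
      have before: "y i * y 1 > 0" if "i \<in> {1..d}" "i < k" for i
        using not_less_Least[of i "\<lambda>i. i \<in> {1..d} \<and> \<not> y i * y 1 > 0"] that unfolding k_def by blast
      have I1: "1 \<in> {1..d}" using d by simp
      have k1: "1 < k" using k y[OF I1] by (cases "k = 1") auto
      have yk: "y k * y 1 < 0" using k y[of k] y[OF I1] by (simp add: not_less le_less)
      have after: "y i * y 1 < 0" if i: "i \<in> {1..d}" "k \<le> i" for i
      proof (rule ccontr)
        assume "\<not> y i * y 1 < 0"
        then have yi: "y i * y 1 > 0" using y[OF i(1)] y[OF I1] by (simp add: not_less le_less)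
        then have ki: "k < i" using yk i(2) by (cases "i = k") auto
        have p: "det2 (M 1) (M k) > 0" "det2 (M k) (M i) > 0" "det2 (M 1) (M i) > 0"
          using Mat_pos_det2[OF M] I1 k i(1) k1 ki by auto
        have "y k * y 1 * det2 (M 1) (M i) = det2 (M 1) (M k) * (y i * y 1) + det2 (M k) (M i) * (y 1)\<^sup>2"
          by (simp add: y_def power2_eq_square algebra_simps)
        moreover have "\<dots> > 0" using p yi by (intro add_pos_nonneg) auto
        moreover have "y k * y 1 * det2 (M 1) (M i) < 0" using yk p(3) by (simp add: mult_neg_pos)
        ultimately show False by simp
      qed
      show ?thesis
      proof (rule that[of k "- y 1"])
        show "k \<in> {1..d}" using k by blast
        show "K k m $ 2 * - y 1 > 0" if m: "m < d" for m
        proof (cases "k + m \<le> d")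
          case True
          then show ?thesis using after[of "k + m"] k by (auto simp: K_def cyc_sign_def cyc_eq y_def)
        next
          case False
          then show ?thesis using before[of "k + m - d"] k m by (auto simp: K_def cyc_sign_def cyc_eq y_def)
        qed
      qed
    qed
    show ?thesis
    proof (rule ideal_polygonI[where K = "K k" and start = 0, OF k det[OF k] _ _ zK[OF k]])
      show "K k m $ 2 * K k n $ 2 > 0" if "m < n" "n < d" for m n
        using \<epsilon>[of m] \<epsilon>[of n] that by (auto simp: zero_less_mult_iff)
      show "K k m $ 2 \<noteq> 0" if "m < d" for m using \<epsilon>[OF that] by auto
    qed auto
  qed
qed

text \<open>The columns before position \<open>k\<close>, which come last in the cyclic order that starts at \<open>k\<close>, are negated: a minor of a column
before \<open>k\<close> and a column from \<open>k\<close> on then changes sign twice, once by reversing the order and once by the negation.\<close>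

lemma unrotate_Mat_pos:
  assumes k: "k \<in> {1..d}" and det: "\<And>m n. m < n \<Longrightarrow> n < d \<Longrightarrow> det2 (K m) (K n) > 0"
  obtains M where "M \<in> Mat_pos d" "\<forall>i\<in>{1..d}. \<exists>m<d. cyc d k m = i \<and> (M i = K m \<or> M i = - K m)"
proof -
  define m where "m i = (if k \<le> i then i - k else i + d - k)" for i
  define M where "M = (\<lambda>i\<in>{1..d}. if k \<le> i then K (m i) else - K (m i))"
  have m: "m i < d \<and> cyc d k (m i) = i" if "i \<in> {1..d}" for i
    using that k cyc_eq[OF k, of "m i"] by (auto simp: m_def)
  have "det2 (M i) (M j) > 0" if ij: "i \<in> {1..d}" "j \<in> {1..d}" "i < j" for i j
  proof -
    consider "k \<le> i" | "j < k" | "i < k" "k \<le> j" by linarith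
    then show ?thesis
    proof cases
      case 3
      then have "m j < m i" "m i < d" using ij k by (auto simp: m_def)
      then show ?thesis using det[of "m j" "m i"] 3 ij by (simp add: M_def)
    qed (use det[of "m i" "m j"] ij k in \<open>auto simp: M_def m_def\<close>)
  qed
  then have "M \<in> Mat_pos d" by (auto simp: Mat_pos_def plucker_eq M_def)
  moreover have "\<exists>n<d. cyc d k n = i \<and> (M i = K n \<or> M i = - K n)" if "i \<in> {1..d}" for i
    using m[OF that] that by (intro exI[of _ "m i"]) (simp add: M_def)
  ultimately show ?thesis using that by blast
qed

lemma ideal_polygon_Mat_pos:
  assumes z: "ideal_polygon d z" and r: "\<And>i. i \<in> {1..d} \<Longrightarrow> r i > 0"
  obtains M where "M \<in> Mat_pos d" "\<forall>i\<in>{1..d}. spinor_centre (cvec (M i)) = z i \<and> spinor_size (cvec (M i)) = r i"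
proof -
  obtain k x where k: "k \<in> {1..d}" and kx:
    "((\<forall>m\<in>{0..<d}. z (cyc d k m) = Fin (of_real (x m))) \<and> (\<forall>m n. m < n \<and> n < d \<longrightarrow> x m > x n)) \<or>
      (z k = Infty \<and> (\<forall>m\<in>{1..<d}. z (cyc d k m) = Fin (of_real (x m))) \<and>
        (\<forall>m n. 1 \<le> m \<and> m < n \<and> n < d \<longrightarrow> x m > x n))"
    using z unfolding ideal_polygon_def Let_def cyc_def[symmetric] by blast
  define \<rho> where "\<rho> m = sqrt (r (cyc d k m))" for m
  have \<rho>: "\<rho> m > 0" "(\<rho> m)\<^sup>2 = r (cyc d k m)" if "m < d" for m
    using r[OF cyc_in[OF k that]] by (simp_all add: \<rho>_def)
  \<comment> \<open>the real spinor with the given centre and size, normalised by a nonnegative second entry\<close>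
  define K :: "nat \<Rightarrow> real^2" where "K m = (if z (cyc d k m) = Infty then vector [\<rho> m, 0] else vector [x m / \<rho> m, 1 / \<rho> m])" for m
  have K: "spinor_centre (cvec (K m)) = z (cyc d k m) \<and> spinor_size (cvec (K m)) = r (cyc d k m)" if m: "m < d" for m
  proof (cases "z (cyc d k m) = Infty")
    case True
    then show ?thesis using \<rho>[OF m] by (simp add: K_def spinor_centre_def spinor_size_def)
  next
    case False
    have "cyc d k 0 = k" using k by (auto simp: cyc_eq)
    then have "m = 0 \<Longrightarrow> z (cyc d k m) = z k" by simp
    moreover have "m \<in> {0..<d}" "m = 0 \<or> m \<in> {1..<d}" using m by auto
    ultimately have "z (cyc d k m) = Fin (of_real (x m))" using kx False by metis
    then show ?thesis using \<rho>[OF m] False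
      by (simp add: K_def spinor_centre_def spinor_size_def power_divide norm_divide)
  qed
  have det: "det2 (K m) (K n) > 0" if mn: "m < n" "n < d" for m n
  proof -
    have fin: "z (cyc d k n) = Fin (of_real (x n))" using kx mn by (cases n) auto
    have ck: "cyc d k 0 = k" using k by (auto simp: cyc_eq)
    show ?thesis
    proof (cases "z (cyc d k m) = Infty")
      case True
      then show ?thesis using fin \<rho>(1)[of m] \<rho>(1)[of n] mn by (simp add: K_def)
    next
      case False
      then have "x m > x n" using kx mn ck by (cases m) auto
      moreover have "det2 (K m) (K n) = (x m - x n) / (\<rho> m * \<rho> n)"
        using False fin by (simp add: K_def diff_divide_distrib)
      ultimately show ?thesis using \<rho>(1)[of m] \<rho>(1)[of n] mn by simp
    qed
  qed
  obtain M where M: "M \<in> Mat_pos d" "\<forall>i\<in>{1..d}. \<exists>m<d. cyc d k m = i \<and> (M i = K m \<or> M i = - K m)"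
    by (rule unrotate_Mat_pos[of k d K, OF k det])
  show ?thesis
  proof (rule that[OF M(1)], intro ballI)
    fix i assume "i \<in> {1..d}"
    then obtain m where m: "m < d" "cyc d k m = i" "M i = K m \<or> M i = - K m" using M(2) by blast
    have "spinor_centre (cvec (- v)) = spinor_centre (cvec v)" "spinor_size (cvec (- v)) = spinor_size (cvec v)" for v
      by (simp_all add: spinor_centre_def spinor_size_def)
    then show "spinor_centre (cvec (M i)) = z i \<and> spinor_size (cvec (M i)) = r i"
      using K[OF m(1)] m(2,3) by auto
  qed
qed

text \<open>Horocycles determine real spinors only up to sign. This is harmless: columns of two matrices that agree up to signs have
minors agreeing up to sign, and these are positive on both sides. Conversely the signs of the spinors of a given polygon
can be chosen to make all minors positive, by \<open>ideal_polygon_Mat_pos\<close>.\<close>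

lemma ideal_polygons:
  assumes d: "d \<ge> 2"
  shows "\<exists>f. bij_betw f (cone_pos d) (Teich2 d) \<and>
        (\<forall>M\<in>Mat_pos d.
          f (row_wedge d M) = dec_polygon_rel d `` {horocycle_polygon d M} \<and>
          (\<forall>P\<in>f (row_wedge d M). \<forall>i\<in>{1..d}. \<forall>j\<in>{1..d}.
            i < j \<longrightarrow> real_lambda (P i) (P j) = plucker M i j))"
proof -
  let ?h = "horocycle_polygon d"
  have ne: "M i \<noteq> 0" if "M \<in> Mat_pos d" "i \<in> {1..d}" for M i using Mat_pos_nonzero[OF d that] .
  have hi: "?h M i = (spinor_centre (cvec (M i)), horocycle (spinor_centre (cvec (M i))) (spinor_size (cvec (M i))))"
    if "i \<in> {1..d}" for M i using that by (simp add: horocycle_polygon_def spinor_horosphere_def horocycle_def)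
  have surj: "?h ` Mat_pos d = dec_polygons d"
  proof (intro equalityI subsetI)
    fix P assume "P \<in> ?h ` Mat_pos d"
    then obtain M where M: "M \<in> Mat_pos d" "P = ?h M" by blast
    have "ideal_polygon d (\<lambda>i. fst (P i))"
      by (rule Mat_pos_ideal_polygon[OF _ M(1)]) (use d hi in \<open>auto simp: M(2)\<close>)
    moreover have "\<exists>r>0. snd (P i) = horocycle (fst (P i)) r" if "i \<in> {1..d}" for i
      using spinor_size_pos[of "cvec (M i)"] ne[OF M(1) that] hi[OF that, of M] by (auto simp: M(2))
    ultimately show "P \<in> dec_polygons d" by (auto simp: dec_polygons_def M(2) horocycle_polygon_def)
  next
    fix P assume P: "P \<in> dec_polygons d"
    then have "\<forall>i\<in>{1..d}. \<exists>r>0. snd (P i) = horocycle (fst (P i)) r" by (simp add: dec_polygons_def)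
    then obtain r where r: "\<And>i. i \<in> {1..d} \<Longrightarrow> r i > 0" "\<And>i. i \<in> {1..d} \<Longrightarrow> snd (P i) = horocycle (fst (P i)) (r i)"
      by metis
    have poly: "ideal_polygon d (\<lambda>i. fst (P i))" using P by (simp add: dec_polygons_def)
    obtain M where M: "M \<in> Mat_pos d"
      "\<forall>i\<in>{1..d}. spinor_centre (cvec (M i)) = fst (P i) \<and> spinor_size (cvec (M i)) = r i"
      by (rule ideal_polygon_Mat_pos[OF poly r(1)])
    have "P i = ?h M i" for i
    proof (cases "i \<in> {1..d}")
      case True
      then show ?thesis using bspec[OF M(2) True] r(2)[OF True] hi[OF True] by (simp add: prod_eq_iff)
    next
      case False
      then show ?thesis using P by (auto simp: dec_polygons_def extensional_def horocycle_polygon_def)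
    qed
    then show "P \<in> ?h ` Mat_pos d" using M(1) by blast
  qed
  have rel: "(?h M, ?h N) \<in> dec_polygon_rel d \<longleftrightarrow> row_wedge d M = row_wedge d N"
    if M: "M \<in> Mat_pos d" and N: "N \<in> Mat_pos d" for M N
  proof -
    have "?h M \<in> dec_polygons d" "?h N \<in> dec_polygons d" using surj M N by blast+
    then have "(?h M, ?h N) \<in> dec_polygon_rel d \<longleftrightarrow> (\<exists>A :: real^2^2 \<in> SL2. \<forall>i\<in>{1..d}.
        spinor_centre (cvec (N i)) = mobius (map_matrix complex_of_real A) (spinor_centre (cvec (M i))) \<and>
        spinor_horosphere (cvec (N i)) \<inter> U2 = act (map_matrix complex_of_real A) ` (spinor_horosphere (cvec (M i)) \<inter> U2))"
      by (auto simp: dec_polygon_rel_def horocycle_polygon_def Let_def)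
    also have "\<dots> \<longleftrightarrow> (\<exists>A :: real^2^2 \<in> SL2. \<forall>i\<in>{1..d}. N i = A *v M i \<or> N i = - (A *v M i))"
    proof (intro bex_cong refl ball_cong)
      fix A :: "real^2^2" and i assume A: "A \<in> SL2" and i: "i \<in> {1..d}"
      have nz: "M i \<noteq> 0" "N i \<noteq> 0" using ne M N i by auto
      have nz': "A *v M i \<noteq> 0"
        using adj22_cancel_vec(1)[OF A, of "M i"] nz(1) by auto
      have c: "mobius (map_matrix complex_of_real A) (spinor_centre (cvec (M i))) = spinor_centre (cvec (A *v M i))"
        using mobius_spinor_centre[OF map_matrix_SL2[OF A], of "cvec (M i)"] nz(1) by (simp add: cvec_mult)
      show "(spinor_centre (cvec (N i)) = mobius (map_matrix complex_of_real A) (spinor_centre (cvec (M i))) \<and>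
        spinor_horosphere (cvec (N i)) \<inter> U2 = act (map_matrix complex_of_real A) ` (spinor_horosphere (cvec (M i)) \<inter> U2))
        \<longleftrightarrow> N i = A *v M i \<or> N i = - (A *v M i)"
        unfolding c act_real_horocycle[OF A nz(1)]
      proof
        assume *: "spinor_centre (cvec (N i)) = spinor_centre (cvec (A *v M i)) \<and>
          spinor_horosphere (cvec (N i)) \<inter> U2 = spinor_horosphere (cvec (A *v M i)) \<inter> U2"
        have sizes: "spinor_size (cvec (N i)) > 0" "spinor_size (cvec (A *v M i)) > 0"
          using spinor_size_pos nz(2) nz' cvec_eq_0_iff by blast+
        have "horocycle (spinor_centre (cvec (N i))) (spinor_size (cvec (N i))) =
            horocycle (spinor_centre (cvec (N i))) (spinor_size (cvec (A *v M i)))"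
          using conjunct2[OF *] unfolding spinor_horosphere_def horocycle_def conjunct1[OF *] .
        from horocycle_inj[OF refl sizes this]
        show "N i = A *v M i \<or> N i = - (A *v M i)"
          using real_spinor_up_to_sign[OF nz(2) nz'] * by blast
      next
        have "spinor_centre (cvec (- v)) = spinor_centre (cvec v)" "spinor_horosphere (cvec (- v)) = spinor_horosphere (cvec v)" for v
          by (simp_all add: spinor_centre_def spinor_size_def spinor_horosphere_def)
        then show "N i = A *v M i \<or> N i = - (A *v M i) \<Longrightarrow> spinor_centre (cvec (N i)) = spinor_centre (cvec (A *v M i)) \<and>
          spinor_horosphere (cvec (N i)) \<inter> U2 = spinor_horosphere (cvec (A *v M i)) \<inter> U2" by auto
      qed
    qed
    also have "\<dots> \<longleftrightarrow> row_wedge d M = row_wedge d N"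
    proof
      assume "\<exists>A :: real^2^2 \<in> SL2. \<forall>i\<in>{1..d}. N i = A *v M i \<or> N i = - (A *v M i)"
      then obtain A :: "real^2^2" where A: "A \<in> SL2" "\<And>i. i \<in> {1..d} \<Longrightarrow> N i = A *v M i \<or> N i = - (A *v M i)" by blast
      have abs: "\<bar>det2 (N i) (N j)\<bar> = \<bar>det2 (M i) (M j)\<bar>" if ij: "i \<in> {1..d}" "j \<in> {1..d}" for i j
      proof -
        have neg: "\<bar>det2 (- a) b\<bar> = \<bar>det2 a b\<bar>" "\<bar>det2 a (- b)\<bar> = \<bar>det2 a b\<bar>" for a b :: "real^2"
          by (simp_all add: abs_if)
        have "\<bar>det2 (N i) (N j)\<bar> = \<bar>det2 (A *v M i) (A *v M j)\<bar>"
          using A(2)[OF ij(1)] A(2)[OF ij(2)] neg by metis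
        then show ?thesis using det2_SL2[OF A(1)] by simp
      qed
      have lt: "det2 (M i) (M j) = det2 (N i) (N j)" if "i \<in> {1..d}" "j \<in> {1..d}" "i < j" for i j
        using abs[OF that(1,2)] Mat_pos_det2[OF M that] Mat_pos_det2[OF N that] by linarith
      have "det2 (M i) (M j) = det2 (N i) (N j)" if ij: "i \<in> {1..d}" "j \<in> {1..d}" for i j
      proof (cases i j rule: linorder_cases)
        case greater
        then show ?thesis using lt[OF ij(2,1)] by linarith
      qed (use lt[OF ij] in auto)
      then show "row_wedge d M = row_wedge d N" unfolding row_wedge_eq_iff by blast
    next
      assume eq: "row_wedge d M = row_wedge d N"
      have I: "1 \<in> {1..d}" "2 \<in> {1..d}" using d by simp_all
      obtain A where "A \<in> SL2" "\<And>k. k \<in> {1..d} \<Longrightarrow> N k = A *v M k"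
      proof (rule equal_minors_SL2[OF I])
        show "det2 (M 1) (M 2) \<noteq> 0" using Mat_pos_det2[OF M I] by simp
        show "det2 (M k) (M l) = det2 (N k) (N l)" if "k \<in> {1..d}" "l \<in> {1..d}" for k l
          using eq that unfolding row_wedge_eq_iff by blast
      qed blast
      then show "\<exists>A :: real^2^2 \<in> SL2. \<forall>i\<in>{1..d}. N i = A *v M i \<or> N i = - (A *v M i)" by blast
    qed
    finally show ?thesis .
  qed
  have "dec_polygon_rel d \<subseteq> dec_polygons d \<times> dec_polygons d" by (auto simp: dec_polygon_rel_def)
  from quotient_bijection[where w = "row_wedge d", OF surj this rel]
  obtain f where f: "bij_betw f (row_wedge d ` Mat_pos d) (dec_polygons d // dec_polygon_rel d)"
    "\<And>M. M \<in> Mat_pos d \<Longrightarrow> f (row_wedge d M) = dec_polygon_rel d `` {?h M}"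
    "\<And>M P. M \<in> Mat_pos d \<Longrightarrow> P \<in> f (row_wedge d M) \<Longrightarrow> \<exists>N\<in>Mat_pos d. row_wedge d N = row_wedge d M \<and> P = ?h N"
    by blast
  have "real_lambda (P i) (P j) = plucker M i j"
    if M: "M \<in> Mat_pos d" and P: "P \<in> f (row_wedge d M)" and ij: "i \<in> {1..d}" "j \<in> {1..d}" "i < j" for M P i j
  proof -
    obtain N where N: "N \<in> Mat_pos d" "row_wedge d N = row_wedge d M" "P = ?h N" using f(3)[OF M P] by blast
    have "real_lambda (P i) (P j) = det2 (N i) (N j)"
      using real_lambda_det2[OF Mat_pos_det2[OF N(1) ij]] ij by (simp add: N(3) horocycle_polygon_def)
    then show ?thesis using N(2) ij by (simp add: row_wedge_eq_iff plucker_eq)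
  qed
  then show ?thesis using f(1,2) unfolding cone_pos_def Teich2_def by blast
qed

theorem theorem4:
  fixes d :: nat and \<Phi> :: "complex^2 \<Rightarrow> spin_horosphere"
  assumes "d \<ge> 3" and "spinor_correspondence \<Phi>"
  shows
    "(\<exists>f. bij_betw f (cone_pos d) (Teich2 d) \<and>
        (\<forall>M\<in>Mat_pos d.
          f (row_wedge d M) = dec_polygon_rel d `` {horocycle_polygon d M} \<and>
          (\<forall>P\<in>f (row_wedge d M). \<forall>i\<in>{1..d}. \<forall>j\<in>{1..d}.
            i < j \<longrightarrow> real_lambda (P i) (P j) = plucker M i j))) \<and>
     (\<exists>f. bij_betw f (cone_nz d) (Teich3 d) \<and>
        (\<forall>M\<in>Mat_nz d.
          f (row_wedge d M) = spin_polygon_rel d `` {horosphere_polygon \<Phi> d M} \<and>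
          (\<forall>P\<in>f (row_wedge d M). \<forall>i\<in>{1..d}. \<forall>j\<in>{1..d}.
            i < j \<longrightarrow> complex_lambda (P i) (P j) = plucker M i j)))"
  using ideal_polygons skew_polygons assms by simp

end
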